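(* Let $v^1\in\mathbf{A}^{r_1\times n_1}$ and $v^2\in\mathbf{A}^{r_2\times n_2}$, and let $v^1\oplus v^2\in\mathbf{A}^{r\times n}$ be their direct sum, with $r=r_1+r_2$ and $n=n_1+n_2$. Then $$\mathcal{K}(X_{v^1\oplus v^2})=\rho^{r_2}\mathcal{K}(X_{v^1})\cdot\rho^{r_1}\mathcal{K}(X_{v^2}).$$
   Context: $\mathbf{k}$ is an algebraically closed field of characteristic zero. For $v\in\mathbf{A}^{r\times n}$ (the space of $r$-by-$n$ matrices), $X_v$ is the Zariski closure of the orbit of $v$ under $\mathrm{GL}_r(\mathbf{k})\times(\mathbf{k}^\times)^n$, acting by left multiplication and rescaling of columns. The direct sum $v^1\oplus v^2$ is the block diagonal matrix with blocks $v^1,v^2$. The coordinate ring $R=\mathbf{k}[x_{ij}]$ of $\mathbf{A}^{r\times n}$ is graded by $\mathbb{Z}^r\times\mathbb{Z}^n$ with $\deg x_{ij}=a_i+b_j$ (standard basis vectors). For a closed subvariety $X$ with ideal $I$, $\mathcal{K}(X)$ is the polynomial with $\sum\dim_{\mathbf{k}}((R/I)_{(\mathbf{a},\mathbf{b})})u^{\mathbf{a}}t^{\mathbf{b}}=\mathcal{K}(X)/\prod_{i=1}^r\prod_{j=1}^n(1-u_it_j)$. In the claim, $\mathcal{K}(X_{v^1\oplus v^2})$ is in variables $u_1,\dots,u_r,t_1,\dots,t_n$; $\mathcal{K}(X_{v^1})$ is in $u_1,\dots,u_{r_1}$ and $t_1,\dots,t_{n_1}$; and $\mathcal{K}(X_{v^2})$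 is in $u_1,\dots,u_{r_2}$ and $t_{n_1+1},\dots,t_n$. Operators: for any integer tuple $\lambda\in\mathbb{Z}^m$ put $s_\lambda(x_1,\dots,x_m)=\det(x_i^{\lambda_j+m-j})_{i,j}/\det(x_i^{m-j})_{i,j}$. For each number $m$ of $u$ variables, $\rho_k$ is the map from polynomials symmetric in $u_1,\dots,u_m$ to polynomials symmetric in $u_1,\dots,u_{m+1}$, linear over the $t$ variables, with $\rho_k\,s_\lambda(u_1,\dots,u_m)=s_{(\lambda_1,\dots,\lambda_m,k)}(u_1,\dots,u_{m+1})$ for every partition $\lambda=(\lambda_1\ge\dots\ge\lambda_m\ge0)$. Set $\rho=\sum_{k\ge0}(-1)^ke_k(t)\rho_k$, where $e_k(t)$ is the elementary symmetric polynomial in the $t$ variables of the matrix space in question ($t_1,\dots,t_{n_1}$ when applied to $\mathcal{K}(X_{v^1})$, and $t_{n_1+1},\dots,t_n$ when applied to $\mathcal{K}(X_{v^2})$). $\rho^m$ is the $m$-fold iterate, each application increasing the number of $u$ variables by one. *)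

theory Defs
  imports
    "HOL-Library.Poly_Mapping"
    "HOL-Computational_Algebra.Polynomial"
    "Jordan_Normal_Form.Determinant"
begin

text \<open>
  Polynomials over \<open>'b\<close> in a set of variables \<open>'x\<close> are elements of the monoid algebra
  \<open>('x \<Rightarrow>\<^sub>0 nat) \<Rightarrow>\<^sub>0 'b\<close>. Rows and columns of matrices, and the variables \<open>u\<close> and \<open>t\<close>,
  are numbered from 0.
\<close>

type_synonym ('x, 'b) mpoly = "('x \<Rightarrow>\<^sub>0 nat) \<Rightarrow>\<^sub>0 'b"

definition Const :: "'b::zero \<Rightarrow> ('x, 'b) mpoly" where
  "Const c = Poly_Mapping.single 0 c"

definition Var :: "'x \<Rightarrow> ('x, 'b::zero_neq_one) mpoly" where
  "Var x = Poly_Mapping.single (Poly_Mapping.single x 1) 1"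

definition polys_in :: "'x set \<Rightarrow> ('x, 'b::zero) mpoly set" where
  "polys_in A = {p. \<forall>m \<in> Poly_Mapping.keys p. Poly_Mapping.keys m \<subseteq> A}"


subsection \<open>The affine space of matrices and orbit closures\<close>

abbreviation coord_ring :: "nat \<Rightarrow> nat \<Rightarrow> (nat \<times> nat, 'k::zero) mpoly set" where
  "coord_ring r n \<equiv> polys_in ({..<r} \<times> {..<n})"

definition eval_at :: "'k::comm_ring_1 mat \<Rightarrow> (nat \<times> nat, 'k) mpoly \<Rightarrow> 'k" where
  "eval_at w p = (\<Sum>m \<in> Poly_Mapping.keys p. Poly_Mapping.lookup p m *
     (\<Prod>x \<in> Poly_Mapping.keys m. (w $$ x) ^ Poly_Mapping.lookup m x))"

definition zariski_closed :: "nat \<Rightarrow> nat \<Rightarrow> 'k::field mat set \<Rightarrow> bool" where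
  "zariski_closed r n Z \<longleftrightarrow>
     (\<exists>P \<subseteq> coord_ring r n. Z = {w \<in> carrier_mat r n. \<forall>p \<in> P. eval_at w p = 0})"

definition zariski_closure :: "nat \<Rightarrow> nat \<Rightarrow> 'k::field mat set \<Rightarrow> 'k mat set" where
  "zariski_closure r n S = \<Inter> {Z. zariski_closed r n Z \<and> S \<subseteq> Z}"

definition vanishing_ideal :: "nat \<Rightarrow> nat \<Rightarrow> 'k::field mat set \<Rightarrow> (nat \<times> nat, 'k) mpoly set" where
  "vanishing_ideal r n X = {p \<in> coord_ring r n. \<forall>w \<in> X. eval_at w p = 0}"

definition matrix_orbit :: "nat \<Rightarrow> nat \<Rightarrow> 'k::field mat \<Rightarrow> 'k mat set" where
  "matrix_orbit r n v =
     {g * v * mat_diag n c | g c. g \<in> carrier_mat r r \<and> invertible_mat g \<and> (\<forall>j<n. c j \<noteq> 0)}"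

definition orbit_closure :: "nat \<Rightarrow> nat \<Rightarrow> 'k::field mat \<Rightarrow> 'k mat set" where
  "orbit_closure r n v = zariski_closure r n (matrix_orbit r n v)"

definition mat_direct_sum :: "'k::zero mat \<Rightarrow> 'k mat \<Rightarrow> 'k mat" where
  "mat_direct_sum v w = four_block_mat v (0\<^sub>m (dim_row v) (dim_col w)) (0\<^sub>m (dim_row w) (dim_col v)) w"


subsection \<open>Multigraded Hilbert series and K-polynomials\<close>

datatype kvar = U nat | T nat

text \<open>
  Multidegrees are written as monomials in \<open>u\<close> and \<open>t\<close>. The graded pieces in degrees with a
  negative component vanish, so that exponents in \<open>nat\<close> are enough. The parameter \<open>d\<close> is an
  offset of the column variables: the degree of \<open>x\<^sub>i\<^sub>j\<close> is that of \<open>u\<^sub>i t\<^sub>d\<^sub>+\<^sub>j\<close>.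
\<close>

definition multidegree :: "nat \<Rightarrow> (nat \<times> nat \<Rightarrow>\<^sub>0 nat) \<Rightarrow> (kvar \<Rightarrow>\<^sub>0 nat)" where
  "multidegree d m = (\<Sum>(i, j) \<in> Poly_Mapping.keys m.
     Poly_Mapping.single (U i) (Poly_Mapping.lookup m (i, j)) +
     Poly_Mapping.single (T (d + j)) (Poly_Mapping.lookup m (i, j)))"

definition graded_piece :: "nat \<Rightarrow> nat \<Rightarrow> nat \<Rightarrow> (kvar \<Rightarrow>\<^sub>0 nat) \<Rightarrow> (nat \<times> nat, 'k::zero) mpoly set" where
  "graded_piece r n d e =
     {p \<in> coord_ring r n. \<forall>m \<in> Poly_Mapping.keys p. multidegree d m = e}"

text \<open>The classes of the elements of \<open>B\<close> form a basis of the image of \<open>V\<close> in the quotient by \<open>I\<close>.\<close>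

definition basis_modulo ::
    "('x, 'k::field) mpoly set \<Rightarrow> ('x, 'k) mpoly set \<Rightarrow> ('x, 'k) mpoly set \<Rightarrow> bool" where
  "basis_modulo I V B \<longleftrightarrow> finite B \<and> B \<subseteq> V \<and>
     (\<forall>c. (\<Sum>b\<in>B. Const (c b) * b) \<in> I \<longrightarrow> (\<forall>b\<in>B. c b = 0)) \<and>
     (\<forall>p\<in>V. \<exists>c. p - (\<Sum>b\<in>B. Const (c b) * b) \<in> I)"

definition quotient_dim :: "('x, 'k::field) mpoly set \<Rightarrow> ('x, 'k) mpoly set \<Rightarrow> nat" where
  "quotient_dim I V = (THE N. \<exists>B. basis_modulo I V B \<and> card B = N)"

definition hilbert_fun :: "nat \<Rightarrow> nat \<Rightarrow> nat \<Rightarrow> 'k::field mat set \<Rightarrow> (kvar \<Rightarrow>\<^sub>0 nat) \<Rightarrow> nat" where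
  "hilbert_fun r n d X e = quotient_dim (vanishing_ideal r n X) (graded_piece r n d e)"

text \<open>
  The defining identity is cleared of its denominator and compared coefficientwise: the
  coefficients of the polynomial are those of the product of the Hilbert series with
  \<open>\<Prod>(1 - u\<^sub>i t\<^sub>j)\<close>. The set of pairs \<open>(a, b)\<close> is finite.
\<close>

definition K_poly :: "nat \<Rightarrow> nat \<Rightarrow> nat \<Rightarrow> 'k::field mat set \<Rightarrow> (kvar, int) mpoly" where
  "K_poly r n d X = (THE K. \<forall>e. Poly_Mapping.lookup K e =
     (\<Sum>(a, b) | a + b = e. int (hilbert_fun r n d X a) *
        Poly_Mapping.lookup (\<Prod>i<r. \<Prod>j<n. 1 - Var (U i) * Var (T (d + j))) b))"


subsection \<open>The operators on symmetric polynomials\<close>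

text \<open>
  The bialternant is only needed for tuples of natural numbers, where it is a polynomial.
  The exponent of the \<open>j\<close>-th column is \<open>\<lambda>\<^sub>j + m - j\<close> for \<open>j\<close> counted from 1.
\<close>

definition alternant :: "nat list \<Rightarrow> (kvar, int) mpoly" where
  "alternant l = (let m = length l in
     det (mat m m (\<lambda>(i, j). Var (U i) ^ (l ! j + (m - Suc j)))))"

definition schur :: "nat list \<Rightarrow> (kvar, int) mpoly" where
  "schur l = (THE s. s * alternant (replicate (length l) 0) = alternant l)"

definition partitions :: "nat \<Rightarrow> nat list set" where
  "partitions m = {l. length l = m \<and> sorted_wrt (\<ge>) l}"

fun permute_u :: "(nat \<Rightarrow> nat) \<Rightarrow> kvar \<Rightarrow> kvar" where
  "permute_u \<pi> (U i) = U (\<pi> i)"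
| "permute_u \<pi> (T j) = T j"

text \<open>Polynomials in \<open>u\<^sub>0, \<dots>, u\<^bsub>m-1\<^esub>\<close> and all \<open>t\<close>, symmetric in the former.\<close>

definition sym_polys :: "nat \<Rightarrow> (kvar, int) mpoly set" where
  "sym_polys m = {p \<in> polys_in (U ` {..<m} \<union> range T).
     \<forall>\<pi> a. \<pi> permutes {..<m} \<longrightarrow>
       Poly_Mapping.lookup p (Poly_Mapping.map_key (permute_u \<pi>) a) = Poly_Mapping.lookup p a}"

text \<open>
  The linear map is made unique as a HOL function by letting it be 0 off its domain.
\<close>

definition is_rho :: "nat \<Rightarrow> nat \<Rightarrow> ((kvar, int) mpoly \<Rightarrow> (kvar, int) mpoly) \<Rightarrow> bool" where
  "is_rho k m \<phi> \<longleftrightarrow>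
     (\<forall>p \<in> sym_polys m. \<phi> p \<in> sym_polys (Suc m)) \<and>
     (\<forall>p \<in> sym_polys m. \<forall>q \<in> sym_polys m. \<phi> (p + q) = \<phi> p + \<phi> q) \<and>
     (\<forall>c \<in> polys_in (range T). \<forall>p \<in> sym_polys m. \<phi> (c * p) = c * \<phi> p) \<and>
     (\<forall>l \<in> partitions m. \<phi> (schur l) = schur (l @ [k])) \<and>
     (\<forall>p. p \<notin> sym_polys m \<longrightarrow> \<phi> p = 0)"

definition rho_comp :: "nat \<Rightarrow> nat \<Rightarrow> (kvar, int) mpoly \<Rightarrow> (kvar, int) mpoly" where
  "rho_comp k m = (THE \<phi>. is_rho k m \<phi>)"

definition elem_sym :: "nat set \<Rightarrow> nat \<Rightarrow> (kvar, int) mpoly" where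
  "elem_sym J k = (\<Sum>S | S \<subseteq> J \<and> card S = k. \<Prod>j\<in>S. Var (T j))"

text \<open>
  Here \<open>J\<close> is the finite set of indices of the \<open>t\<close> variables and \<open>m\<close> the number of \<open>u\<close> variables
  of the argument. The terms with \<open>k > card J\<close> are omitted because \<open>elem_sym J k\<close> is then 0.
\<close>

definition rho :: "nat set \<Rightarrow> nat \<Rightarrow> (kvar, int) mpoly \<Rightarrow> (kvar, int) mpoly" where
  "rho J m p = (\<Sum>k\<le>card J. (-1) ^ k * elem_sym J k * rho_comp k m p)"

fun rho_iter :: "nat set \<Rightarrow> nat \<Rightarrow> nat \<Rightarrow> (kvar, int) mpoly \<Rightarrow> (kvar, int) mpoly" where
  "rho_iter J m 0 p = p"
| "rho_iter J m (Suc s) p = rho J (m + s) (rho_iter J m s p)"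

end

theory Submission
  imports
    Defs
    "HOL-Library.Function_Algebras"
    "HOL-Library.Product_Lexorder"
    "Jordan_Normal_Form.Char_Poly"
begin

text \<open>
  For an \<open>r \<times> n\<close> matrix \<open>v\<close> and any number \<open>m\<close> of rows, let \<open>H\<^sub>m\<close> be the multigraded Hilbert
  series of the closure of all \<open>g v t\<close>, where \<open>g\<close> is an arbitrary \<open>m \<times> r\<close> matrix and \<open>t\<close> a torus
  element. For \<open>m = r\<close> this is the orbit closure of \<open>v\<close>, because invertible \<open>g\<close> are dense. Writing
  \<open>g = (g\<^sub>1 | g\<^sub>2)\<close> shows that the orbit closure of a direct sum is a product of two such varieties
  with \<open>m = r\<^sub>1 + r\<^sub>2\<close>, so its Hilbert series is a product. It remains to see that multiplying
  \<open>H\<^sub>m\<close> by \<open>\<Prod>(1 - u\<^sub>i t\<^sub>j)\<close> gives polynomials \<open>K\<^sub>m\<close> with \<open>K\<^bsub>m+1\<^esub> = \<rho> K\<^sub>m\<close> for \<open>m \<ge> r\<close>.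

  Expanding bialternants along the last column, \<open>\<rho> p\<close> times the Vandermonde determinant is the
  determinant with rows \<open>(u\<^sub>i\<^sup>m, \<dots>, u\<^sub>i, E(u\<^sub>i) p(u without u\<^sub>i))\<close>, where \<open>E(u) = \<Prod>(1 - u t\<^sub>j)\<close>.
  So one needs the analogous determinantal formula for \<open>H\<^bsub>m+1\<^esub>\<close> with \<open>E\<close> replaced by 1. Adjoin to the
  coordinate ring the products of a monomial in the entries of \<open>g v\<close> with a minor of \<open>y v\<close>, where
  \<open>y\<close> consists of \<open>j\<close> further (odd) rows, and let \<open>H\<^sup>j\<close> be the Hilbert series of this part. Substituting
  the \<open>i\<close>-th row of \<open>g\<close> for an odd row is a Koszul differential, exact in characteristic 0 by
  polarisation, whence \<open>\<Sum>\<^sub>j (-u\<^sub>i)\<^sup>j H\<^sup>j = H\<^sub>m(u without u\<^sub>i)\<close>. As \<open>v\<close> has rank at most \<open>r \<le> m\<close>, only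
  \<open>j \<le> m\<close> occur, and Cramer's rule for this Vandermonde system computes \<open>H\<^sup>0 = H\<^bsub>m+1\<^esub>\<close>.
\<close>

text \<open>Hilbert series are infinite, so they never occur as such. Each is cut off at an
  arbitrary t-degree \<open>D\<close>, which makes it a polynomial, and identities hold modulo
  t-degree above \<open>D\<close>. The operators \<open>\<rho>\<close> respect these congruences
  because the Vandermonde determinant to be cancelled contains no t.

  Coordinate rings occur as spaces of functions of \<open>g\<close> and of the odd rows, spanned by
  explicit generators of each formal multidegree; the Koszul differential and its homotopy are then
  operators on functions. The odd rows carry no u-degree. Hence substituting row i of
  \<open>g\<close> for one of them raises the exponent of the i-th u variable by one, and the
  alternating sums of the complexes become a Vandermonde system.

  Two facts stand apart from this argument. That the products called K are polynomials comes from
  standard monomials and Dickson's lemma. That \<open>rho_comp\<close> is given by a determinant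
  rests on uniqueness of the linear map: m! times a symmetric polynomial is a combination of Schur
  polynomials, and m! can be cancelled in a domain of characteristic zero.\<close>

text \<open>An arbitrary linear order, which makes the polynomials an integral domain.\<close>

instantiation kvar :: linorder
begin

fun kvar_code :: "kvar \<Rightarrow> nat" where
  "kvar_code (U i) = 2 * i"
| "kvar_code (T j) = Suc (2 * j)"

definition less_eq_kvar :: "kvar \<Rightarrow> kvar \<Rightarrow> bool" where
  "x \<le> y \<longleftrightarrow> kvar_code x \<le> kvar_code y"

definition less_kvar :: "kvar \<Rightarrow> kvar \<Rightarrow> bool" where
  "x < y \<longleftrightarrow> kvar_code x < kvar_code y"

lemma kvar_code_inject: "kvar_code x = kvar_code y \<longleftrightarrow> x = y"
  by (cases x; cases y) (simp_all, presburger+)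

instance
  by standard (auto simp: less_eq_kvar_def less_kvar_def kvar_code_inject simp flip: kvar_code_inject)

end

abbreviation "lookup \<equiv> Poly_Mapping.lookup"
abbreviation "keys \<equiv> Poly_Mapping.keys"
abbreviation "single \<equiv> Poly_Mapping.single"

section \<open>Substitution homomorphisms\<close>

definition mev :: "('x \<Rightarrow> 'c::comm_monoid_mult) \<Rightarrow> ('x \<Rightarrow>\<^sub>0 nat) \<Rightarrow> 'c" where
  "mev \<sigma> m = (\<Prod>x\<in>keys m. \<sigma> x ^ lookup m x)"

lemma mev_superset:
  assumes "finite A" "keys m \<subseteq> A"
  shows "mev \<sigma> m = (\<Prod>x\<in>A. \<sigma> x ^ lookup m x)"
  unfolding mev_def using assms
  by (intro prod.mono_neutral_left) (auto simp: in_keys_iff)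

lemma mev_0 [simp]: "mev \<sigma> 0 = 1"
  by (simp add: mev_def)

lemma mev_single [simp]: "mev \<sigma> (single x n) = \<sigma> x ^ n"
  by (cases "n = 0") (simp_all add: mev_def)

lemma mev_add: "mev \<sigma> (m + m') = mev \<sigma> m * mev \<sigma> m'"
proof -
  let ?A = "keys m \<union> keys m'"
  have "mev \<sigma> (m + m') = (\<Prod>x\<in>?A. \<sigma> x ^ lookup (m + m') x)"
    by (rule mev_superset) (simp_all add: keys_add)
  also have "\<dots> = mev \<sigma> m * mev \<sigma> m'"
    by (subst (1 2) mev_superset[of ?A]) (auto simp: lookup_add power_add prod.distrib)
  finally show ?thesis .
qed

lemma mev_sum: "mev \<sigma> (sum f A) = (\<Prod>a\<in>A. mev \<sigma> (f a))"
  by (induction A rule: infinite_finite_induct) (auto simp: mev_add)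

lemma mev_cong: "(\<And>x. x \<in> keys m \<Longrightarrow> \<sigma> x = \<tau> x) \<Longrightarrow> mev \<sigma> m = mev \<tau> m"
  by (simp add: mev_def)

lemma mev_mult: "mev (\<lambda>x. \<sigma> x * \<tau> x) m = mev \<sigma> m * mev \<tau> m"
  by (simp add: mev_def power_mult_distrib prod.distrib)

lemma poly_mapping_sum_singles:
  assumes "finite A" "keys p \<subseteq> A"
  shows "p = (\<Sum>m\<in>A. single m (lookup p m))"
proof (rule poly_mapping_eqI)
  fix k
  have "lookup (\<Sum>m\<in>A. single m (lookup p m)) k = (\<Sum>m\<in>A. if m = k then lookup p m else 0)"
    by (simp add: lookup_sum lookup_single when_def)
  also have "\<dots> = lookup p k"
    using assms by (auto simp: sum.delta in_keys_iff)
  finally show "lookup p k = lookup (\<Sum>m\<in>A. single m (lookup p m)) k" by simp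
qed

text \<open>Integer coefficients have a canonical image in every commutative ring, so a substitution
  is determined by the images of the variables alone.\<close>

definition msub :: "('x \<Rightarrow> 'c::comm_ring_1) \<Rightarrow> ('x, int) mpoly \<Rightarrow> 'c" where
  "msub \<sigma> p = (\<Sum>m\<in>keys p. of_int (lookup p m) * mev \<sigma> m)"

lemma msub_superset:
  assumes "finite A" "keys p \<subseteq> A"
  shows "msub \<sigma> p = (\<Sum>m\<in>A. of_int (lookup p m) * mev \<sigma> m)"
  unfolding msub_def using assms
  by (intro sum.mono_neutral_left) (auto simp: in_keys_iff)

lemma msub_0 [simp]: "msub \<sigma> 0 = 0"
  by (simp add: msub_def)

lemma msub_single [simp]: "msub \<sigma> (single m c) = of_int c * mev \<sigma> m"
  by (cases "c = 0") (simp_all add: msub_def)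

lemma msub_1 [simp]: "msub \<sigma> 1 = 1"
  using msub_single[of \<sigma> 0 1] by simp

lemma msub_Var [simp]: "msub \<sigma> (Var x) = \<sigma> x"
  by (simp add: Var_def)

lemma msub_add: "msub \<sigma> (p + q) = msub \<sigma> p + msub \<sigma> q"
proof -
  let ?A = "keys p \<union> keys q"
  have "msub \<sigma> (p + q) = (\<Sum>m\<in>?A. of_int (lookup (p + q) m) * mev \<sigma> m)"
    by (rule msub_superset) (simp_all add: keys_add)
  also have "\<dots> = msub \<sigma> p + msub \<sigma> q"
    by (subst (1 2) msub_superset[of ?A]) (auto simp: lookup_add ring_distribs sum.distrib)
  finally show ?thesis .
qed

lemma msub_sum: "msub \<sigma> (sum f A) = (\<Sum>a\<in>A. msub \<sigma> (f a))"
  by (induction A rule: infinite_finite_induct) (auto simp: msub_add)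

lemma msub_mult: "msub \<sigma> (p * q) = msub \<sigma> p * msub \<sigma> q"
proof -
  have "p * q = (\<Sum>m\<in>keys p. \<Sum>m'\<in>keys q. single (m + m') (lookup p m * lookup q m'))"
    using sum_product[of "\<lambda>m. single m (lookup p m)" "keys p" "\<lambda>m. single m (lookup q m)" "keys q"]
      poly_mapping_sum_singles[of "keys p" p] poly_mapping_sum_singles[of "keys q" q]
    by (simp add: mult_single)
  then have "msub \<sigma> (p * q) =
      msub \<sigma> (\<Sum>m\<in>keys p. \<Sum>m'\<in>keys q. single (m + m') (lookup p m * lookup q m'))"
    by (rule arg_cong)
  also have "\<dots> = msub \<sigma> p * msub \<sigma> q"
    by (simp add: msub_sum mev_add msub_def[of _ p] msub_def[of _ q] sum_product algebra_simps)
  finally show ?thesis .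
qed

lemma monomial_induct [case_names zero add]:
  fixes m :: "'x \<Rightarrow>\<^sub>0 nat"
  assumes "P 0" and add: "\<And>m x. P m \<Longrightarrow> P (m + single x 1)"
  shows "P m"
proof -
  have step: "P m \<Longrightarrow> P (m + single x k)" for m x k
  proof (induction k)
    case (Suc k)
    then show ?case using add[of "m + single x k" x] by (simp add: add.assoc flip: single_add)
  qed simp
  have "P (\<Sum>x\<in>A. single x (lookup m x))" if "finite A" for A
    using that
  proof (induction A rule: finite_induct)
    case (insert x F)
    then show ?case using step[OF insert.IH, of x "lookup m x"] by (simp add: add.commute)
  qed (simp add: assms(1))
  then show ?thesis by (subst poly_mapping_sum_singles[of "keys m" m]) auto
qed

interpretation msub: comm_ring_hom "msub \<sigma>"
  by unfold_locales (simp_all add: msub_add msub_mult)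

lemma mev_Var: "mev Var m = (single m 1 :: ('x, int) mpoly)"
proof -
  have "mev Var (sum f A) = (single (sum f A) 1 :: ('x, int) mpoly)"
    if "finite A" "\<And>a. mev Var (f a) = (single (f a) 1 :: ('x, int) mpoly)" for f and A :: "'x set"
    using that(1) by (induction A rule: finite_induct) (simp_all add: mev_add that(2) mult_single)
  moreover have "mev Var (single x n) = (single (single x n) 1 :: ('x, int) mpoly)" for x :: 'x and n
    by (induction n) (simp_all add: Var_def mult_single flip: single_add)
  ultimately show ?thesis
    by (subst (1 2) poly_mapping_sum_singles[of "keys m" m]) auto
qed

lemma int_mpoly_induct [case_names const Var add mult]:
  fixes p :: "('x, int) mpoly"
  assumes "\<And>c. P (of_int c)" "\<And>x. P (Var x)"
    and add: "\<And>p q. P p \<Longrightarrow> P q \<Longrightarrow> P (p + q)" and mult: "\<And>p q. P p \<Longrightarrow> P q \<Longrightarrow> P (p * q)"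
  shows "P p"
proof -
  have pow: "P q \<Longrightarrow> P (q ^ n)" for q and n :: nat
    by (induction n) (use assms(1)[of 1] mult in auto)
  have "P (\<Prod>x\<in>A. Var x ^ lookup m x)" if "finite A" for A and m :: "'x \<Rightarrow>\<^sub>0 nat"
    using that by (induction A rule: finite_induct) (use assms(1)[of 1] assms(2) pow mult in auto)
  then have mono: "P (single m 1)" for m
    by (simp add: mev_def flip: mev_Var)
  have single: "P (single m c)" for m c
    using mult[OF assms(1)[of c] mono[of m]] by (simp add: mult_single flip: single_of_int)
  have "P 0" using assms(1)[of 0] by simp
  have "P (\<Sum>m\<in>A. single m (lookup p m))" if "finite A" for A
    using that by (induction A rule: finite_induct) (use add single \<open>P 0\<close> in auto)
  then show ?thesis
    by (subst poly_mapping_sum_singles[of "keys p" p]) auto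
qed

lemma msub_msub: "msub \<sigma> (msub \<tau> p) = msub (\<lambda>x. msub \<sigma> (\<tau> x)) p"
  by (induction p rule: int_mpoly_induct) (simp_all add: msub_add msub_mult msub.hom_of_int)

lemma msub_Var_id [simp]: "msub Var p = p"
  by (induction p rule: int_mpoly_induct) (simp_all add: msub_add msub_mult msub.hom_of_int)

lemma msub_cong: "(\<And>m x. m \<in> keys p \<Longrightarrow> x \<in> keys m \<Longrightarrow> \<sigma> x = \<tau> x) \<Longrightarrow> msub \<sigma> p = msub \<tau> p"
  unfolding msub_def by (intro sum.cong arg_cong2[of _ _ _ _ "(*)"] mev_cong) auto

lemma msub_cong_polys_in: "p \<in> polys_in A \<Longrightarrow> (\<And>x. x \<in> A \<Longrightarrow> \<sigma> x = \<tau> x) \<Longrightarrow> msub \<sigma> p = msub \<tau> p"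
  by (rule msub_cong) (auto simp: polys_in_def)

lemma lookup_of_int_mult: "lookup (of_int c * p) m = c * lookup p m"
proof -
  have "lookup (single 0 c * p) m = c * lookup p m"
    unfolding mult_map_scale_conv_mult[symmetric]
    by (simp add: Poly_Mapping.map.rep_eq when_def)
  moreover have "single 0 c = (of_int c :: ('a \<Rightarrow>\<^sub>0 int))"
    by (metis of_int_eq_id id_apply single_of_int)
  ultimately show ?thesis by simp
qed

text \<open>This ring homomorphism kills the variables outside \<open>A\<close>, and
  \<open>polys_in A\<close> is its fixed set. Closure of \<open>polys_in A\<close> under ring
  operations and determinants thereby becomes formal.\<close>

definition restrict_vars :: "'x set \<Rightarrow> ('x, int) mpoly \<Rightarrow> ('x, int) mpoly" where
  "restrict_vars A = msub (\<lambda>x. if x \<in> A then Var x else 0)"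

lemma mev_restrict:
  fixes A :: "'x set"
  shows "mev (\<lambda>x. if x \<in> A then Var x else 0) m =
    (if keys m \<subseteq> A then single m 1 else 0 :: ('x, int) mpoly)"
proof (cases "keys m \<subseteq> A")
  case True
  then show ?thesis by (auto simp flip: mev_Var intro!: mev_cong)
next
  case False
  then obtain x where "x \<in> keys m" "x \<notin> A" by auto
  then have "mev (\<lambda>x. if x \<in> A then Var x else 0) m = (0 :: ('x, int) mpoly)"
    unfolding mev_def by (intro prod_zero bexI[of _ x]) (auto simp: in_keys_iff zero_power)
  then show ?thesis using False by simp
qed

lemma lookup_restrict_vars:
  "lookup (restrict_vars A p) m = (if keys m \<subseteq> A then lookup p m else 0)"
proof -
  have "lookup (restrict_vars A p) m = (\<Sum>m'\<in>insert m (keys p). lookup (of_int (lookup p m') * (if keys m' \<subseteq> A then single m' 1 else 0)) m)"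
    unfolding restrict_vars_def
    by (subst msub_superset[of "insert m (keys p)"]) (auto simp: mev_restrict lookup_sum simp del: sum.insert)
  also have "\<dots> = (\<Sum>m'\<in>insert m (keys p). if m' = m then (if keys m \<subseteq> A then lookup p m else 0) else 0)"
    by (intro sum.cong) (auto simp: mult_single lookup_single when_def simp flip: single_of_int)
  also have "\<dots> = (if keys m \<subseteq> A then lookup p m else 0)"
    by (subst sum.delta) auto
  finally show ?thesis .
qed

lemma polys_in_iff: "p \<in> polys_in A \<longleftrightarrow> restrict_vars A p = p"
  by (auto simp: poly_mapping_eq_iff fun_eq_iff lookup_restrict_vars polys_in_def in_keys_iff)

interpretation restrict_vars: comm_ring_hom "restrict_vars A"
  unfolding restrict_vars_def by unfold_locales

context
  fixes A :: "'x set"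
begin

lemma polys_in_Var: "x \<in> A \<Longrightarrow> (Var x :: ('x, int) mpoly) \<in> polys_in A"
  by (simp add: polys_in_iff restrict_vars_def)

lemma polys_in_add: "p \<in> polys_in A \<Longrightarrow> q \<in> polys_in A \<Longrightarrow> p + q \<in> polys_in A"
  for p q :: "('x, int) mpoly"
  by (simp add: polys_in_iff restrict_vars.hom_add)

lemma polys_in_mult: "p \<in> polys_in A \<Longrightarrow> q \<in> polys_in A \<Longrightarrow> p * q \<in> polys_in A"
  for p q :: "('x, int) mpoly"
  by (simp add: polys_in_iff restrict_vars.hom_mult)

lemma polys_in_minus: "p \<in> polys_in A \<Longrightarrow> q \<in> polys_in A \<Longrightarrow> p - q \<in> polys_in A"
  for p q :: "('x, int) mpoly"
  by (simp add: polys_in_iff restrict_vars.hom_minus)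

lemma polys_in_of_int: "(of_int c :: ('x, int) mpoly) \<in> polys_in A"
  by (simp add: polys_in_iff restrict_vars.hom_of_int)

lemma polys_in_1: "(1 :: ('x, int) mpoly) \<in> polys_in A"
  using polys_in_of_int[of 1] by simp

lemma polys_in_power: "p \<in> polys_in A \<Longrightarrow> p ^ n \<in> polys_in A" for p :: "('x, int) mpoly"
  by (induction n) (auto intro: polys_in_mult polys_in_1)

lemma polys_in_sum: "(\<And>i. i \<in> I \<Longrightarrow> f i \<in> polys_in A) \<Longrightarrow> sum f I \<in> polys_in A"
  for f :: "'i \<Rightarrow> ('x, int) mpoly"
  by (simp add: polys_in_iff restrict_vars.hom_sum)

lemma polys_in_prod: "(\<And>i. i \<in> I \<Longrightarrow> f i \<in> polys_in A) \<Longrightarrow> prod f I \<in> polys_in A"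
  for f :: "'i \<Rightarrow> ('x, int) mpoly"
  by (simp add: polys_in_iff restrict_vars.hom_prod)

lemma polys_in_det:
  fixes f :: "nat \<times> nat \<Rightarrow> ('x, int) mpoly"
  assumes "\<And>i j. i < n \<Longrightarrow> j < n \<Longrightarrow> f (i, j) \<in> polys_in A"
  shows "det (mat n n f) \<in> polys_in A"
proof -
  have "map_mat (restrict_vars A) (mat n n f) = mat n n f"
    by (rule eq_matI) (use assms in \<open>auto simp: polys_in_iff\<close>)
  then show ?thesis
    unfolding polys_in_iff by (metis restrict_vars.hom_det)
qed

end

lemma polys_in_mono: "p \<in> polys_in A \<Longrightarrow> A \<subseteq> B \<Longrightarrow> p \<in> polys_in B"
  by (auto simp: polys_in_def)

text \<open>Exponents are added up over the fibres of \<open>f\<close>. Projections of index pairs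
  give row and column degrees, a constant map gives the total degree, an injective map a
  renaming.\<close>

definition push_mono :: "('x \<Rightarrow> 'y) \<Rightarrow> ('x \<Rightarrow>\<^sub>0 nat) \<Rightarrow> ('y \<Rightarrow>\<^sub>0 nat)" where
  "push_mono f m = (\<Sum>x\<in>keys m. single (f x) (lookup m x))"

lemma push_mono_superset:
  assumes "finite A" "keys m \<subseteq> A"
  shows "push_mono f m = (\<Sum>x\<in>A. single (f x) (lookup m x))"
  unfolding push_mono_def using assms
  by (intro sum.mono_neutral_left) (auto simp: in_keys_iff)

lemma push_mono_0 [simp]: "push_mono f 0 = 0"
  by (simp add: push_mono_def)

lemma push_mono_single [simp]: "push_mono f (single x n) = single (f x) n"
  by (cases "n = 0") (simp_all add: push_mono_def)

lemma push_mono_add: "push_mono f (m + m') = push_mono f m + push_mono f m'"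
proof -
  let ?A = "keys m \<union> keys m'"
  have "push_mono f (m + m') = (\<Sum>x\<in>?A. single (f x) (lookup (m + m') x))"
    by (rule push_mono_superset) (simp_all add: keys_add)
  also have "\<dots> = push_mono f m + push_mono f m'"
    by (subst (1 2) push_mono_superset[of ?A]) (auto simp: lookup_add single_add sum.distrib)
  finally show ?thesis .
qed

lemma keys_push_mono: "keys (push_mono f m) = f ` keys m"
proof (rule Set.set_eqI)
  fix y
  have "lookup (push_mono f m) y = (\<Sum>x\<in>keys m. if f x = y then lookup m x else 0)"
    by (simp add: push_mono_def lookup_sum lookup_single when_def)
  then have "y \<in> keys (push_mono f m) \<longleftrightarrow> (\<exists>x\<in>keys m. f x = y)"
    by (auto simp: in_keys_iff)
  then show "y \<in> keys (push_mono f m) \<longleftrightarrow> y \<in> f ` keys m" by auto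
qed

lemma mev_push_mono: "mev \<sigma> (push_mono f m) = mev (\<lambda>x. \<sigma> (f x)) m"
  by (simp add: push_mono_def mev_sum mev_def[of "\<lambda>x. \<sigma> (f x)"])

lemma map_key_push_mono:
  assumes "inj f"
  shows "Poly_Mapping.map_key f (push_mono f m) = m"
  by (rule poly_mapping_eqI, subst map_key.rep_eq[OF assms])
     (use assms in \<open>auto simp: push_mono_def lookup_sum lookup_single when_def inj_eq sum.delta in_keys_iff\<close>)

lemma lookup_push_mono: "inj f \<Longrightarrow> lookup (push_mono f m) (f x) = lookup m x"
  using arg_cong[OF map_key_push_mono, of f "\<lambda>p. lookup p x" m] by (simp add: map_key.rep_eq)

lemma push_mono_map_key:
  assumes "inj f" "keys e \<subseteq> range f"
  shows "push_mono f (Poly_Mapping.map_key f e) = e"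
proof (rule poly_mapping_eqI)
  fix y
  show "lookup (push_mono f (Poly_Mapping.map_key f e)) y = lookup e y"
  proof (cases "y \<in> range f")
    case True
    then obtain x where [simp]: "y = f x" by auto
    show ?thesis by (simp add: lookup_push_mono[OF assms(1)] map_key.rep_eq[OF assms(1)])
  next
    case False
    then have "y \<notin> keys e" "y \<notin> keys (push_mono f (Poly_Mapping.map_key f e))"
      using assms(2) by (auto simp: keys_push_mono)
    then show ?thesis by (simp add: in_keys_iff)
  qed
qed

lemma mev_rename:
  assumes "inj f"
  shows "lookup (mev (\<lambda>x. Var (f x)) m) e =
    (if keys e \<subseteq> range f \<and> Poly_Mapping.map_key f e = m then 1 else 0 :: int)"
proof -
  have "mev (\<lambda>x. Var (f x)) m = (single (push_mono f m) 1 :: ('b, int) mpoly)"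
    by (simp add: mev_push_mono flip: mev_Var)
  moreover have "push_mono f m = e \<longleftrightarrow> keys e \<subseteq> range f \<and> Poly_Mapping.map_key f e = m"
    using push_mono_map_key[OF assms, of e] map_key_push_mono[OF assms, of m] keys_push_mono[of f m] by auto
  ultimately show ?thesis by (simp only: lookup_single when_def)
qed

text \<open>On coefficients a renaming is the pullback of exponent vectors. This translates the
  symmetry condition of \<open>sym_polys\<close>, stated through \<open>map_key\<close>, into
  invariance under substitutions.\<close>

lemma lookup_msub_rename:
  assumes "inj f"
  shows "lookup (msub (\<lambda>x. Var (f x)) p) e =
    (if keys e \<subseteq> range f then lookup p (Poly_Mapping.map_key f e) else 0)"
proof -
  let ?m = "Poly_Mapping.map_key f e"
  have "lookup (msub (\<lambda>x. Var (f x)) p) e =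
      (\<Sum>m\<in>insert ?m (keys p). lookup (of_int (lookup p m) * mev (\<lambda>x. Var (f x)) m) e)"
    by (subst msub_superset[of "insert ?m (keys p)"]) (auto simp: lookup_sum simp del: sum.insert)
  also have "\<dots> = (\<Sum>m\<in>insert ?m (keys p). if m = ?m then (if keys e \<subseteq> range f then lookup p m else 0) else 0)"
  proof (intro sum.cong refl)
    fix m
    show "lookup (of_int (lookup p m) * mev (\<lambda>x. Var (f x)) m) e =
      (if m = ?m then (if keys e \<subseteq> range f then lookup p m else 0) else 0)"
      by (simp add: lookup_of_int_mult mev_rename[OF assms] eq_commute[of m])
  qed
  also have "\<dots> = (if keys e \<subseteq> range f then lookup p ?m else 0)"
    by (subst sum.delta) auto
  finally show ?thesis .
qed

section \<open>Alternating polynomials\<close>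

lemma vandermonde_det:
  fixes x :: "nat \<Rightarrow> 'a::comm_ring_1"
  shows "det (mat m m (\<lambda>(i, j). x i ^ (m - Suc j))) = (\<Prod>i<m. \<Prod>j\<in>{i<..<m}. x i - x j)"
proof (induction m arbitrary: x)
  case 0
  show ?case by (simp add: det_dim_zero)
next
  case (Suc m)
  let ?V = "mat (Suc m) (Suc m) (\<lambda>(i, j). x i ^ (Suc m - Suc j))"
  \<comment> \<open>Right multiplication by \<open>?L\<close> subtracts \<open>x 0\<close> times the
    next column from every column but the last, which clears the first row except for its last
    entry.\<close>
  let ?L = "mat (Suc m) (Suc m) (\<lambda>(i, j). if i = j then 1 else if i = Suc j then - x 0 else 0)"
  let ?W = "mat (Suc m) (Suc m) (\<lambda>(i, j). if j = m then 1 else x i ^ (m - Suc j) * (x i - x 0))"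
  have "det ?L = prod_list (diag_mat ?L)"
    by (rule det_lower_triangular[of "Suc m"]) auto
  also have "\<dots> = 1"
  proof -
    have "diag_mat ?L = replicate (Suc m) 1"
      by (rule nth_equalityI) (auto simp: diag_mat_def simp del: replicate_Suc upt_Suc)
    then show ?thesis by simp
  qed
  finally have L: "det ?L = 1" .
  have "?V * ?L = ?W"
  proof (rule eq_matI)
    fix i j assume "i < dim_row ?W" "j < dim_col ?W"
    then have ij: "i < Suc m" "j < Suc m" by auto
    then have "(?V * ?L) $$ (i, j) =
        (\<Sum>k\<in>{0..<Suc m}. x i ^ (m - k) * (if k = j then 1 else if k = Suc j then - x 0 else 0))"
      by (simp add: times_mat_def scalar_prod_def)
    also have "\<dots> = (\<Sum>k\<in>{0..<Suc m}. if k = j then x i ^ (m - j) else 0) +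
        (\<Sum>k\<in>{0..<Suc m}. if k = Suc j then x i ^ (m - Suc j) * (- x 0) else 0)"
      by (subst sum.distrib[symmetric], intro sum.cong) auto
    also have "\<dots> = ?W $$ (i, j)"
    proof (cases "j = m")
      case False
      with ij have "m - j = Suc (m - Suc j)" by auto
      then show ?thesis using ij False by (simp add: sum.delta algebra_simps)
    qed (use ij in \<open>simp add: sum.delta\<close>)
    finally show "(?V * ?L) $$ (i, j) = ?W $$ (i, j)" .
  qed auto
  then have "det ?V = det ?W"
    using det_mult[of ?V "Suc m" ?L] L by simp
  also have "\<dots> = (\<Sum>j<Suc m. ?W $$ (0, j) * cofactor ?W 0 j)"
    by (rule laplace_expansion_row) auto
  also have "\<dots> = (\<Sum>j<Suc m. if j = m then cofactor ?W 0 m else 0)"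
    by (intro sum.cong) auto
  also have "\<dots> = (-1) ^ m * det (mat_delete ?W 0 m)"
    by (simp add: cofactor_def)
  also have "mat_delete ?W 0 m =
      mat\<^sub>r m m (\<lambda>i. (x (Suc i) - x 0) \<cdot>\<^sub>v vec m (\<lambda>j. x (Suc i) ^ (m - Suc j)))"
    by (rule eq_matI) (auto simp: mat_delete_def mult.commute)
  also have "det \<dots> = (\<Prod>i\<in>{0..<m}. x (Suc i) - x 0) *
      det (mat\<^sub>r m m (\<lambda>i. vec m (\<lambda>j. x (Suc i) ^ (m - Suc j))))"
    by (rule det_rows_mul) auto
  also have "mat\<^sub>r m m (\<lambda>i. vec m (\<lambda>j. x (Suc i) ^ (m - Suc j))) =
      mat m m (\<lambda>(i, j). (x \<circ> Suc) i ^ (m - Suc j))"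
    by (rule eq_matI) (auto simp:)
  also have "det \<dots> = (\<Prod>i<m. \<Prod>j\<in>{i<..<m}. x (Suc i) - x (Suc j))"
    using Suc.IH[of "x \<circ> Suc"] by simp
  also have "(-1) ^ m * ((\<Prod>i\<in>{0..<m}. x (Suc i) - x 0) * \<dots>) =
      (\<Prod>i\<in>{0..<m}. x 0 - x (Suc i)) * (\<Prod>i<m. \<Prod>j\<in>{i<..<m}. x (Suc i) - x (Suc j))"
  proof -
    have "(-1) ^ m * (\<Prod>i\<in>{0..<m}. x (Suc i) - x 0) = (\<Prod>i\<in>{0..<m}. (-1) * (x (Suc i) - x 0))"
      by (subst prod.distrib) simp
    then show ?thesis by (simp flip: mult.assoc)
  qed
  also have "\<dots> = (\<Prod>i<Suc m. \<Prod>j\<in>{i<..<Suc m}. x i - x j)"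
  proof -
    have *: "{i<..<Suc n} = Suc ` {j. i \<le> j \<and> j < n}" for i n
    proof (intro equalityI subsetI)
      fix x assume "x \<in> {i<..<Suc n}"
      then show "x \<in> Suc ` {j. i \<le> j \<and> j < n}" by (cases x) auto
    qed auto
    have "{j. Suc i \<le> j \<and> j < m} = {i<..<m}" "{j. 0 \<le> j \<and> j < m} = {0..<m}" for i by auto
    then show ?thesis
      by (simp add: prod.lessThan_Suc_shift * prod.reindex del: prod.lessThan_Suc)
  qed
  finally show ?case .
qed

section \<open>Divisibility by the Vandermonde product\<close>

abbreviation ut_vars :: "nat \<Rightarrow> kvar set" where
  "ut_vars m \<equiv> U ` {..<m} \<union> range T"

abbreviation rename_u :: "(nat \<Rightarrow> nat) \<Rightarrow> (kvar, int) mpoly \<Rightarrow> (kvar, int) mpoly" where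
  "rename_u f \<equiv> msub (\<lambda>x. Var (permute_u f x))"

definition merge_u :: "nat \<Rightarrow> nat \<Rightarrow> nat \<Rightarrow> nat" where
  "merge_u k l i = (if i = k then l else i)"

text \<open>The remainder theorem for the divisor \<open>Var (U k) - Var (U l)\<close>: congruence
  modulo it holds for the variables and is preserved by sums and products.\<close>

lemma diff_Var_dvd: "Var (U k) - Var (U l) dvd p - rename_u (merge_u k l) p"
proof (induction p rule: int_mpoly_induct)
  case (const c)
  then show ?case by (simp add: msub.hom_of_int)
next
  case (Var x)
  then show ?case by (cases x) (auto simp: merge_u_def)
next
  case (add p q)
  then show ?case by (simp add: msub_add add_diff_add dvd_add)
next
  case (mult p q)
  have "p * q - p' * q' = (p - p') * q + p' * (q - q')" for p' q' :: "(kvar, int) mpoly"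
    by (simp add: algebra_simps)
  with mult show ?case by (simp add: msub_mult)
qed

lemma Var_inject: "(Var x :: ('x, int) mpoly) = Var y \<longleftrightarrow> x = y"
proof
  assume "(Var x :: ('x, int) mpoly) = Var y"
  then have "keys (Var x :: ('x, int) mpoly) = keys (Var y :: ('x, int) mpoly)" by simp
  then have "keys (single x (1::nat)) = keys (single y (1::nat))" by (simp add: Var_def)
  then show "x = y" by simp
qed simp

definition vdm :: "nat \<Rightarrow> (kvar, int) mpoly" where
  "vdm m = (\<Prod>i<m. \<Prod>j\<in>{i<..<m}. Var (U i) - Var (U j))"

lemma vdm_nonzero: "vdm m \<noteq> 0"
  by (auto simp: vdm_def Var_inject)

lemma alternant_replicate: "alternant (replicate m 0) = vdm m"
proof -
  have "mat m m (\<lambda>(i, j). Var (U i) ^ (replicate m 0 ! j + (m - Suc j))) =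
      mat m m (\<lambda>(i, j). Var (U i) ^ (m - Suc j) :: (kvar, int) mpoly)"
    by (rule eq_matI) auto
  then show ?thesis
    unfolding alternant_def vdm_def Let_def by (simp add: vandermonde_det)
qed

text \<open>The factors are split off one at a time. Merging the two variables of a new factor
  annihilates \<open>p\<close> but none of the factors already split off, so in a domain it
  annihilates the remaining quotient, which is therefore divisible by the new factor.\<close>

lemma vdm_dvd:
  assumes "\<And>k l. k < l \<Longrightarrow> l < m \<Longrightarrow> rename_u (merge_u k l) p = 0"
  shows "vdm m dvd p"
proof -
  let ?d = "\<lambda>(i, j). Var (U i) - Var (U j) :: (kvar, int) mpoly"
  have "prod ?d S dvd p" if "finite S" "S \<subseteq> (SIGMA i:{..<m}. {i<..<m})" for S
    using that
  proof (induction S rule: finite_induct)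
    case (insert kl S)
    obtain k l where kl: "kl = (k, l)" by (cases kl)
    then have "k < l" "l < m" using insert.prems by auto
    obtain q where q: "p = prod ?d S * q" using insert by (auto elim: dvdE)
    have "rename_u (merge_u k l) (?d ij) \<noteq> 0" if "ij \<in> S" for ij
    proof -
      obtain i j where ij: "ij = (i, j)" by (cases ij)
      then have "i < j" "(i, j) \<noteq> (k, l)" using insert that kl by auto
      then show ?thesis
        using \<open>k < l\<close> by (auto simp: ij msub.hom_minus Var_inject merge_u_def)
    qed
    then have "rename_u (merge_u k l) (prod ?d S) \<noteq> 0"
      using insert.hyps(1) by (simp add: msub.hom_prod)
    moreover have "rename_u (merge_u k l) (prod ?d S) * rename_u (merge_u k l) q = 0"
      using assms[OF \<open>k < l\<close> \<open>l < m\<close>] by (simp add: q msub_mult)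
    ultimately have "rename_u (merge_u k l) q = 0" by simp
    then have "Var (U k) - Var (U l) dvd q" using diff_Var_dvd[of k l q] by simp
    then show ?case using insert.hyps by (simp add: q kl mult.commute mult_dvd_mono)
  qed simp
  from this[of "SIGMA i:{..<m}. {i<..<m}"] show ?thesis
    by (simp add: vdm_def prod.Sigma)
qed

lemma rename_u_comp: "rename_u f (rename_u g p) = rename_u (f \<circ> g) p"
proof -
  have "permute_u f (permute_u g x) = permute_u (f \<circ> g) x" for x by (cases x) auto
  then show ?thesis by (simp add: msub_msub)
qed

lemma rename_u_cong:
  assumes "p \<in> polys_in (ut_vars m)" "\<And>i. i < m \<Longrightarrow> f i = g i"
  shows "rename_u f p = rename_u g p"
  using assms(1) by (rule msub_cong_polys_in) (use assms(2) in auto)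

lemma inj_permute_u: "inj f \<Longrightarrow> inj (permute_u f)"
proof (rule injI)
  fix x y assume "inj f" "permute_u f x = permute_u f y"
  then show "x = y" by (cases x; cases y) (auto dest: injD)
qed

lemma surj_permute_u: "surj f \<Longrightarrow> surj (permute_u f)"
proof (rule surjI)
  fix y assume "surj f"
  then show "permute_u f (permute_u (inv_into UNIV f) y) = y"
    by (cases y) (auto simp: surj_f_inv_f)
qed

lemma sym_polys_iff:
  "p \<in> sym_polys m \<longleftrightarrow> p \<in> polys_in (ut_vars m) \<and> (\<forall>\<pi>. \<pi> permutes {..<m} \<longrightarrow> rename_u \<pi> p = p)"
proof -
  have "(\<forall>a. lookup p (Poly_Mapping.map_key (permute_u \<pi>) a) = lookup p a) \<longleftrightarrow> rename_u \<pi> p = p"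
    if "\<pi> permutes {..<m}" for \<pi>
  proof -
    have "inj (permute_u \<pi>)" "range (permute_u \<pi>) = UNIV"
      using that by (auto intro!: inj_permute_u surj_permute_u dest: permutes_inj permutes_surj)
    then show ?thesis by (simp add: poly_mapping_eq_iff fun_eq_iff lookup_msub_rename)
  qed
  then show ?thesis by (auto simp: sym_polys_def)
qed

lemma rename_u_polys_in:
  assumes "p \<in> polys_in (U ` A \<union> range T)" "f ` A \<subseteq> B"
  shows "rename_u f p \<in> polys_in (U ` B \<union> range T)"
proof -
  have "restrict_vars (U ` B \<union> range T) (rename_u f p) =
      msub (\<lambda>x. restrict_vars (U ` B \<union> range T) (Var (permute_u f x))) p"
    by (simp add: restrict_vars_def msub_msub)
  also have "\<dots> = rename_u f p"
    by (rule msub_cong_polys_in[OF assms(1)]) (use assms(2) in \<open>auto simp: restrict_vars_def\<close>)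
  finally show ?thesis by (simp add: polys_in_iff)
qed

lemma vdm_polys_in: "m \<le> n \<Longrightarrow> vdm m \<in> polys_in (ut_vars n)"
  unfolding vdm_def by (intro polys_in_prod polys_in_minus polys_in_Var) auto

lemma rename_u_det:
  "rename_u f (det (mat n n g)) = det (mat n n (\<lambda>ij. rename_u f (g ij)))"
proof -
  have "map_mat (rename_u f) (mat n n g) = mat n n (\<lambda>ij. rename_u f (g ij))" by (rule eq_matI) auto
  then show ?thesis by (metis msub.hom_det)
qed

lemma det_permuted_rows:
  fixes f :: "nat \<Rightarrow> nat \<Rightarrow> 'a::comm_ring_1"
  assumes "\<pi> permutes {..<n}"
  shows "det (mat n n (\<lambda>(i, j). f (\<pi> i) j)) = of_int (sign \<pi>) * det (mat n n (\<lambda>(i, j). f i j))"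
proof -
  have p: "\<pi> permutes {0..<n}" using assms by (simp add: atLeast0LessThan)
  have "mat n n (\<lambda>(i, j). mat n n (\<lambda>(i, j). f i j) $$ (\<pi> i, j)) = mat n n (\<lambda>(i, j). f (\<pi> i) j)"
    by (rule eq_matI) (use permutes_in_image[OF p] in auto)
  then show ?thesis
    using det_permute_rows[OF _ p, of "mat n n (\<lambda>(i, j). f i j)"]
    by auto
qed

lemma vdm_det: "vdm m = det (mat m m (\<lambda>(i, j). Var (U i) ^ (m - Suc j)))"
  by (simp add: vandermonde_det vdm_def)

lemma rename_u_vdm:
  assumes "\<pi> permutes {..<m}"
  shows "rename_u \<pi> (vdm m) = of_int (sign \<pi>) * vdm m"
  unfolding vdm_det rename_u_det
  by (subst det_permuted_rows[OF assms, symmetric], intro arg_cong[of _ _ det] eq_matI)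
     (auto simp: msub.hom_power)

text \<open>The quotient by the Vandermonde product exists by \<open>vdm_dvd\<close>. It inherits
  the variables of \<open>A\<close> because \<open>restrict_vars\<close> is multiplicative and fixes
  \<open>vdm m\<close>, and it is symmetric because the two signs cancel.\<close>

lemma alternating_quotient:
  assumes A: "A \<in> polys_in (ut_vars m)"
    and alt: "\<And>\<pi>. \<pi> permutes {..<m} \<Longrightarrow> rename_u \<pi> A = of_int (sign \<pi>) * A"
    and merge: "\<And>k l. k < l \<Longrightarrow> l < m \<Longrightarrow> rename_u (merge_u k l) A = 0"
  shows "\<exists>s\<in>sym_polys m. s * vdm m = A"
proof -
  from vdm_dvd[OF merge] obtain s where s: "A = vdm m * s" by (auto elim: dvdE)
  have "restrict_vars (ut_vars m) s * vdm m = s * vdm m"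
    using A vdm_polys_in[of m m] by (simp add: polys_in_iff s restrict_vars.hom_mult mult.commute)
  then have "s \<in> polys_in (ut_vars m)"
    using vdm_nonzero by (simp add: polys_in_iff)
  moreover have "rename_u \<pi> s = s" if "\<pi> permutes {..<m}" for \<pi>
  proof -
    have "of_int (sign \<pi>) * (rename_u \<pi> s * vdm m) = of_int (sign \<pi>) * (s * vdm m)"
      using alt[OF that] rename_u_vdm[OF that] by (simp add: s msub_mult mult_ac)
    then show ?thesis using vdm_nonzero by (simp add: sign_def split: if_splits)
  qed
  ultimately show ?thesis
    using s by (auto simp: sym_polys_iff mult.commute intro!: bexI[of _ s])
qed

section \<open>Schur polynomials and the operators \<open>\<rho>\<close>\<close>

text \<open>Permuting the variables permutes the rows, and merging two variables makes two rows
  equal. Both power determinants and bordered determinants have this shape.\<close>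

lemma det_alternating_quotient:
  assumes f: "\<And>i j. i < m \<Longrightarrow> j < m \<Longrightarrow> f i j \<in> polys_in (ut_vars m)"
    and perm: "\<And>\<pi> i j. \<pi> permutes {..<m} \<Longrightarrow> i < m \<Longrightarrow> j < m \<Longrightarrow> rename_u \<pi> (f i j) = f (\<pi> i) j"
    and merge: "\<And>k l j. k < l \<Longrightarrow> l < m \<Longrightarrow> j < m \<Longrightarrow>
      rename_u (merge_u k l) (f k j) = rename_u (merge_u k l) (f l j)"
  shows "\<exists>s\<in>sym_polys m. s * vdm m = det (mat m m (\<lambda>(i, j). f i j))"
proof (rule alternating_quotient)
  show "det (mat m m (\<lambda>(i, j). f i j)) \<in> polys_in (ut_vars m)"
    by (rule polys_in_det) (use f in auto)
next
  fix \<pi> assume "\<pi> permutes {..<m}"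
  then show "rename_u \<pi> (det (mat m m (\<lambda>(i, j). f i j))) = of_int (sign \<pi>) * det (mat m m (\<lambda>(i, j). f i j))"
    unfolding rename_u_det
    by (subst det_permuted_rows[symmetric], assumption, intro arg_cong[of _ _ det] eq_matI)
       (use perm in auto)
next
  fix k l assume kl: "k < l" "l < m"
  show "rename_u (merge_u k l) (det (mat m m (\<lambda>(i, j). f i j))) = 0"
    unfolding rename_u_det
    by (rule det_identical_rows[of _ m k l]) (use kl merge in \<open>auto intro!: eq_vecI\<close>)
qed

definition power_det :: "nat \<Rightarrow> (nat \<Rightarrow> nat) \<Rightarrow> (kvar, int) mpoly" where
  "power_det m \<alpha> = det (mat m m (\<lambda>(i, j). Var (U i) ^ \<alpha> j))"

lemma power_det_quotient: "\<exists>s\<in>sym_polys m. s * vdm m = power_det m \<alpha>"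
  unfolding power_det_def
  by (rule det_alternating_quotient)
     (auto simp: msub.hom_power merge_u_def intro!: polys_in_power polys_in_Var)

lemma alternant_power_det: "length l = m \<Longrightarrow> alternant l = power_det m (\<lambda>j. l ! j + (m - Suc j))"
  by (simp add: alternant_def power_det_def Let_def)

lemma schur: "schur l \<in> sym_polys (length l)" "schur l * vdm (length l) = alternant l"
proof -
  let ?m = "length l"
  obtain s where s: "s \<in> sym_polys ?m" "s * vdm ?m = alternant l"
    unfolding alternant_power_det[OF refl, of l] using power_det_quotient by blast
  have "schur l = s"
    unfolding schur_def alternant_replicate
  proof (rule the_equality)
    fix s' assume "s' * vdm ?m = alternant l"
    then have "s' * vdm ?m = s * vdm ?m" using s(2) by simp
    then show "s' = s" using vdm_nonzero[of ?m] by simp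
  qed (rule s(2))
  then show "schur l \<in> sym_polys (length l)" "schur l * vdm (length l) = alternant l"
    using s by auto
qed

lemma power_det_permute:
  assumes "\<pi> permutes {..<m}"
  shows "power_det m (\<lambda>j. \<alpha> (\<pi> j)) = of_int (sign \<pi>) * power_det m \<alpha>"
proof -
  have tr: "power_det m \<beta> = det (mat m m (\<lambda>(i, j). Var (U j) ^ \<beta> i))" for \<beta>
    unfolding power_det_def
    by (subst det_transpose[symmetric, of _ m], simp) (intro arg_cong[of _ _ det] eq_matI, auto)
  show ?thesis
    unfolding tr by (rule det_permuted_rows[OF assms, of "\<lambda>i j. Var (U j) ^ \<alpha> i"])
qed

text \<open>In strictly decreasing order each of the m exponents drops by at least one, so entry j
  is at least m - 1 - j. Subtracting this staircase stays within the natural numbers and leaves a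
  weakly decreasing list.\<close>

lemma sorting_permutation:
  fixes \<alpha> :: "nat \<Rightarrow> nat"
  assumes "inj_on \<alpha> {..<m}"
  obtains \<pi> l where "\<pi> permutes {..<m}" "l \<in> partitions m" "\<And>j. j < m \<Longrightarrow> \<alpha> (\<pi> j) = l ! j + (m - Suc j)"
proof -
  let ?ys = "map \<alpha> [0..<m]"
  define xs where "xs = rev (sort ?ys)"
  have "mset xs = mset ?ys" by (simp add: xs_def)
  then obtain \<pi> where \<pi>: "\<pi> permutes {..<length ?ys}" "permute_list \<pi> ?ys = xs"
    by (rule mset_eq_permutation)
  have perm: "\<pi> permutes {..<m}" using \<pi>(1) by simp
  have len: "length xs = m" by (simp add: xs_def)
  have nth: "xs ! j = \<alpha> (\<pi> j)" if "j < m" for j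
    using permute_list_nth[OF \<pi>(1), of j] that permutes_in_image[OF perm, of j] by (simp add: \<pi>(2))
  have "distinct xs"
    using assms by (simp add: xs_def distinct_map lessThan_atLeast0)
  moreover have "sorted (rev xs)" by (simp add: xs_def)
  ultimately have dec: "xs ! j < xs ! i" if "i < j" "j < m" for i j
    using that len sorted_rev_nth_mono[of xs i j] nth_eq_iff_index_eq[of xs i j] by fastforce
  have gap: "xs ! j + (j - i) \<le> xs ! i" if "i \<le> j" "j < m" for i j
    using that
  proof (induction j rule: dec_induct)
    case (step n)
    then show ?case using dec[of n "Suc n"] by auto
  qed simp
  define l where "l = map (\<lambda>j. xs ! j - (m - Suc j)) [0..<m]"
  have l: "l ! j = xs ! j - (m - Suc j)" if "j < m" for j using that by (simp add: l_def)
  have ge: "m - Suc j \<le> xs ! j" if "j < m" for j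
    using gap[of j "m - 1"] that by simp linarith
  have "\<alpha> (\<pi> j) = l ! j + (m - Suc j)" if "j < m" for j
    unfolding l[OF that] using ge[OF that] nth[OF that] by simp
  moreover have "l ! j \<le> l ! i" if "i < j" "j < m" for i j
    using gap[of i j] ge[of i] ge[of j] l[of i] l[of j] that by linarith
  then have "l \<in> partitions m"
    by (simp add: partitions_def sorted_wrt_iff_nth_less l_def)
  ultimately show thesis using perm that by blast
qed

lemma power_det_schur:
  "\<exists>l\<in>partitions m. \<exists>c::int. power_det m \<alpha> = of_int c * alternant l"
proof (cases "inj_on \<alpha> {..<m}")
  case True
  from sorting_permutation[OF True] obtain \<pi> l where *: "\<pi> permutes {..<m}" "l \<in> partitions m"
      "\<And>j. j < m \<Longrightarrow> \<alpha> (\<pi> j) = l ! j + (m - Suc j)" by blast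
  have "alternant l = power_det m (\<lambda>j. \<alpha> (\<pi> j))"
    using *(2,3) unfolding power_det_def
    by (subst alternant_power_det[of l m]) (auto simp: partitions_def power_det_def intro!: arg_cong[of _ _ det])
  then have "of_int (sign \<pi>) * alternant l = power_det m \<alpha>"
    by (simp add: power_det_permute[OF *(1)] sign_def)
  then show ?thesis using *(2) by metis
next
  case False
  then obtain i j where "i < m" "j < m" "i \<noteq> j" "\<alpha> i = \<alpha> j" by (auto simp: inj_on_def)
  then have "power_det m \<alpha> = 0"
    unfolding power_det_def by (intro det_identical_columns[of _ m i j]) (auto intro!: eq_vecI)
  \<comment> \<open>The coefficient is 0 in this case, so the partition is an arbitrary one.\<close>
  moreover have "replicate m 0 \<in> partitions m" by (auto simp: partitions_def sorted_wrt_iff_nth_less)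
  ultimately show ?thesis by (metis mult_zero_left of_int_0)
qed

lemma single_split:
  assumes "keys e \<subseteq> ut_vars m"
  obtains t where "t \<in> polys_in (range T)"
    "single e 1 = t * (\<Prod>i<m. Var (U i) ^ lookup e (U i))"
    "\<And>f. rename_u f t = t"
proof
  let ?B = "keys e \<inter> range T"
  let ?t = "\<Prod>x\<in>?B. Var x ^ lookup e x :: (kvar, int) mpoly"
  have "single e (1::int) = mev Var e" by (simp add: mev_Var)
  also have "\<dots> = (\<Prod>x\<in>?B \<union> U ` {..<m}. Var x ^ lookup e x)"
    by (rule mev_superset) (use assms in auto)
  also have "\<dots> = ?t * (\<Prod>x\<in>U ` {..<m}. Var x ^ lookup e x)"
    by (rule prod.union_disjoint) auto
  also have "(\<Prod>x\<in>U ` {..<m}. Var x ^ lookup e x) = (\<Prod>i<m. Var (U i) ^ lookup e (U i) :: (kvar, int) mpoly)"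
    by (subst prod.reindex) (auto simp: inj_on_def)
  finally show "single e 1 = ?t * (\<Prod>i<m. Var (U i) ^ lookup e (U i))" .
  show "?t \<in> polys_in (range T)" by (intro polys_in_prod polys_in_power polys_in_Var) auto
  show "rename_u f ?t = ?t" for f
    by (auto simp: msub.hom_prod msub.hom_power intro!: prod.cong)
qed

text \<open>Leibniz' formula for the transposed matrix, read as a signed sum over the renamings of a
  single monomial.\<close>

lemma antisymmetrization:
  "(\<Sum>\<pi> | \<pi> permutes {..<m}. of_int (sign \<pi>) * rename_u \<pi> (\<Prod>i<m. Var (U i) ^ \<alpha> i)) = power_det m \<alpha>"
proof -
  have "power_det m \<alpha> = det (mat m m (\<lambda>(i, j). Var (U j) ^ \<alpha> i))"
    unfolding power_det_def
    by (subst det_transpose[symmetric, of _ m], simp) (intro arg_cong[of _ _ det] eq_matI, auto)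
  also have "\<dots> = (\<Sum>\<pi> | \<pi> permutes {0..<m}. of_int (sign \<pi>) * (\<Prod>i = 0..<m. Var (U (\<pi> i)) ^ \<alpha> i))"
    unfolding det_def'[OF mat_carrier]
    by (intro sum.cong arg_cong2[of _ _ _ _ "(*)"] prod.cong refl) (auto dest: permutes_in_image)
  finally show ?thesis
    by (simp add: msub.hom_prod msub.hom_power atLeast0LessThan)
qed

lemma sym_polys_span:
  assumes p: "p \<in> sym_polys m"
  obtains X :: "(kvar \<Rightarrow>\<^sub>0 nat) set" and c l where "finite X"
    "\<And>x. x \<in> X \<Longrightarrow> c x \<in> polys_in (range T)" "\<And>x. x \<in> X \<Longrightarrow> l x \<in> partitions m"
    "of_nat (fact m) * p = (\<Sum>x\<in>X. c x * schur (l x))"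
proof -
  define q where "q = p * vdm m"
  have pin: "p \<in> polys_in (ut_vars m)" using p by (simp add: sym_polys_iff)
  have q: "q \<in> polys_in (ut_vars m)"
    unfolding q_def by (intro polys_in_mult pin vdm_polys_in order_refl)
  have ren: "of_int (sign \<pi>) * rename_u \<pi> q = q" if "\<pi> permutes {..<m}" for \<pi>
    using p that by (simp add: q_def msub_mult rename_u_vdm sym_polys_iff sign_def)
  have "\<exists>c l. c \<in> polys_in (range T) \<and> l \<in> partitions m \<and>
      (\<Sum>\<pi> | \<pi> permutes {..<m}. of_int (sign \<pi>) * rename_u \<pi> (single e a)) = c * alternant l"
    if e: "keys e \<subseteq> ut_vars m" for e a
  proof -
    obtain t where t: "t \<in> polys_in (range T)"
      "single e 1 = t * (\<Prod>i<m. Var (U i) ^ lookup e (U i))" "\<And>f. rename_u f t = t"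
      using single_split[OF e] by blast
    obtain l d where l: "l \<in> partitions m" "power_det m (\<lambda>i. lookup e (U i)) = of_int d * alternant l"
      using power_det_schur by blast
    have "single e a = of_int a * t * (\<Prod>i<m. Var (U i) ^ lookup e (U i))"
    proof -
      have "single e a = of_int a * single e 1"
        by (rule poly_mapping_eqI) (simp add: lookup_of_int_mult lookup_single when_def)
      then show ?thesis by (simp add: t(2) mult.assoc)
    qed
    then have "(\<Sum>\<pi> | \<pi> permutes {..<m}. of_int (sign \<pi>) * rename_u \<pi> (single e a)) =
      (\<Sum>\<pi> | \<pi> permutes {..<m}. of_int a * t * (of_int (sign \<pi>) * rename_u \<pi> (\<Prod>i<m. Var (U i) ^ lookup e (U i))))"
      by (intro sum.cong refl) (simp add: msub_mult t(3) msub.hom_of_int mult_ac del: msub_single)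
    also have "\<dots> = of_int a * t * of_int d * alternant l"
      by (simp add: antisymmetrization l(2) mult.assoc flip: sum_distrib_left)
    finally show ?thesis using t(1) l(1) by (intro exI[of _ "of_int a * t * of_int d"] exI[of _ l] conjI)
      (auto intro!: polys_in_mult polys_in_of_int)
  qed
  then have "\<forall>e\<in>keys q. \<exists>cl. fst cl \<in> polys_in (range T) \<and> snd cl \<in> partitions m \<and>
      (\<Sum>\<pi> | \<pi> permutes {..<m}. of_int (sign \<pi>) * rename_u \<pi> (single e (lookup q e))) =
        fst cl * alternant (snd cl)"
    using q by (fastforce simp: polys_in_def simp del: msub_single)
  from bchoice[OF this] obtain cl where cl: "\<forall>e\<in>keys q. fst (cl e) \<in> polys_in (range T) \<and>
      snd (cl e) \<in> partitions m \<and>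
      (\<Sum>\<pi> | \<pi> permutes {..<m}. of_int (sign \<pi>) * rename_u \<pi> (single e (lookup q e))) =
        fst (cl e) * alternant (snd (cl e))"
    by blast
  define c l where "c = (\<lambda>e. fst (cl e))" and "l = (\<lambda>e. snd (cl e))"
  have cl: "c e \<in> polys_in (range T)" "l e \<in> partitions m"
      "(\<Sum>\<pi> | \<pi> permutes {..<m}. of_int (sign \<pi>) * rename_u \<pi> (single e (lookup q e))) = c e * alternant (l e)"
    if "e \<in> keys q" for e using cl that by (auto simp: c_def l_def simp del: msub_single)
  have "of_nat (fact m) * q = (\<Sum>\<pi> | \<pi> permutes {..<m}. q)"
    by (simp add: card_permutations[OF refl])
  also have "\<dots> = (\<Sum>\<pi> | \<pi> permutes {..<m}. of_int (sign \<pi>) * rename_u \<pi> q)"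
    by (intro sum.cong refl) (simp add: ren)
  also have "\<dots> = (\<Sum>\<pi> | \<pi> permutes {..<m}. \<Sum>e\<in>keys q. of_int (sign \<pi>) * rename_u \<pi> (single e (lookup q e)))"
    by (subst (1) poly_mapping_sum_singles[of "keys q" q]) (simp_all add: msub.hom_sum sum_distrib_left del: msub_single)
  also have "\<dots> = (\<Sum>e\<in>keys q. c e * alternant (l e))"
    by (subst sum.swap) (simp add: cl(3) del: msub_single)
  also have "\<dots> = (\<Sum>e\<in>keys q. c e * schur (l e)) * vdm m"
    unfolding sum_distrib_right
  proof (intro sum.cong refl)
    fix e assume "e \<in> keys q"
    then have "length (l e) = m" using cl(2) by (simp add: partitions_def)
    then show "c e * alternant (l e) = c e * schur (l e) * vdm m"
      using schur(2)[of "l e"] by (simp add: mult.assoc)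
  qed
  finally have "of_nat (fact m) * p = (\<Sum>e\<in>keys q. c e * schur (l e))"
    using vdm_nonzero[of m] by (simp add: q_def flip: mult.assoc)
  then show thesis using cl(1,2) that[of "keys q" c l] by simp
qed

text \<open>A symmetric polynomial sees only the set of variables put into it: on the first m
  indices, \<open>f\<close> is \<open>g\<close> preceded by the permutation
  \<open>\<tau>\<close>.\<close>

lemma rename_u_same_image:
  assumes p: "p \<in> sym_polys m" and f: "inj_on f {..<m}" and g: "inj_on g {..<m}"
    and img: "f ` {..<m} = g ` {..<m}"
  shows "rename_u f p = rename_u g p"
proof -
  define \<tau> where "\<tau> = (\<lambda>j. if j < m then inv_into {..<m} g (f j) else j)"
  have "bij_betw f {..<m} (g ` {..<m})" using f img by (simp add: bij_betw_def)
  moreover have "bij_betw (inv_into {..<m} g) (g ` {..<m}) {..<m}"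
    by (rule bij_betw_inv_into) (simp add: bij_betw_def g)
  ultimately have "bij_betw (inv_into {..<m} g \<circ> f) {..<m} {..<m}" by (rule bij_betw_trans)
  then have "bij_betw \<tau> {..<m} {..<m}" by (rule bij_betw_cong[THEN iffD1, rotated]) (simp add: \<tau>_def)
  then have "\<tau> permutes {..<m}" by (rule bij_imp_permutes) (simp add: \<tau>_def)
  then have "rename_u g p = rename_u (g \<circ> \<tau>) p"
    using p rename_u_comp[of g \<tau> p] by (simp add: sym_polys_iff)
  also have "\<dots> = rename_u f p"
  proof (rule rename_u_cong)
    show "p \<in> polys_in (ut_vars m)" using p by (simp add: sym_polys_iff)
    show "(g \<circ> \<tau>) i = f i" if "i < m" for i
      using that img by (auto simp: \<tau>_def intro!: f_inv_into_f)
  qed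
  finally show ?thesis by simp
qed

section \<open>Bordered determinants\<close>

lemma insert_index_inj: "inj (insert_index i)"
  by (auto simp: inj_def insert_index_def split: if_splits)

lemma insert_index_image_lessThan: "i \<le> m \<Longrightarrow> insert_index i ` {..<m} = {..<Suc m} - {i}"
proof (intro equalityI subsetI)
  fix x assume "i \<le> m" "x \<in> {..<Suc m} - {i}"
  then show "x \<in> insert_index i ` {..<m}"
    by (intro image_eqI[of _ _ "if x < i then x else x - 1"]) (auto simp: insert_index_def)
qed (auto simp: insert_index_def split: if_splits)

abbreviation omit_u :: "nat \<Rightarrow> (kvar, int) mpoly \<Rightarrow> (kvar, int) mpoly" where
  "omit_u i \<equiv> rename_u (insert_index i)"

text \<open>The cofactor of entry i of the last column when the other columns hold the powers with
  exponents m, ..., 1 of the variables. Since these exponents end at 1 and not at 0, each remaining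
  row contributes one further factor \<open>Var (U j)\<close> besides the Vandermonde
  determinant.\<close>

definition border_cofactor :: "nat \<Rightarrow> nat \<Rightarrow> (kvar, int) mpoly" where
  "border_cofactor m i = (-1) ^ (i + m) * omit_u i ((\<Prod>j<m. Var (U j)) * vdm m)"

text \<open>A determinant with last column \<open>g i * omit_u i p\<close>, written as its expansion
  along that column, so that linearity in \<open>p\<close> and in \<open>g\<close> is visible. See
  \<open>bordered_det\<close> for the matrix.\<close>

definition bordered :: "nat \<Rightarrow> (nat \<Rightarrow> (kvar, int) mpoly) \<Rightarrow> (kvar, int) mpoly \<Rightarrow> (kvar, int) mpoly" where
  "bordered m g p = (\<Sum>i<Suc m. g i * omit_u i p * border_cofactor m i)"

lemma alternant_shift:
  assumes "length l = m"
  shows "det (mat m m (\<lambda>(i, j). Var (U i) ^ (l ! j + (m - j)))) = (\<Prod>j<m. Var (U j)) * alternant l"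
proof -
  have "mat m m (\<lambda>(i, j). Var (U i) ^ (l ! j + (m - j))) =
      mat\<^sub>r m m (\<lambda>i. Var (U i) \<cdot>\<^sub>v vec m (\<lambda>j. Var (U i) ^ (l ! j + (m - Suc j)) :: (kvar, int) mpoly))"
    by (rule eq_matI) (auto simp: Suc_diff_Suc simp flip: power_Suc add_Suc_right)
  also have "det \<dots> = (\<Prod>i\<in>{0..<m}. Var (U i)) *
      det (mat\<^sub>r m m (\<lambda>i. vec m (\<lambda>j. Var (U i) ^ (l ! j + (m - Suc j)))))"
    by (rule det_rows_mul) auto
  also have "mat\<^sub>r m m (\<lambda>i. vec m (\<lambda>j. Var (U i) ^ (l ! j + (m - Suc j)))) =
      mat m m (\<lambda>(i, j). Var (U i) ^ (l ! j + (m - Suc j)) :: (kvar, int) mpoly)"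
    by (rule eq_matI) auto
  also have "det \<dots> = alternant l" using assms by (simp add: alternant_def Let_def)
  finally show ?thesis by (simp add: atLeast0LessThan)
qed

lemma det_last_column:
  assumes "length l = m"
  shows "det (mat (Suc m) (Suc m) (\<lambda>(i, j). if j = m then g i else Var (U i) ^ (l ! j + (m - j)))) =
    (\<Sum>i<Suc m. g i * ((-1) ^ (i + m) * omit_u i ((\<Prod>j<m. Var (U j)) * alternant l)))"
    (is "det ?A = _")
proof -
  have "det ?A = (\<Sum>i<Suc m. ?A $$ (i, m) * cofactor ?A i m)"
    by (rule laplace_expansion_column) auto
  also have "\<dots> = (\<Sum>i<Suc m. g i * ((-1) ^ (i + m) * omit_u i ((\<Prod>j<m. Var (U j)) * alternant l)))"
  proof (intro sum.cong refl)
    fix i assume "i \<in> {..<Suc m}"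
    then have "mat_delete ?A i m = mat m m (\<lambda>(i', j). omit_u i (Var (U i') ^ (l ! j + (m - j))))"
      by (intro eq_matI) (auto simp: mat_delete_def insert_index_def msub.hom_power)
    then have "det (mat_delete ?A i m) = omit_u i ((\<Prod>j<m. Var (U j)) * alternant l)"
      by (simp add: rename_u_det case_prod_unfold flip: alternant_shift[OF assms])
    then show "?A $$ (i, m) * cofactor ?A i m =
        g i * ((-1) ^ (i + m) * omit_u i ((\<Prod>j<m. Var (U j)) * alternant l))"
      using \<open>i \<in> _\<close> by (simp add: cofactor_def)
  qed
  finally show ?thesis .
qed

lemma bordered_det:
  "bordered m g p =
    det (mat (Suc m) (Suc m) (\<lambda>(i, j). if j = m then g i * omit_u i p else Var (U i) ^ (m - j)))"
proof -
  have "mat (Suc m) (Suc m) (\<lambda>(i, j). if j = m then g i * omit_u i p else Var (U i) ^ (m - j)) =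
      mat (Suc m) (Suc m) (\<lambda>(i, j). if j = m then g i * omit_u i p
        else Var (U i) ^ (replicate m 0 ! j + (m - j)))"
    by (rule eq_matI) auto
  then show ?thesis
    using det_last_column[of "replicate m 0" m "\<lambda>i. g i * omit_u i p"]
    by (simp add: bordered_def border_cofactor_def alternant_replicate mult.assoc)
qed

text \<open>Appending \<open>k\<close> raises the staircase under the first m columns by one and
  makes the last column \<open>Var (U i) ^ k\<close>. On Schur polynomials the k-th component of
  \<open>\<rho>\<close> is thus a bordered determinant divided by a Vandermonde determinant.\<close>

lemma bordered_schur:
  assumes "length l = m"
  shows "bordered m (\<lambda>i. Var (U i) ^ k) (schur l) = alternant (l @ [k])"
proof -
  have "mat (Suc m) (Suc m) (\<lambda>(i, j). Var (U i) ^ ((l @ [k]) ! j + (Suc m - Suc j))) =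
      mat (Suc m) (Suc m) (\<lambda>(i, j). if j = m then Var (U i) ^ k else Var (U i) ^ (l ! j + (m - j)) :: (kvar, int) mpoly)"
    by (rule eq_matI) (auto simp: nth_append assms)
  then have "alternant (l @ [k]) = (\<Sum>i<Suc m. Var (U i) ^ k *
      ((-1) ^ (i + m) * omit_u i ((\<Prod>j<m. Var (U j)) * alternant l)))"
    using det_last_column[OF assms, of "\<lambda>i. Var (U i) ^ k"] by (simp add: alternant_def[of "l @ [k]"] Let_def assms)
  also have "\<dots> = bordered m (\<lambda>i. Var (U i) ^ k) (schur l)"
    unfolding bordered_def border_cofactor_def schur(2)[of l, symmetric, unfolded assms]
    by (intro sum.cong refl) (simp add: msub_mult mult_ac)
  finally show ?thesis by simp
qed

text \<open>The last entry of row i involves \<open>p\<close> at the variables other than the i-th.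
  As \<open>p\<close> is symmetric, only the set of these variables matters: a permutation carries
  the set for i to the set for its image, and once variable a has been replaced by variable b, rows
  a and b both see all variables except the a-th.\<close>

lemma bordered_quotient:
  assumes p: "p \<in> sym_polys m"
  shows "\<exists>s\<in>sym_polys (Suc m). s * vdm (Suc m) = bordered m (\<lambda>i. Var (U i) ^ k) p"
  unfolding bordered_det
proof (rule det_alternating_quotient)
  have pin: "p \<in> polys_in (ut_vars m)" using p by (simp add: sym_polys_iff)
  have ins: "omit_u i p \<in> polys_in (ut_vars (Suc m))" for i
    by (rule rename_u_polys_in[OF pin]) (auto simp: insert_index_def)
  show "(if j = m then Var (U i) ^ k * omit_u i p else Var (U i) ^ (m - j))
      \<in> polys_in (ut_vars (Suc m))" if "i < Suc m" "j < Suc m" for i j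
    using that by (auto intro!: polys_in_mult polys_in_power polys_in_Var ins)
  have inj: "inj_on (insert_index i) A" for i A
    using insert_index_inj by (rule inj_on_subset) auto
  show "rename_u \<pi> (if j = m then Var (U i) ^ k * omit_u i p else Var (U i) ^ (m - j)) =
      (if j = m then Var (U (\<pi> i)) ^ k * omit_u (\<pi> i) p else Var (U (\<pi> i)) ^ (m - j))"
    if "\<pi> permutes {..<Suc m}" "i < Suc m" "j < Suc m" for \<pi> i j
  proof -
    have "rename_u (\<pi> \<circ> insert_index i) p = omit_u (\<pi> i) p"
    proof (rule rename_u_same_image[OF p])
      show "inj_on (\<pi> \<circ> insert_index i) {..<m}"
        using that(1) by (intro comp_inj_on inj) (auto intro: permutes_inj_on)
      have "\<pi> i < Suc m" using permutes_in_image[OF that(1), of i] that(2) by simp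
      then show "(\<pi> \<circ> insert_index i) ` {..<m} = insert_index (\<pi> i) ` {..<m}"
        unfolding image_comp[symmetric] using that
        by (simp add: insert_index_image_lessThan image_set_diff[OF permutes_inj] permutes_image)
    qed (rule inj)
    then show ?thesis by (cases "j = m") (simp_all add: msub_mult msub.hom_power rename_u_comp)
  qed
  show "rename_u (merge_u a b) (if j = m then Var (U a) ^ k * omit_u a p else Var (U a) ^ (m - j)) =
      rename_u (merge_u a b) (if j = m then Var (U b) ^ k * omit_u b p else Var (U b) ^ (m - j))"
    if "a < b" "b < Suc m" "j < Suc m" for a b j
  proof -
    have "rename_u (merge_u a b \<circ> insert_index a) p = rename_u (merge_u a b \<circ> insert_index b) p"
    proof (rule rename_u_same_image[OF p])
      show "inj_on (merge_u a b \<circ> insert_index a) {..<m}" "inj_on (merge_u a b \<circ> insert_index b) {..<m}"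
        using that by (auto intro!: comp_inj_on inj simp: insert_index_image_lessThan)
          (auto simp: inj_on_def merge_u_def)
      have "merge_u a b ` ({..<Suc m} - {a}) = {..<Suc m} - {a}"
        by (auto simp: merge_u_def image_iff)
      moreover have "merge_u a b ` ({..<Suc m} - {b}) = {..<Suc m} - {a}"
      proof (intro equalityI subsetI)
        fix x assume "x \<in> {..<Suc m} - {a}"
        then show "x \<in> merge_u a b ` ({..<Suc m} - {b})"
          using that by (intro image_eqI[of _ _ "if x = b then a else x"]) (auto simp: merge_u_def)
      qed (use that in \<open>auto simp: merge_u_def split: if_splits\<close>)
      ultimately show "(merge_u a b \<circ> insert_index a) ` {..<m} = (merge_u a b \<circ> insert_index b) ` {..<m}"
        unfolding image_comp[symmetric] using that by (simp add: insert_index_image_lessThan)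
    qed
    then show ?thesis by (cases "j = m") (simp_all add: msub_mult msub.hom_power rename_u_comp merge_u_def)
  qed
qed

section \<open>The operators as quotients of determinants\<close>

lemma rename_u_polys_in_T: "c \<in> polys_in (range T) \<Longrightarrow> rename_u f c = c"
proof -
  assume "c \<in> polys_in (range T)"
  then have "rename_u f c = msub Var c" by (rule msub_cong_polys_in) auto
  then show ?thesis by simp
qed

lemma bordered_add: "bordered m g (p + q) = bordered m g p + bordered m g q"
  by (simp add: bordered_def msub_add algebra_simps sum.distrib del: sum.lessThan_Suc)

lemma bordered_mult: "c \<in> polys_in (range T) \<Longrightarrow> bordered m g (c * p) = c * bordered m g p"
  by (simp add: bordered_def msub_mult rename_u_polys_in_T sum_distrib_left mult_ac del: sum.lessThan_Suc)

lemma sym_polys_add: "p \<in> sym_polys m \<Longrightarrow> q \<in> sym_polys m \<Longrightarrow> p + q \<in> sym_polys m"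
  by (auto simp: sym_polys_iff msub_add intro: polys_in_add)

lemma sym_polys_mult: "p \<in> sym_polys m \<Longrightarrow> q \<in> sym_polys m \<Longrightarrow> p * q \<in> sym_polys m"
  by (auto simp: sym_polys_iff msub_mult intro: polys_in_mult)

lemma polys_in_T_sym: "c \<in> polys_in (range T) \<Longrightarrow> c \<in> sym_polys m"
  by (auto simp: sym_polys_iff rename_u_polys_in_T intro: polys_in_mono)

lemma sym_polys_0: "0 \<in> sym_polys m"
  using polys_in_T_sym[OF polys_in_of_int[of 0]] by simp

lemma sym_polys_sum: "(\<And>i. i \<in> I \<Longrightarrow> f i \<in> sym_polys m) \<Longrightarrow> sum f I \<in> sym_polys m"
  by (induction I rule: infinite_finite_induct) (auto intro: sym_polys_add sym_polys_0)

text \<open>\<open>is_rho\<close> grants linearity on symmetric polynomials only, so every partial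
  sum has to be seen to be symmetric.\<close>

lemma semilinear_sum_schur:
  assumes add: "\<And>p q. p \<in> sym_polys m \<Longrightarrow> q \<in> sym_polys m \<Longrightarrow> \<phi> (p + q) = \<phi> p + (\<phi> q :: (kvar, int) mpoly)"
    and mult: "\<And>c p. c \<in> polys_in (range T) \<Longrightarrow> p \<in> sym_polys m \<Longrightarrow> \<phi> (c * p) = c * \<phi> p"
    and X: "finite X" "\<And>x. x \<in> X \<Longrightarrow> c x \<in> polys_in (range T)" "\<And>x. x \<in> X \<Longrightarrow> l x \<in> partitions m"
  shows "\<phi> (\<Sum>x\<in>X. c x * schur (l x)) = (\<Sum>x\<in>X. c x * \<phi> (schur (l x)))"
  using X
proof (induction X rule: finite_induct)
  case empty
  show ?case using mult[OF polys_in_of_int[of 0] sym_polys_0] by simp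
next
  case (insert x X)
  have s: "schur (l y) \<in> sym_polys m" if "y \<in> insert x X" for y
    using schur(1)[of "l y"] insert.prems(2)[OF that] by (simp add: partitions_def)
  have "c y * schur (l y) \<in> sym_polys m" if "y \<in> insert x X" for y
    using that by (intro sym_polys_mult[OF polys_in_T_sym] s insert.prems)
  then have "c x * schur (l x) \<in> sym_polys m" "(\<Sum>x\<in>X. c x * schur (l x)) \<in> sym_polys m"
    by (auto intro: sym_polys_sum)
  then show ?case using insert s by (simp add: add mult)
qed

text \<open>This replaces the definite description by a formula. Quotients of bordered determinants
  satisfy \<open>is_rho\<close>; two maps with this property agree on m! times any symmetric
  polynomial by \<open>sym_polys_span\<close>, hence on the polynomial itself.\<close>

lemma rho_comp:
  assumes p: "p \<in> sym_polys m"
  shows "rho_comp k m p \<in> sym_polys (Suc m)"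
    and "rho_comp k m p * vdm (Suc m) = bordered m (\<lambda>i. Var (U i) ^ k) p"
proof -
  let ?b = "bordered m (\<lambda>i. Var (U i) ^ k)"
  \<comment> \<open>The value 0 off the symmetric polynomials is the one prescribed by
    \<open>is_rho\<close>.\<close>
  define \<phi> where "\<phi> p = (if p \<in> sym_polys m then THE s. s * vdm (Suc m) = ?b p else 0)" for p
  note cancel = mult_right_cancel[OF vdm_nonzero[of "Suc m"]]
  have \<phi>: "\<phi> p \<in> sym_polys (Suc m) \<and> \<phi> p * vdm (Suc m) = ?b p" if p: "p \<in> sym_polys m" for p
  proof -
    from bordered_quotient[OF p, of k] obtain s where s: "s \<in> sym_polys (Suc m)" "s * vdm (Suc m) = ?b p" by blast
    have "(THE s. s * vdm (Suc m) = ?b p) = s"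
    proof (rule the_equality)
      fix s' assume "s' * vdm (Suc m) = ?b p"
      then have "s' * vdm (Suc m) = s * vdm (Suc m)" using s(2) by simp
      then show "s' = s" by (simp only: cancel)
    qed (rule s(2))
    then show ?thesis using s p by (simp add: \<phi>_def)
  qed
  have is_rho: "is_rho k m \<phi>"
    unfolding is_rho_def
  proof (intro conjI ballI allI impI)
    fix p q assume pq: "p \<in> sym_polys m" "q \<in> sym_polys m"
    have "\<phi> (p + q) * vdm (Suc m) = (\<phi> p + \<phi> q) * vdm (Suc m)"
      using \<phi>[OF pq(1)] \<phi>[OF pq(2)] \<phi>[OF sym_polys_add[OF pq]] by (simp add: bordered_add distrib_right)
    then show "\<phi> (p + q) = \<phi> p + \<phi> q" by (simp only: cancel)
  next
    fix c p :: "(kvar, int) mpoly"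
    assume c: "c \<in> polys_in (range T)" and p: "p \<in> sym_polys m"
    have "\<phi> (c * p) * vdm (Suc m) = c * \<phi> p * vdm (Suc m)"
      using \<phi>[OF p] \<phi>[OF sym_polys_mult[OF polys_in_T_sym[OF c] p]] c by (simp add: bordered_mult mult.assoc)
    then show "\<phi> (c * p) = c * \<phi> p" by (simp only: cancel)
  next
    fix l assume "l \<in> partitions m"
    then have l: "length l = m" by (simp add: partitions_def)
    have "\<phi> (schur l) * vdm (Suc m) = schur (l @ [k]) * vdm (Suc m)"
      using \<phi>[of "schur l"] schur[of l] schur(2)[of "l @ [k]"] l by (simp add: bordered_schur)
    then show "\<phi> (schur l) = schur (l @ [k])" by (simp only: cancel)
  qed (use \<phi> in \<open>auto simp: \<phi>_def\<close>)
  have unique: "\<psi> = \<phi>" if "is_rho k m \<psi>" for \<psi>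
  proof
    fix p
    show "\<psi> p = \<phi> p"
    proof (cases "p \<in> sym_polys m")
      case True
      obtain X :: "(kvar \<Rightarrow>\<^sub>0 nat) set" and c l where X: "finite X"
        "\<And>x. x \<in> X \<Longrightarrow> c x \<in> polys_in (range T)" "\<And>x. x \<in> X \<Longrightarrow> l x \<in> partitions m"
        "of_nat (fact m) * p = (\<Sum>x\<in>X. c x * schur (l x))"
        using sym_polys_span[OF True] by blast
      have N: "(of_nat (fact m) :: (kvar, int) mpoly) \<in> polys_in (range T)"
        using polys_in_of_int[of "int (fact m)" "range T"] by (simp only: of_int_of_nat_eq)
      have "of_nat (fact m) * \<chi> p = (\<Sum>x\<in>X. c x * schur (l x @ [k]))" if \<chi>: "is_rho k m \<chi>" for \<chi>
      proof -
        have "of_nat (fact m) * \<chi> p = \<chi> (of_nat (fact m) * p)"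
          using \<chi> N True by (simp add: is_rho_def)
        also have "\<dots> = (\<Sum>x\<in>X. c x * \<chi> (schur (l x)))"
          unfolding X(4) by (rule semilinear_sum_schur[of m]) (use \<chi> X in \<open>auto simp: is_rho_def\<close>)
        also have "\<dots> = (\<Sum>x\<in>X. c x * schur (l x @ [k]))"
          by (intro sum.cong refl) (use \<chi> X in \<open>auto simp: is_rho_def\<close>)
        finally show ?thesis .
      qed
      from this[OF that] this[OF is_rho] have "of_nat (fact m) * \<psi> p = of_nat (fact m) * \<phi> p" by simp
      moreover have "(of_nat (fact m) :: (kvar, int) mpoly) \<noteq> 0"
        unfolding of_nat_eq_0_iff by simp
      ultimately show ?thesis by simp
    next
      case False
      then show ?thesis using that is_rho by (simp add: is_rho_def)
    qed
  qed
  have "rho_comp k m = \<phi>"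
    unfolding rho_comp_def by (rule the_equality, rule is_rho, rule unique)
  then show "rho_comp k m p \<in> sym_polys (Suc m)" "rho_comp k m p * vdm (Suc m) = ?b p"
    using \<phi>[OF p] by auto
qed

lemma elem_sym_generating:
  assumes "finite J"
  shows "(\<Sum>k\<le>card J. (-1) ^ k * elem_sym J k * x ^ k) = (\<Prod>j\<in>J. 1 - x * Var (T j))"
proof -
  have "(\<Prod>j\<in>J. 1 - x * Var (T j)) = (\<Sum>S\<in>Pow J. (-1) ^ card S * (\<Prod>j\<in>S. x * Var (T j)))"
    using prod_diff_conv_sum[OF assms, of "\<lambda>_. 1" "\<lambda>j. x * Var (T j)"] by simp
  also have "\<dots> = (\<Sum>S\<in>Pow J. (-1) ^ card S * x ^ card S * (\<Prod>j\<in>S. Var (T j)))"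
    by (simp add: prod.distrib mult.assoc)
  also have "\<dots> = (\<Sum>k\<in>{..card J}. \<Sum>S\<in>{S \<in> Pow J. card S = k}. (-1) ^ card S * x ^ card S * (\<Prod>j\<in>S. Var (T j)))"
    by (rule sum.group[symmetric]) (use assms in \<open>auto intro: card_mono\<close>)
  also have "\<dots> = (\<Sum>k\<le>card J. (-1) ^ k * elem_sym J k * x ^ k)"
    by (intro sum.cong refl) (simp add: elem_sym_def sum_distrib_left sum_distrib_right mult_ac Pow_def)
  finally show ?thesis by simp
qed

lemma elem_sym_in: "elem_sym J k \<in> polys_in (range T)"
  unfolding elem_sym_def by (intro polys_in_sum polys_in_prod polys_in_Var) auto

lemma rho:
  assumes p: "p \<in> sym_polys m" and "finite J"
  shows "rho J m p \<in> sym_polys (Suc m)"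
    and "rho J m p * vdm (Suc m) = bordered m (\<lambda>i. \<Prod>j\<in>J. 1 - Var (U i) * Var (T j)) p"
proof -
  have "(-1) ^ k * elem_sym J k \<in> sym_polys (Suc m)" for k
    using polys_in_of_int[of "(-1) ^ k" "range T"]
    by (intro polys_in_T_sym polys_in_mult elem_sym_in) simp
  then show "rho J m p \<in> sym_polys (Suc m)"
    unfolding rho_def by (intro sym_polys_sum sym_polys_mult[OF _ rho_comp(1)[OF p]])
  have "rho J m p * vdm (Suc m) = (\<Sum>k\<le>card J. (-1) ^ k * elem_sym J k * bordered m (\<lambda>i. Var (U i) ^ k) p)"
    by (simp add: rho_def sum_distrib_right mult.assoc rho_comp(2)[OF p])
  also have "\<dots> = (\<Sum>i<Suc m. (\<Sum>k\<le>card J. (-1) ^ k * elem_sym J k * Var (U i) ^ k) *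
      (omit_u i p * border_cofactor m i))"
    unfolding bordered_def sum_distrib_left sum_distrib_right by (subst sum.swap) (simp add: mult_ac)
  also have "\<dots> = bordered m (\<lambda>i. \<Prod>j\<in>J. 1 - Var (U i) * Var (T j)) p"
    unfolding elem_sym_generating[OF \<open>finite J\<close>] bordered_def by (simp add: mult.assoc)
  finally show "rho J m p * vdm (Suc m) = bordered m (\<lambda>i. \<Prod>j\<in>J. 1 - Var (U i) * Var (T j)) p" .
qed

section \<open>Dimensions of spaces of functions\<close>

context vector_space
begin

lemma finite_independent: "independent B \<Longrightarrow> B \<subseteq> span F \<Longrightarrow> finite F \<Longrightarrow> finite B"
  using independent_span_bound by blast

lemma dim_zero_space: "dim {0} = 0"
  using dim_eq_card_independent[OF independent_empty] dim_span[of "{}"] by simp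

text \<open>Rank-nullity for a finite-dimensional subspace of a possibly infinite-dimensional space.
  A basis of the kernel is extended to one of \<open>S\<close>, and \<open>f\<close> carries the
  added vectors to a basis of the image.\<close>

lemma dim_image_kernel:
  assumes f: "Vector_Spaces.linear scale scale f" and S: "subspace S" "S \<subseteq> span F" "finite F"
  shows "dim S = dim (f ` S) + dim {x \<in> S. f x = 0}"
proof -
  interpret f: Vector_Spaces.linear scale scale f by fact
  let ?K = "{x \<in> S. f x = 0}"
  obtain BK where BK: "BK \<subseteq> ?K" "independent BK" "?K \<subseteq> span BK"
    by (rule maximal_independent_subset)
  obtain B where B: "BK \<subseteq> B" "B \<subseteq> S" "independent B" "S \<subseteq> span B"
    using maximal_independent_subset_extend[of BK S] BK by auto
  have fin: "finite B" using finite_independent[OF B(3) _ S(3)] B(2) S(2) by auto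
  define C where "C = B - BK"
  have C: "C \<subseteq> S" using B(2) by (auto simp: C_def)
  \<comment> \<open>If an added vector had the same image as a combination of the others, the
    difference would lie in the span of the kernel basis, against independence of \<open>B\<close>.
    This yields both injectivity on \<open>C\<close> and independence of its image.\<close>
  have key: "f c \<noteq> f y" if "c \<in> C" "y \<in> span (C - {c})" for c y
  proof
    assume eq: "f c = f y"
    have "y \<in> S" using that(2) span_minimal[OF _ S(1), of "C - {c}"] C by auto
    then have "c - y \<in> ?K" using eq C that(1) S(1) by (auto simp: f.diff subspace_diff)
    then have "c - y \<in> span BK" using BK(3) by auto
    then have "c - y \<in> span (B - {c})"
      using span_mono[of BK "B - {c}"] B(1) that(1) by (auto simp: C_def)
    moreover have "y \<in> span (B - {c})" using that(2) span_mono[of "C - {c}" "B - {c}"] by (auto simp: C_def)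
    ultimately have "(c - y) + y \<in> span (B - {c})" by (rule span_add)
    then show False using B(3) that(1) by (auto simp: dependent_def C_def)
  qed
  have inj: "inj_on f C"
  proof (rule inj_onI, rule ccontr)
    fix c c' assume "c \<in> C" "c' \<in> C" "f c = f c'" "c \<noteq> c'"
    then show False using key[of c c'] by (auto intro: span_base)
  qed
  have "independent (f ` C)"
    unfolding dependent_def
  proof safe
    fix c assume c: "c \<in> C" "f c \<in> span (f ` C - {f c})"
    have "f ` C - {f c} = f ` (C - {c})" using inj c(1) by (auto simp: inj_on_def)
    then have "f c \<in> f ` span (C - {c})" using c(2) by (simp add: f.span_image)
    then show False using key[OF c(1)] by auto
  qed
  moreover have "f ` S \<subseteq> span (f ` C)"
  proof -
    have "f ` B \<subseteq> span (f ` C)"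
    proof safe
      fix b assume "b \<in> B"
      then show "f b \<in> span (f ` C)"
        using BK(1) by (cases "b \<in> BK") (auto simp: C_def span_zero intro: span_base)
    qed
    then have "span (f ` B) \<subseteq> span (f ` C)" by (simp add: span_minimal subspace_span)
    then show ?thesis using B(4) by (auto simp: f.span_image)
  qed
  ultimately have "dim (f ` S) = card C"
    using basis_card_eq_dim[of "f ` C" "f ` S"] image_mono[OF C, of f] by (simp add: card_image[OF inj])
  moreover have "dim ?K = card BK" using basis_card_eq_dim[OF BK(1,3,2)] by simp
  moreover have "dim S = card B" using basis_card_eq_dim[OF B(2,4,3)] by simp
  moreover have "card B = card C + card BK"
    using fin B(1) finite_subset[OF B(1) fin] card_mono[OF fin B(1)] by (simp add: C_def card_Diff_subset)
  ultimately show ?thesis by simp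
qed

lemma dim_image_inj:
  assumes f: "Vector_Spaces.linear scale scale f" and S: "subspace S" "S \<subseteq> span F" "finite F"
    and inj: "\<And>x. x \<in> S \<Longrightarrow> f x = 0 \<Longrightarrow> x = 0"
  shows "dim (f ` S) = dim S"
proof -
  interpret f: Vector_Spaces.linear scale scale f by fact
  have "{x \<in> S. f x = 0} = {0}" using inj S(1) subspace_0 by (auto simp: f.zero)
  then show ?thesis using dim_image_kernel[OF f S] by (simp add: dim_zero_space)
qed

text \<open>By rank-nullity and exactness, the alternating sum up to q telescopes to plus or minus
  the dimension of the image of \<open>X (Suc q)\<close>. Injectivity on the last space closes the
  sum.\<close>

lemma exact_euler_characteristic:
  assumes d: "Vector_Spaces.linear scale scale d"
    and X: "\<And>j. subspace (X j)" "\<And>j. X j \<subseteq> span (F j)" "\<And>j. finite (F j)"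
    and "p > 0"
    and E0: "d ` X 1 = X 0"
    and E: "\<And>j. 0 < j \<Longrightarrow> j < p \<Longrightarrow> {x \<in> X j. d x = 0} = d ` X (Suc j)"
    and Ep: "\<And>x. x \<in> X p \<Longrightarrow> d x = 0 \<Longrightarrow> x = 0"
  shows "(\<Sum>j\<le>p. (-1) ^ j * int (dim (X j))) = 0"
proof -
  have partial: "(\<Sum>j\<le>q. (-1) ^ j * int (dim (X j))) = (-1) ^ q * int (dim (d ` X (Suc q)))" if "q < p" for q
    using that
  proof (induction q)
    case 0
    then show ?case using E0 by simp
  next
    case (Suc q)
    have "dim (X (Suc q)) = dim (d ` X (Suc q)) + dim (d ` X (Suc (Suc q)))"
      using dim_image_kernel[OF d X(1,2,3), of "Suc q"] E[of "Suc q"] Suc.prems by simp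
    then show ?case using Suc by (simp add: algebra_simps)
  qed
  obtain q where q: "p = Suc q" using \<open>p > 0\<close> by (cases p) auto
  have "dim (d ` X p) = dim (X p)" by (rule dim_image_inj[OF d X(1,2,3) Ep])
  then show ?thesis using partial[of q] by (simp add: q)
qed

text \<open>The greedy basis: when a new largest index is added, it joins the standard ones exactly
  if its vector lies outside the span so far, and the status of smaller indices is
  unaffected.\<close>

lemma standard_subset:
  fixes \<Phi> :: "'i::linorder \<Rightarrow> 'b"
  assumes "finite A"
  defines "Std \<equiv> {a \<in> A. \<Phi> a \<notin> span (\<Phi> ` {a' \<in> A. a' < a})}"
  shows "inj_on \<Phi> Std \<and> independent (\<Phi> ` Std) \<and> span (\<Phi> ` Std) = span (\<Phi> ` A)"
  unfolding Std_def using assms(1)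
proof (induction A rule: finite_linorder_max_induct)
  case empty
  show ?case by (simp add: independent_empty)
next
  case (insert b A)
  let ?S = "{a \<in> A. \<Phi> a \<notin> span (\<Phi> ` {a' \<in> A. a' < a})}"
  have lt: "{a' \<in> insert b A. a' < a} = {a' \<in> A. a' < a}" if "a \<in> A" for a
    using insert.hyps that by force
  have lb: "{a' \<in> insert b A. a' < b} = A" using insert.hyps by auto
  have "{a \<in> insert b A. \<Phi> a \<notin> span (\<Phi> ` {a' \<in> insert b A. a' < a})} =
      (if \<Phi> b \<in> span (\<Phi> ` A) then ?S else insert b ?S)" (is "?S' = _")
    using lb lt by auto
  moreover have span: "span (\<Phi> ` ?S) = span (\<Phi> ` A)" and ind: "independent (\<Phi> ` ?S)" and inj: "inj_on \<Phi> ?S"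
    using insert.IH by auto
  moreover have "inj_on \<Phi> (insert b ?S) \<and> independent (\<Phi> ` insert b ?S) \<and> span (\<Phi> ` insert b ?S) = span (\<Phi> ` insert b A)"
    if b: "\<Phi> b \<notin> span (\<Phi> ` A)"
  proof (intro conjI)
    show "inj_on \<Phi> (insert b ?S)" using inj b by (auto intro: span_base)
    show "independent (\<Phi> ` insert b ?S)"
      using ind b span by (simp add: independent_insertI)
    show "span (\<Phi> ` insert b ?S) = span (\<Phi> ` insert b A)"
      using span by (simp add: span_insert)
  qed
  moreover have "span (\<Phi> ` A) = span (\<Phi> ` insert b A)" if "\<Phi> b \<in> span (\<Phi> ` A)"
    using that by (simp add: span_redundant)
  ultimately show ?case by simp
qed

text \<open>Applying \<open>R t\<close> and subtracting \<open>\<chi> b t\<close> times the sum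
  removes the term at b and scales every other one. For each remaining index some \<open>t\<close>
  makes its scalar nonzero.\<close>

lemma eigenvectors_independent:
  fixes \<chi> :: "'i \<Rightarrow> 't \<Rightarrow> 'a"
  assumes R: "\<And>t. Vector_Spaces.linear scale scale (R t)"
    and "finite A" "\<And>a t. a \<in> A \<Longrightarrow> R t (f a) = scale (\<chi> a t) (f a)" "inj_on \<chi> A"
    and "(\<Sum>a\<in>A. f a) = 0" "a \<in> A"
  shows "f a = 0"
  using assms(2-)
proof (induction A arbitrary: f a rule: finite_induct)
  case (insert b A)
  have "f a = 0" if "a \<in> A" for a
  proof -
    have "\<chi> a \<noteq> \<chi> b" using insert.hyps insert.prems(2) that by (auto simp: inj_on_def)
    then obtain t where t: "\<chi> a t \<noteq> \<chi> b t" by auto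
    interpret t: Vector_Spaces.linear scale scale "R t" by (rule R)
    let ?g = "\<lambda>a. scale (\<chi> a t - \<chi> b t) (f a)"
    have "R t (\<Sum>a\<in>insert b A. f a) - scale (\<chi> b t) (\<Sum>a\<in>insert b A. f a) = 0"
      using insert.prems(3) by (simp add: t.zero)
    then have "(\<Sum>a\<in>insert b A. ?g a) = 0"
      using insert.prems(1) by (simp only: t.sum scale_sum_right scale_left_diff_distrib sum_subtractf cong: sum.cong)
    then have "(\<Sum>a\<in>A. ?g a) = 0" using insert.hyps by simp
    moreover have "R s (?g c) = scale (\<chi> c s) (?g c)" if "c \<in> A" for c s
    proof -
      interpret s: Vector_Spaces.linear scale scale "R s" by (rule R)
      show ?thesis using insert.prems(1)[of c s] that by (simp add: s.scale mult.commute)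
    qed
    moreover have "inj_on \<chi> A" using insert.prems(2) by auto
    ultimately have "?g a = 0" using insert.IH[of ?g a] that by blast
    then show ?thesis using t by simp
  qed
  then have "f b = 0" using insert by simp
  then show ?case using insert.prems(4) \<open>\<And>a. a \<in> A \<Longrightarrow> f a = 0\<close> by auto
qed simp

end

interpretation fv: vector_space "\<lambda>(c::'k::field) (f::'a \<Rightarrow> 'k) x. c * f x"
  by unfold_locales (auto simp: fun_eq_iff algebra_simps)

abbreviation fun_linear :: "(('a \<Rightarrow> 'k::field) \<Rightarrow> 'b \<Rightarrow> 'k) \<Rightarrow> bool" where
  "fun_linear \<equiv> Vector_Spaces.linear (\<lambda>c f x. c * f x) (\<lambda>c f x. c * f x)"

lemma sum_fun_apply: "(\<Sum>i\<in>I. f i) x = (\<Sum>i\<in>I. f i x)" for f :: "'i \<Rightarrow> 'a \<Rightarrow> 'k::field"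
  by (induction I rule: infinite_finite_induct) auto

section \<open>The Koszul complex of a space of products of linear forms\<close>

lemma multidegree_push:
  "multidegree d m = push_mono (\<lambda>x. U (fst x)) m + push_mono (\<lambda>x. T (d + snd x)) m"
  by (simp add: multidegree_def push_mono_def sum.distrib case_prod_unfold)

lemma multidegree_add: "multidegree d (m + m') = multidegree d m + multidegree d m'"
  by (simp add: multidegree_push push_mono_add add_ac)

lemma multidegree_single: "multidegree d (single (i, j) k) = single (U i) k + single (T (d + j)) k"
  by (simp add: multidegree_push)

text \<open>The weights are the linear coefficients of the Lagrange basis polynomials for the nodes
  0, ..., N, which are distinct in characteristic zero.\<close>

lemma coeff_1_weights:
  "\<exists>w. \<forall>p :: 'k::field_char_0 poly. degree p \<le> N \<longrightarrow> (\<Sum>q\<le>N. w q * poly p (of_nat q)) = coeff p 1"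
proof -
  let ?l = "\<lambda>q. smult (1 / (\<Prod>q'\<in>{..N} - {q}. of_nat q - of_nat q')) (\<Prod>q'\<in>{..N} - {q}. [:- of_nat q', 1:]) :: 'k poly"
  have val: "poly (?l q) (of_nat s) = (if q = s then 1 else 0)" if "q \<le> N" "s \<le> N" for q s
    using that by (auto simp: poly_prod)
  have deg: "degree (?l q) \<le> N" if "q \<le> N" for q
  proof -
    have "degree (?l q) \<le> degree (\<Prod>q'\<in>{..N} - {q}. [:- of_nat q', 1:] :: 'k poly)"
      by (rule degree_smult_le)
    also have "\<dots> \<le> (\<Sum>q'\<in>{..N} - {q}. degree ([:- of_nat q', 1:] :: 'k poly))"
      by (rule degree_prod_sum_le[unfolded o_def]) simp
    also have "\<dots> = N" using that by simp
    finally show ?thesis .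
  qed
  have "(\<Sum>q\<le>N. coeff (?l q) 1 * poly p (of_nat q)) = coeff p 1" if p: "degree p \<le> N" for p :: "'k poly"
  proof -
    let ?s = "\<Sum>q\<le>N. smult (poly p (of_nat q)) (?l q)"
    have "p = ?s"
    proof (rule poly_eqI_degree[of "of_nat ` {..N}"])
      have "card (of_nat ` {..N} :: 'k set) = Suc N" by (simp add: card_image inj_on_def)
      moreover have "degree ?s \<le> N"
        by (intro degree_sum_le) (use deg degree_smult_le order_trans in blast)+
      ultimately show "degree p < card (of_nat ` {..N} :: 'k set)" "degree ?s < card (of_nat ` {..N} :: 'k set)"
        using p by auto
      fix x assume "x \<in> (of_nat ` {..N} :: 'k set)"
      then obtain s where s: "s \<le> N" "x = of_nat s" by auto
      have "poly ?s x = (\<Sum>q\<le>N. poly p (of_nat q) * (if q = s then 1 else 0))"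
        unfolding poly_sum s(2) poly_smult[of "poly p _"]
        by (intro sum.cong refl arg_cong2[of _ _ _ _ "(*)"] val) (use s in auto)
      also have "\<dots> = poly p x" using s by (simp add: if_distrib cong: if_cong)
      finally show "poly p x = poly ?s x" by simp
    qed
    then have "coeff p 1 = coeff ?s 1" by (rule arg_cong)
    also have "\<dots> = (\<Sum>q\<le>N. coeff (?l q) 1 * poly p (of_nat q))"
      by (simp add: coeff_sum mult.commute)
    finally show ?thesis by simp
  qed
  then show ?thesis by (intro exI[of _ "\<lambda>q. coeff (?l q) 1"] allI impI)
qed

text \<open>
  Extracting the coefficient of \<open>\<epsilon>\<close> by interpolation at \<open>0, \<dots>, N\<close> makes polarisation linear on
  arbitrary functions, not only on polynomial ones.
\<close>

definition coeff_1 :: "nat \<Rightarrow> ('k::field_char_0 \<Rightarrow> 'k) \<Rightarrow> 'k" where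
  "coeff_1 N h = (\<Sum>q\<le>N. (SOME w. \<forall>p :: 'k poly. degree p \<le> N \<longrightarrow>
     (\<Sum>q\<le>N. w q * poly p (of_nat q)) = coeff p 1) q * h (of_nat q))"

lemma coeff_1:
  assumes "degree p \<le> N" "\<And>\<epsilon>. h \<epsilon> = poly p \<epsilon>"
  shows "coeff_1 N h = coeff p 1"
  using someI_ex[OF coeff_1_weights[of N, where 'k = 'a]] assms unfolding coeff_1_def by simp

lemma coeff_1_add: "coeff_1 N (\<lambda>\<epsilon>. h \<epsilon> + h' \<epsilon>) = coeff_1 N h + coeff_1 N h'"
  by (simp add: coeff_1_def algebra_simps sum.distrib)

lemma coeff_1_scale: "coeff_1 N (\<lambda>\<epsilon>. c * h \<epsilon>) = c * coeff_1 N h"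
  by (simp add: coeff_1_def sum_distrib_left mult_ac)

section \<open>Polarisation and substitution of rows\<close>

definition remove_nth :: "nat \<Rightarrow> 'a list \<Rightarrow> 'a list" where
  "remove_nth q xs = take q xs @ drop (Suc q) xs"

lemma length_remove_nth: "q < length xs \<Longrightarrow> length (remove_nth q xs) = length xs - 1"
  by (simp add: remove_nth_def)

lemma nth_remove_nth:
  "q < length xs \<Longrightarrow> t < length xs - 1 \<Longrightarrow> remove_nth q xs ! t = xs ! insert_index q t"
  by (auto simp: remove_nth_def nth_append insert_index_def min_def)

lemma set_remove_nth: "set (remove_nth q xs) \<subseteq> set xs"
  by (auto simp: remove_nth_def dest: in_set_takeD in_set_dropD)

lemma remove_nth_Cons: "remove_nth 0 (x # xs) = xs" "remove_nth (Suc q) (x # xs) = x # remove_nth q xs"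
  by (simp_all add: remove_nth_def)

text \<open>The degree of a minor in the odd rows: each column counts once, and there is no
  u-part.\<close>

definition column_degree :: "nat \<Rightarrow> nat list \<Rightarrow> (kvar \<Rightarrow>\<^sub>0 nat)" where
  "column_degree d cs = (\<Sum>c\<leftarrow>cs. single (T (d + c)) 1)"

lemma column_degree_Cons: "column_degree d (c # cs) = single (T (d + c)) 1 + column_degree d cs"
  by (simp add: column_degree_def)

lemma column_degree_remove_nth:
  "q < length cs \<Longrightarrow> column_degree d cs = single (T (d + cs ! q)) 1 + column_degree d (remove_nth q cs)"
proof (induction cs arbitrary: q)
  case (Cons c cs)
  then show ?case by (cases q) (simp_all add: remove_nth_Cons column_degree_Cons add_ac)
qed simp

definition shift_row :: "nat \<Rightarrow> (nat \<Rightarrow> nat \<Rightarrow> 'k) \<Rightarrow> (nat \<Rightarrow> 'k) \<Rightarrow> 'k::field \<Rightarrow> (nat \<Rightarrow> nat \<Rightarrow> 'k)" where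
  "shift_row i g z \<epsilon> = g(i := \<lambda>k. g i k + \<epsilon> * z k)"

text \<open>The even rows \<open>g\<close> and the odd rows \<open>y\<close>. Both are infinite
  sequences of row vectors, so the same functions serve for every number of rows.\<close>

type_synonym 'k point = "(nat \<Rightarrow> nat \<Rightarrow> 'k) \<times> (nat \<Rightarrow> nat \<Rightarrow> 'k)"

lemma linear_funI:
  fixes f :: "('a \<Rightarrow> 'k::field) \<Rightarrow> 'b \<Rightarrow> 'k"
  assumes "\<And>x y. f (\<lambda>z. x z + y z) = (\<lambda>z. f x z + f y z)" "\<And>c x. f (\<lambda>z. c * x z) = (\<lambda>z. c * f x z)"
  shows "fun_linear f"
  unfolding Vector_Spaces.linear_iff using assms
  by (auto simp: fv.vector_space_axioms plus_fun_def)

text \<open>The contracting homotopy. Each of the j + 1 odd rows in turn is the direction of a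
  derivative of \<open>f\<close> in row i, the others fill the j odd arguments of \<open>f\<close>,
  and the signs make the result antisymmetric if \<open>f\<close> is.\<close>

definition polarize :: "nat \<Rightarrow> nat \<Rightarrow> nat \<Rightarrow> ('k::field_char_0 point \<Rightarrow> 'k) \<Rightarrow> ('k point \<Rightarrow> 'k)" where
  "polarize i N j f = (\<lambda>(g, y). \<Sum>l\<le>j. (-1) ^ l *
     coeff_1 N (\<lambda>\<epsilon>. f (shift_row i g (y l) \<epsilon>, \<lambda>t. y (insert_index l t))))"

text \<open>The Koszul differential: row i of \<open>g\<close> becomes the first odd argument, and
  the odd rows move up by one place.\<close>

definition plug_in :: "nat \<Rightarrow> ('k::field_char_0 point \<Rightarrow> 'k) \<Rightarrow> ('k point \<Rightarrow> 'k)" where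
  "plug_in i f = (\<lambda>(g, y). f (g, case_nat (g i) y))"

lemma linear_plug_in: "fun_linear (plug_in i)"
  by (rule linear_funI) (auto simp: plug_in_def fun_eq_iff)

lemma linear_polarize: "fun_linear (polarize i N j)"
  by (rule linear_funI)
     (auto simp: polarize_def fun_eq_iff coeff_1_add coeff_1_scale algebra_simps sum.distrib sum_distrib_left
       simp del: sum.atMost_Suc)

lemma sum_list_fun_apply: "(\<Sum>t\<leftarrow>ts. f t) x = (\<Sum>t\<leftarrow>ts. f t x)"
  for f :: "'t \<Rightarrow> 'a \<Rightarrow> 'k::field"
  by (induction ts) auto

lemma sum_sum_list_swap: "(\<Sum>i\<in>I. \<Sum>t\<leftarrow>ts. f i t) = (\<Sum>t\<leftarrow>ts. \<Sum>i\<in>I. f i t)"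
  for f :: "'i \<Rightarrow> 't \<Rightarrow> 'k::field"
  by (induction ts) (auto simp: sum.distrib)

text \<open>\<open>L x c\<close> stands for entry c of the product of the row vector
  \<open>x\<close> with a fixed matrix. Of that matrix only linearity in \<open>x\<close> and the
  bound r on the rank are retained; n is the number of columns and d the offset of their t
  variables.\<close>

locale row_forms =
  fixes L :: "(nat \<Rightarrow> 'k::field_char_0) \<Rightarrow> nat \<Rightarrow> 'k" and d n r :: nat
  assumes L_add: "L (\<lambda>k. x k + y k) c = L x c + L y c"
    and L_scale: "L (\<lambda>k. a * x k) c = a * L x c"
    and L_rank: "r < j \<Longrightarrow> det (mat j j (\<lambda>(l, q). L (z l) (cs q))) = 0"
begin

definition form_mono :: "(nat \<times> nat \<Rightarrow>\<^sub>0 nat) \<Rightarrow> (nat \<Rightarrow> nat \<Rightarrow> 'k) \<Rightarrow> 'k" where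
  "form_mono m g = mev (\<lambda>x. L (g (fst x)) (snd x)) m"

definition odet :: "nat list \<Rightarrow> (nat \<Rightarrow> nat \<Rightarrow> 'k) \<Rightarrow> 'k" where
  "odet cs y = det (mat (length cs) (length cs) (\<lambda>(l, q). L (y l) (cs ! q)))"

definition gen :: "(nat \<times> nat \<Rightarrow>\<^sub>0 nat) \<Rightarrow> nat list \<Rightarrow> 'k point \<Rightarrow> 'k" where
  "gen m cs = (\<lambda>(g, y). form_mono m g * odet cs y)"

text \<open>The column list may be unsorted or repeat entries. Such minors are zero or agree up to
  sign with others, which leaves the span unchanged.\<close>

definition gens :: "nat \<Rightarrow> (kvar \<Rightarrow>\<^sub>0 nat) \<Rightarrow> ('k point \<Rightarrow> 'k) set" where
  "gens j e = {gen m cs | m cs. length cs = j \<and> set cs \<subseteq> {..<n} \<and> snd ` keys m \<subseteq> {..<n} \<and>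
     multidegree d m + column_degree d cs = e}"

definition hdim :: "nat \<Rightarrow> (kvar \<Rightarrow>\<^sub>0 nat) \<Rightarrow> nat" where
  "hdim j e = fv.dim (gens j e)"

lemma form_mono_add: "form_mono (m + m') g = form_mono m g * form_mono m' g"
  by (simp add: form_mono_def mev_add)

lemma form_mono_single: "form_mono (single (i, c) 1) g = L (g i) c"
  by (simp add: form_mono_def)

lemma form_mono_0 [simp]: "form_mono 0 g = 1"
  by (simp add: form_mono_def)

text \<open>The list \<open>ts\<close> has one entry (m', c) for each factor of m in row i, counted
  with multiplicity, where m' is m without that factor. The derivative in row i is then a sum over
  \<open>ts\<close>, and the degree bound by \<open>length ts\<close> is what makes interpolation
  exact.\<close>

definition polarization :: "nat \<Rightarrow> (nat \<times> nat \<Rightarrow>\<^sub>0 nat) \<Rightarrow> ((nat \<times> nat \<Rightarrow>\<^sub>0 nat) \<times> nat) list \<Rightarrow> bool" where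
  "polarization i m ts \<longleftrightarrow> (\<forall>(m', c)\<in>set ts. m' + single (i, c) 1 = m) \<and>
     length ts = lookup (push_mono fst m) i \<and>
     (\<forall>g z. \<exists>p. degree p \<le> length ts \<and> (\<forall>\<epsilon>. form_mono m (shift_row i g z \<epsilon>) = poly p \<epsilon>) \<and>
       coeff p 0 = form_mono m g \<and> coeff p 1 = (\<Sum>(m', c)\<leftarrow>ts. form_mono m' g * L z c))"

text \<open>The product rule: old entries acquire the new factor, and the factor itself yields a new
  entry if it lies in row i. Correspondingly the polynomial in the shift parameter is multiplied by
  a linear one.\<close>

lemma polarization_add:
  assumes "polarization i m ts"
  shows "polarization i (m + single x 1)
    (map (\<lambda>(m', c). (m' + single x 1, c)) ts @ (if fst x = i then [(m, snd x)] else []))"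
    (is "polarization i ?m ?ts")
  unfolding polarization_def
proof (intro conjI allI)
  have ts: "\<forall>(m', c)\<in>set ts. m' + single (i, c) 1 = m" "length ts = lookup (push_mono fst m) i"
    using assms by (auto simp: polarization_def)
  show "\<forall>(m', c)\<in>set ?ts. m' + single (i, c) 1 = ?m"
  proof safe
    fix m' c assume "(m', c) \<in> set ?ts"
    then consider m'' where "m' = m'' + single x 1" "(m'', c) \<in> set ts" | "m' = m" "x = (i, c)"
      by (cases x) (auto split: if_splits)
    then show "m' + single (i, c) 1 = ?m"
    proof cases
      case 1
      then have m: "m = m'' + single (i, c) 1" using ts(1) by auto
      show ?thesis unfolding 1(1) m by (simp only: add_ac)
    qed simp
  qed
  show len: "length ?ts = lookup (push_mono fst ?m) i"
    using ts(2) by (auto simp: push_mono_add lookup_add lookup_single when_def)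
  fix g z
  obtain p where p: "degree p \<le> length ts" "\<And>\<epsilon>. form_mono m (shift_row i g z \<epsilon>) = poly p \<epsilon>"
    "coeff p 0 = form_mono m g" "coeff p 1 = (\<Sum>(m', c)\<leftarrow>ts. form_mono m' g * L z c)"
    using assms unfolding polarization_def by blast
  let ?a = "L (g (fst x)) (snd x)" and ?b = "if fst x = i then L z (snd x) else 0"
  let ?p = "p * [:?a, ?b:]"
  have x: "form_mono (single x (Suc 0)) g = L (g (fst x)) (snd x)" for g
    using form_mono_single[of "fst x" "snd x" g] by simp
  have "degree ?p \<le> degree p + degree [:?a, ?b:]" by (rule degree_mult_le)
  also have "\<dots> \<le> length ?ts" using p(1) by auto
  finally have "degree ?p \<le> length ?ts" .
  moreover have "form_mono ?m (shift_row i g z \<epsilon>) = poly ?p \<epsilon>" for \<epsilon>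
    using p(2)[of \<epsilon>] by (auto simp: form_mono_add x shift_row_def L_add L_scale algebra_simps)
  moreover have "coeff ?p 0 = form_mono ?m g"
    by (simp add: form_mono_add x p(3) mult_ac)
  moreover have "coeff ?p 1 = (\<Sum>(m', c)\<leftarrow>?ts. form_mono m' g * L z c)"
  proof -
    have "coeff ?p 1 = ?a * coeff p 1 + ?b * coeff p 0"
      by (simp add: mult.commute[of p] coeff_pCons)
    also have "?a * coeff p 1 = (\<Sum>(m', c)\<leftarrow>map (\<lambda>(m', c). (m' + single x 1, c)) ts. form_mono m' g * L z c)"
      unfolding p(4) by (induction ts) (auto simp: form_mono_add x algebra_simps)
    also have "?b * coeff p 0 = (\<Sum>(m', c)\<leftarrow>(if fst x = i then [(m, snd x)] else []). form_mono m' g * L z c)"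
      by (simp add: p(3))
    finally show ?thesis by simp
  qed
  ultimately show "\<exists>p. degree p \<le> length ?ts \<and> (\<forall>\<epsilon>. form_mono ?m (shift_row i g z \<epsilon>) = poly p \<epsilon>) \<and>
      coeff p 0 = form_mono ?m g \<and> coeff p 1 = (\<Sum>(m', c)\<leftarrow>?ts. form_mono m' g * L z c)"
    by blast
qed

lemma polarization_exists: "\<exists>ts. polarization i m ts"
proof (induction m rule: monomial_induct)
  case zero
  have "polarization i 0 []"
    by (auto simp: polarization_def intro!: exI[of _ 1])
  then show ?case ..
next
  case (add m x)
  then show ?case using polarization_add by blast
qed

lemma odet_column:
  assumes "q < length cs"
  shows "odet cs y = (\<Sum>l<length cs. (-1) ^ (l + q) * L (y l) (cs ! q) *
    odet (remove_nth q cs) (\<lambda>t. y (insert_index l t)))"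
proof -
  let ?A = "mat (length cs) (length cs) (\<lambda>(l, q). L (y l) (cs ! q))"
  have "odet cs y = (\<Sum>l<length cs. ?A $$ (l, q) * cofactor ?A l q)"
    unfolding odet_def by (rule laplace_expansion_column) (use assms in auto)
  also have "\<dots> = (\<Sum>l<length cs. (-1) ^ (l + q) * L (y l) (cs ! q) *
    odet (remove_nth q cs) (\<lambda>t. y (insert_index l t)))"
  proof (intro sum.cong refl)
    fix l assume l: "l \<in> {..<length cs}"
    have "mat_delete ?A l q = mat (length cs - 1) (length cs - 1)
        (\<lambda>(t, s). L (y (insert_index l t)) (remove_nth q cs ! s))"
      using assms l by (intro eq_matI) (auto simp: mat_delete_def nth_remove_nth insert_index_def)
    then show "?A $$ (l, q) * cofactor ?A l q = (-1) ^ (l + q) * L (y l) (cs ! q) *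
        odet (remove_nth q cs) (\<lambda>t. y (insert_index l t))"
      using assms l by (simp add: cofactor_def odet_def length_remove_nth)
  qed
  finally show ?thesis .
qed

lemma odet_row:
  assumes "cs \<noteq> []"
  shows "odet cs (case_nat z y) = (\<Sum>q<length cs. (-1) ^ q * L z (cs ! q) * odet (remove_nth q cs) y)"
proof -
  let ?A = "mat (length cs) (length cs) (\<lambda>(l, q). L (case_nat z y l) (cs ! q))"
  have "odet cs (case_nat z y) = (\<Sum>q<length cs. ?A $$ (0, q) * cofactor ?A 0 q)"
    unfolding odet_def by (rule laplace_expansion_row) (use assms in auto)
  also have "\<dots> = (\<Sum>q<length cs. (-1) ^ q * L z (cs ! q) * odet (remove_nth q cs) y)"
  proof (intro sum.cong refl)
    fix q assume q: "q \<in> {..<length cs}"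
    have "mat_delete ?A 0 q = mat (length cs - 1) (length cs - 1) (\<lambda>(t, s). L (y t) (remove_nth q cs ! s))"
      using assms q by (intro eq_matI) (auto simp: mat_delete_def nth_remove_nth insert_index_def)
    then show "?A $$ (0, q) * cofactor ?A 0 q = (-1) ^ q * L z (cs ! q) * odet (remove_nth q cs) y"
      using assms q by (simp add: cofactor_def odet_def length_remove_nth)
  qed
  finally show ?thesis .
qed

lemma odet_Cons:
  "odet (c # cs) y = (\<Sum>l\<le>length cs. (-1) ^ l * L (y l) c * odet cs (\<lambda>t. y (insert_index l t)))"
  using odet_column[of 0 "c # cs" y] by (simp add: remove_nth_Cons lessThan_Suc_atMost del: sum.lessThan_Suc)

text \<open>Expanding both sides along the moved column gives the same minors; the sign is the
  difference between the positions 0 and q.\<close>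

lemma odet_move:
  assumes "q < length cs"
  shows "odet (cs ! q # remove_nth q cs) y = (-1) ^ q * odet cs y"
proof -
  have "length (remove_nth q cs) = length cs - 1" by (rule length_remove_nth[OF assms])
  then have "{..length (remove_nth q cs)} = {..<length cs}" using assms by auto
  then show ?thesis
    unfolding odet_Cons odet_column[OF assms]
    by (simp add: sum_distrib_left power_add mult_ac)
qed

text \<open>The signed sum over the odd row used as direction is the Laplace expansion, along its
  first column, of the minor with column c put in front.\<close>

lemma polarize_gen:
  assumes ts: "polarization i m ts" and N: "length ts \<le> N"
  shows "polarize i N (length cs) (gen m cs) = (\<Sum>(m', c)\<leftarrow>ts. gen m' (c # cs))"
proof
  fix x :: "'k point"
  obtain g y where x: "x = (g, y)" by (cases x)
  have c1: "coeff_1 N (\<lambda>\<epsilon>. form_mono m (shift_row i g z \<epsilon>)) = (\<Sum>(m', c)\<leftarrow>ts. form_mono m' g * L z c)" for z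
  proof -
    obtain p where p: "degree p \<le> length ts" "\<And>\<epsilon>. form_mono m (shift_row i g z \<epsilon>) = poly p \<epsilon>"
      "coeff p 1 = (\<Sum>(m', c)\<leftarrow>ts. form_mono m' g * L z c)"
      using ts unfolding polarization_def by blast
    show ?thesis using coeff_1[of p N, OF order_trans[OF p(1) N] p(2)] p(3) by simp
  qed
  have "polarize i N (length cs) (gen m cs) x = (\<Sum>l\<le>length cs. (-1) ^ l *
      (odet cs (\<lambda>t. y (insert_index l t)) * (\<Sum>(m', c)\<leftarrow>ts. form_mono m' g * L (y l) c)))"
    by (simp add: polarize_def x gen_def c1 coeff_1_scale mult.commute[of "form_mono m _"])
  also have "\<dots> = (\<Sum>l\<le>length cs. \<Sum>(m', c)\<leftarrow>ts. form_mono m' g *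
      ((-1) ^ l * L (y l) c * odet cs (\<lambda>t. y (insert_index l t))))"
    by (intro sum.cong refl) (simp add: case_prod_unfold mult_ac flip: sum_list_const_mult)
  also have "\<dots> = (\<Sum>(m', c)\<leftarrow>ts. form_mono m' g * odet (c # cs) y)"
    by (simp add: case_prod_unfold sum_sum_list_swap odet_Cons sum_distrib_left)
  also have "\<dots> = (\<Sum>(m', c)\<leftarrow>ts. gen m' (c # cs)) x"
    by (simp add: sum_list_fun_apply gen_def x case_prod_unfold)
  finally show "polarize i N (length cs) (gen m cs) x = (\<Sum>(m', c)\<leftarrow>ts. gen m' (c # cs)) x" .
qed

lemma plug_in_gen:
  assumes "cs \<noteq> []"
  shows "plug_in i (gen m cs) =
    (\<Sum>q<length cs. (\<lambda>x. (-1) ^ q * gen (m + single (i, cs ! q) 1) (remove_nth q cs) x))"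
proof
  fix x :: "'k point"
  obtain g y where x: "x = (g, y)" by (cases x)
  have "plug_in i (gen m cs) x = (\<Sum>q<length cs. form_mono m g * ((-1) ^ q * L (g i) (cs ! q) * odet (remove_nth q cs) y))"
    by (simp add: x plug_in_def gen_def odet_row[OF assms] sum_distrib_left)
  also have "\<dots> = (\<Sum>q<length cs. (-1) ^ q * gen (m + single (i, cs ! q) 1) (remove_nth q cs) x)"
    by (intro sum.cong refl) (simp add: x gen_def form_mono_add form_mono_single[simplified])
  finally show "plug_in i (gen m cs) x =
      (\<Sum>q<length cs. (\<lambda>x. (-1) ^ q * gen (m + single (i, cs ! q) 1) (remove_nth q cs) x)) x"
    by (simp add: sum_fun_apply)
qed

text \<open>Differential after homotopy plus homotopy after differential is multiplication by the
  total degree in row i and the odd rows. Factors in row i contribute once each through the first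
  composition, columns of the minor once each through the second, and all mixed terms cancel. When
  \<open>cs\<close> is nonempty, \<open>N\<close> exceeds the row degree because the differential
  raises that degree by one before polarisation.\<close>

lemma homotopy_gen:
  assumes N: "lookup (push_mono fst m) i + (if cs = [] then 0 else 1) \<le> N"
  shows "plug_in i (polarize i N (length cs) (gen m cs)) (g, y) +
      (if cs = [] then 0 else polarize i N (length cs - 1) (plug_in i (gen m cs)) (g, y)) =
      of_nat (lookup (push_mono fst m) i + length cs) * gen m cs (g, y)"
proof -
  obtain ts where ts: "polarization i m ts" using polarization_exists by blast
  have mem: "m' + single (i, c) 1 = m" if "(m', c) \<in> set ts" for m' c
    using ts that by (auto simp: polarization_def)
  have len: "length ts = lookup (push_mono fst m) i" using ts by (simp add: polarization_def)
  \<comment> \<open>The mixed terms: one factor of m has moved into the minor while column q has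
    left it as a factor in row i. They enter the two compositions with opposite signs.\<close>
  let ?S = "\<Sum>(m', c)\<leftarrow>ts. \<Sum>q<length cs. (-1) ^ q * (form_mono m' g * L (g i) (cs ! q) * odet (c # remove_nth q cs) y)"
  have ds: "plug_in i (polarize i N (length cs) (gen m cs)) (g, y) = of_nat (length ts) * gen m cs (g, y) - ?S"
  proof -
    have "plug_in i (polarize i N (length cs) (gen m cs)) (g, y) =
        (\<Sum>(m', c)\<leftarrow>ts. form_mono m' g * odet (c # cs) (case_nat (g i) y))"
      using N len by (subst polarize_gen[OF ts])
        (auto simp: plug_in_def sum_list_fun_apply gen_def case_prod_unfold)
    also have "\<dots> = (\<Sum>(m', c)\<leftarrow>ts. form_mono m g * odet cs y -
        (\<Sum>q<length cs. (-1) ^ q * (form_mono m' g * L (g i) (cs ! q) * odet (c # remove_nth q cs) y)))"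
    proof (intro arg_cong[of _ _ sum_list] map_cong refl, clarify)
      fix m' c assume "(m', c) \<in> set ts"
      have "form_mono m' g * L (g i) c = form_mono m g"
        using form_mono_add[of m' "single (i, c) 1" g] mem[OF \<open>(m', c) \<in> set ts\<close>]
        by (simp only: form_mono_single)
      moreover have "odet (c # cs) (case_nat (g i) y) = L (g i) c * odet cs y -
          (\<Sum>q<length cs. (-1) ^ q * (L (g i) (cs ! q) * odet (c # remove_nth q cs) y))"
        by (subst odet_row, simp)
           (simp add: sum.lessThan_Suc_shift remove_nth_Cons sum_negf mult.assoc del: sum.lessThan_Suc)
      ultimately show "form_mono m' g * odet (c # cs) (case_nat (g i) y) = form_mono m g * odet cs y -
          (\<Sum>q<length cs. (-1) ^ q * (form_mono m' g * L (g i) (cs ! q) * odet (c # remove_nth q cs) y))"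
        by (simp add: right_diff_distrib sum_distrib_left mult_ac)
    qed
    also have "\<dots> = of_nat (length ts) * gen m cs (g, y) - ?S"
      by (induction ts) (auto simp: gen_def algebra_simps)
    finally show ?thesis .
  qed
  show ?thesis
  proof (cases "cs = []")
    case True
    then show ?thesis using ds len by (simp add: case_prod_unfold)
  next
    case False
    interpret p: Vector_Spaces.linear "\<lambda>c f x. c * f x" "\<lambda>c f x. c * f x" "polarize i N (length cs - 1) :: ('k point \<Rightarrow> 'k) \<Rightarrow> _"
      by (rule linear_polarize)
    \<comment> \<open>The factor produced by the differential adds one polarisation term, in which
      column q returns to the front of its minor; \<open>odet_move\<close> accounts for its
      sign.\<close>
    have pol: "polarize i N (length cs - 1) (gen (m + single (i, cs ! q) 1) (remove_nth q cs)) (g, y) =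
        (\<Sum>(m', c)\<leftarrow>ts. form_mono m' g * L (g i) (cs ! q) * odet (c # remove_nth q cs) y) +
        (-1) ^ q * gen m cs (g, y)" if q: "q < length cs" for q
    proof -
      have l: "length cs - 1 = length (remove_nth q cs)" using q by (simp add: length_remove_nth)
      have "polarize i N (length cs - 1) (gen (m + single (i, cs ! q) 1) (remove_nth q cs)) =
        (\<Sum>(m', c)\<leftarrow>map (\<lambda>(m', c). (m' + single (i, cs ! q) 1, c)) ts @ [(m, cs ! q)]. gen m' (c # remove_nth q cs))"
        unfolding l using polarization_add[OF ts, of "(i, cs ! q)"] N len False
        by (intro polarize_gen) auto
      then show ?thesis
        by (simp add: sum_list_fun_apply gen_def case_prod_unfold o_def form_mono_add
            form_mono_single[simplified] odet_move[OF q])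
    qed
    have "polarize i N (length cs - 1) (plug_in i (gen m cs)) (g, y) =
        (\<Sum>q<length cs. (-1) ^ q * polarize i N (length cs - 1) (gen (m + single (i, cs ! q) 1) (remove_nth q cs)) (g, y))"
      unfolding plug_in_gen[OF False] p.sum p.scale by (simp only: sum_fun_apply)
    also have "\<dots> = (\<Sum>q<length cs. (-1) ^ q * (\<Sum>(m', c)\<leftarrow>ts. form_mono m' g * L (g i) (cs ! q) * odet (c # remove_nth q cs) y)
        + gen m cs (g, y))"
    proof (intro sum.cong refl)
      fix q assume "q \<in> {..<length cs}"
      then have q: "q < length cs" by simp
      show "(-1) ^ q * polarize i N (length cs - 1) (gen (m + single (i, cs ! q) 1) (remove_nth q cs)) (g, y) =
          (-1) ^ q * (\<Sum>(m', c)\<leftarrow>ts. form_mono m' g * L (g i) (cs ! q) * odet (c # remove_nth q cs) y)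
          + gen m cs (g, y)"
        unfolding pol[OF q] by (simp add: distrib_left)
    qed
    also have "\<dots> = ?S + of_nat (length cs) * gen m cs (g, y)"
      by (simp add: sum.distrib case_prod_unfold sum_sum_list_swap flip: sum_list_const_mult)
    finally show ?thesis using ds len False by (simp add: algebra_simps)
  qed
qed

end

section \<open>Multidegrees and finiteness\<close>

lemma keys_add_nat: "keys (m + m') = keys m \<union> keys (m' :: 'x \<Rightarrow>\<^sub>0 nat)"
  by (auto simp: in_keys_iff lookup_add)

lemma push_mono_push_mono: "push_mono f (push_mono g m) = push_mono (\<lambda>x. f (g x)) m"
  by (induction m rule: monomial_induct) (simp_all add: push_mono_add)

lemma lookup_le_push_mono: "lookup m x \<le> lookup (push_mono f m) (f x)"
proof (cases "x \<in> keys m")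
  case True
  then have "lookup m x \<le> (\<Sum>x'\<in>keys m. if f x' = f x then lookup m x' else 0)"
    using member_le_sum[of x "keys m" "\<lambda>x'. if f x' = f x then lookup m x' else 0"] by simp
  then show ?thesis by (simp add: push_mono_def lookup_sum lookup_single when_def)
qed (simp add: in_keys_iff)

lemma lookup_multidegree_U: "lookup (multidegree d m) (U i) = lookup (push_mono fst m) i"
proof -
  have "lookup (push_mono (\<lambda>x. T (d + snd x)) m) (U i) = 0"
    by (auto simp: not_in_keys_iff_lookup_eq_zero[symmetric] keys_push_mono)
  moreover have "push_mono (\<lambda>x. U (fst x)) m = push_mono U (push_mono fst m)"
    by (simp add: push_mono_push_mono)
  ultimately show ?thesis
    by (simp add: multidegree_push lookup_add lookup_push_mono inj_def)
qed

lemma keys_multidegree: "keys (multidegree d m) = (\<lambda>x. U (fst x)) ` keys m \<union> (\<lambda>x. T (d + snd x)) ` keys m"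
  by (simp add: multidegree_push keys_add_nat keys_push_mono)

text \<open>The bound on the rows can be read off the u-part of the multidegree. This is why
  \<open>gens\<close> and \<open>hdim\<close> carry no number of rows.\<close>

lemma keys_box_iff:
  "keys m \<subseteq> {..<M} \<times> {..<n} \<longleftrightarrow>
    snd ` keys m \<subseteq> {..<n} \<and> keys (multidegree d m) \<subseteq> ut_vars M"
  by (auto simp: keys_multidegree)

lemma finite_bounded_monomials:
  assumes "finite A"
  shows "finite {m :: 'x \<Rightarrow>\<^sub>0 nat. keys m \<subseteq> A \<and> (\<forall>x. lookup m x \<le> N)}" (is "finite ?M")
proof (rule finite_imageD)
  have "(\<lambda>m. restrict (lookup m) A) ` ?M \<subseteq> A \<rightarrow>\<^sub>E {..N}" by auto
  then show "finite ((\<lambda>m. restrict (lookup m) A) ` ?M)"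
    by (rule finite_subset) (use assms in \<open>auto intro: finite_PiE\<close>)
  show "inj_on (\<lambda>m. restrict (lookup m) A) ?M"
  proof (rule inj_onI, rule poly_mapping_eqI)
    fix m m' x assume m: "m \<in> ?M" "m' \<in> ?M" "restrict (lookup m) A = restrict (lookup m') A"
    show "lookup m x = lookup m' x"
    proof (cases "x \<in> A")
      case True
      then show ?thesis using fun_cong[OF m(3), of x] by simp
    next
      case False
      then have "x \<notin> keys m" "x \<notin> keys m'" using m(1,2) by auto
      then show ?thesis by (simp add: in_keys_iff)
    qed
  qed
qed

lemma finite_multidegree: "finite {m. \<exists>a. multidegree d m + a = e}"
proof (rule finite_subset)
  let ?A = "{i. U i \<in> keys e} \<times> {c. T (d + c) \<in> keys e}" and ?N = "\<Sum>x\<in>keys e. lookup e x"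
  have "finite (U -` keys e)" "finite ((\<lambda>c. T (d + c)) -` keys e)"
    by (auto intro!: finite_vimageI simp: inj_def)
  then show "finite {m :: nat \<times> nat \<Rightarrow>\<^sub>0 nat. keys m \<subseteq> ?A \<and> (\<forall>x. lookup m x \<le> ?N)}"
    by (intro finite_bounded_monomials) (simp add: vimage_def)
  show "{m. \<exists>a. multidegree d m + a = e} \<subseteq> {m. keys m \<subseteq> ?A \<and> (\<forall>x. lookup m x \<le> ?N)}"
  proof
    fix m assume "m \<in> {m. \<exists>a. multidegree d m + a = e}"
    then obtain a where e: "e = multidegree d m + a" by auto
    have "keys m \<subseteq> ?A" by (auto simp: e keys_add_nat keys_multidegree image_iff) force+
    moreover have "lookup m x \<le> ?N" for x
    proof -
      have "lookup m x \<le> lookup (multidegree d m) (U (fst x))"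
        by (simp add: lookup_multidegree_U lookup_le_push_mono)
      also have "\<dots> \<le> lookup e (U (fst x))" by (simp add: e lookup_add)
      also have "\<dots> \<le> ?N" by (cases "U (fst x) \<in> keys e") (auto simp: in_keys_iff intro: member_le_sum)
      finally show ?thesis .
    qed
    ultimately show "m \<in> {m. keys m \<subseteq> ?A \<and> (\<forall>x. lookup m x \<le> ?N)}" by simp
  qed
qed

lemma linear_image_span_subset:
  fixes F :: "('a \<Rightarrow> 'k::field) \<Rightarrow> 'b \<Rightarrow> 'k"
  assumes "fun_linear F"
    and "\<And>x. x \<in> S \<Longrightarrow> F x \<in> fv.span S'" and "f \<in> fv.span S"
  shows "F f \<in> fv.span S'"
proof -
  interpret F: Vector_Spaces.linear "\<lambda>c f x. c * f x" "\<lambda>c f x. c * f x" F by fact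
  show ?thesis using assms(3)
  proof (induction rule: fv.span_induct_alt)
    case base
    show ?case unfolding F.zero by (rule fv.span_zero)
  next
    case (step c x y)
    then show ?case
      unfolding F.add F.scale by (intro fv.span_add fv.span_scale) (auto intro: assms(2))
  qed
qed

section \<open>Exactness of the Koszul complex\<close>

context row_forms
begin

lemma gensI:
  "length cs = j \<Longrightarrow> set cs \<subseteq> {..<n} \<Longrightarrow> snd ` keys m \<subseteq> {..<n} \<Longrightarrow>
    multidegree d m + column_degree d cs = e \<Longrightarrow> gen m cs \<in> gens j e"
  unfolding gens_def by blast

lemma gensE:
  assumes "f \<in> gens j e"
  obtains m cs where "f = gen m cs" "length cs = j" "set cs \<subseteq> {..<n}" "snd ` keys m \<subseteq> {..<n}"
    "multidegree d m + column_degree d cs = e"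
  using assms unfolding gens_def by (smt (verit) mem_Collect_eq)

lemma finite_gens: "finite (gens j e)"
proof -
  have "gens j e \<subseteq> (\<lambda>(m, cs). gen m cs) ` ({m. \<exists>a. multidegree d m + a = e} \<times> {cs. set cs \<subseteq> {..<n} \<and> length cs = j})"
    by (auto simp: gens_def)
  then show ?thesis
    by (rule finite_subset) (intro finite_imageI finite_cartesian_product finite_multidegree finite_lists_length_eq finite_lessThan)
qed

lemma lookup_column_degree_U: "lookup (column_degree d cs) (U i) = 0"
  by (induction cs) (auto simp: column_degree_def lookup_add lookup_single)

lemma row_degree: "multidegree d m + column_degree d cs = e \<Longrightarrow> lookup (push_mono fst m) i = lookup e (U i)"
  by (auto simp: lookup_add lookup_multidegree_U lookup_column_degree_U)

text \<open>Column q leaves the minor and reappears in a factor of row i, so the t-degree is kept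
  and only the exponent of \<open>U i\<close> grows.\<close>

lemma plug_in_span:
  assumes "f \<in> fv.span (gens (Suc j) e)"
  shows "plug_in i f \<in> fv.span (gens j (e + single (U i) 1))"
  using linear_plug_in _ assms
proof (rule linear_image_span_subset)
  fix f assume "f \<in> gens (Suc j) e"
  then obtain m cs where f: "f = gen m cs" and cs: "length cs = Suc j" "set cs \<subseteq> {..<n}"
    "snd ` keys m \<subseteq> {..<n}" "multidegree d m + column_degree d cs = e" by (auto simp: gens_def)
  have "plug_in i f = (\<Sum>q<length cs. (\<lambda>x. (-1) ^ q * gen (m + single (i, cs ! q) 1) (remove_nth q cs) x))"
    unfolding f by (rule plug_in_gen) (use cs in auto)
  also have "\<dots> \<in> fv.span (gens j (e + single (U i) 1))"
  proof (intro fv.span_sum fv.span_scale fv.span_base)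
    fix q assume q: "q \<in> {..<length cs}"
    have "multidegree d (m + single (i, cs ! q) 1) + column_degree d (remove_nth q cs) = e + single (U i) 1"
      using q column_degree_remove_nth[of q cs d] by (simp add: multidegree_add multidegree_single add_ac flip: cs(4))
    moreover have "snd ` keys (m + single (i, cs ! q) 1) \<subseteq> {..<n}"
    proof -
      have "cs ! q \<in> set cs" using q by simp
      then have "cs ! q < n" using cs(2) by blast
      then show ?thesis using cs(3) by (auto simp: keys_add_nat)
    qed
    moreover have "set (remove_nth q cs) \<subseteq> {..<n}" using set_remove_nth[of q cs] cs(2) by (rule order_trans)
    ultimately show "gen (m + single (i, cs ! q) 1) (remove_nth q cs) \<in> gens j (e + single (U i) 1)"
      using q cs(1) by (intro gensI) (simp_all add: length_remove_nth)
  qed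
  finally show "plug_in i f \<in> fv.span (gens j (e + single (U i) 1))" .
qed

lemma polarize_span:
  assumes "lookup e (U i) < N" "f \<in> fv.span (gens j (e + single (U i) 1))"
  shows "polarize i N j f \<in> fv.span (gens (Suc j) e)"
  using linear_polarize _ assms(2)
proof (rule linear_image_span_subset)
  fix f assume "f \<in> gens j (e + single (U i) 1)"
  then obtain m cs where f: "f = gen m cs" and cs: "length cs = j" "set cs \<subseteq> {..<n}"
    "snd ` keys m \<subseteq> {..<n}" "multidegree d m + column_degree d cs = e + single (U i) 1" by (auto simp: gens_def)
  obtain ts where ts: "polarization i m ts" using polarization_exists by blast
  have "length ts \<le> N"
    using ts assms(1) row_degree[OF cs(4), of i] by (simp add: polarization_def lookup_add)
  then have "polarize i N j f = (\<Sum>(m', c)\<leftarrow>ts. gen m' (c # cs))"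
    using polarize_gen[OF ts, of N cs] f cs(1) by simp
  also have "\<dots> \<in> fv.span (gens (Suc j) e)"
  proof -
    have "gen m' (c # cs) \<in> gens (Suc j) e" if "(m', c) \<in> set ts" for m' c
    proof -
      have m: "m = m' + single (i, c) 1" using ts that by (auto simp: polarization_def)
      have "multidegree d m' + column_degree d (c # cs) + single (U i) 1 = e + single (U i) 1"
        using cs(4) by (simp add: m multidegree_add multidegree_single column_degree_Cons add_ac)
      then have "multidegree d m' + column_degree d (c # cs) = e" by simp
      then show ?thesis using cs by (intro gensI) (auto simp: m keys_add_nat)
    qed
    then show ?thesis by (induction ts) (auto intro!: fv.span_add intro: fv.span_base fv.span_zero)
  qed
  finally show "polarize i N j f \<in> fv.span (gens (Suc j) e)" .
qed

lemma polarize_span_0: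
  assumes "lookup e (U i) = 0" "f \<in> fv.span (gens j e)"
  shows "polarize i N j f = 0"
proof -
  have "polarize i N j f \<in> fv.span {}"
    using linear_polarize _ assms(2)
  proof (rule linear_image_span_subset)
    fix f assume "f \<in> gens j e"
    then obtain m cs where f: "f = gen m cs" and cs: "length cs = j"
      "multidegree d m + column_degree d cs = e" by (auto simp: gens_def)
    obtain ts where ts: "polarization i m ts" using polarization_exists by blast
    have "ts = []"
      using ts assms(1) row_degree[OF cs(2), of i] by (simp add: polarization_def)
    then show "polarize i N j f \<in> fv.span {}"
      using polarize_gen[OF ts, of N cs] f cs(1) by simp
  qed
  then show ?thesis by simp
qed

lemma plug_in_twice:
  assumes "f \<in> fv.span (gens (Suc (Suc j)) e)"
  shows "plug_in i (plug_in i f) = 0"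
proof -
  interpret p: Vector_Spaces.linear "\<lambda>c f x. c * f x" "\<lambda>c f x. c * f x" "plug_in i :: ('k point \<Rightarrow> 'k) \<Rightarrow> _"
    by (rule linear_plug_in)
  show ?thesis using assms
  proof (induction rule: fv.span_induct_alt)
    case base
    show ?case unfolding p.zero ..
  next
    case (step c f f')
    from step(1) obtain m cs where f: "f = gen m cs" and cs: "length cs = Suc (Suc j)" by (auto simp: gens_def)
    have "odet cs (case_nat z (case_nat z y)) = 0" for z y
      unfolding odet_def by (rule det_identical_rows[of _ "length cs" 0 1]) (auto simp: cs intro!: eq_vecI)
    then have "plug_in i (plug_in i f) = 0" by (auto simp: f plug_in_def gen_def fun_eq_iff)
    then show ?case using step(2) by (simp only: p.add p.scale) (simp add: fun_eq_iff)
  qed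
qed

lemma homotopy:
  assumes "f \<in> fv.span (gens j e)" "lookup e (U i) + (if j = 0 then 0 else 1) \<le> N"
  shows "plug_in i (polarize i N j f) + (if j = 0 then 0 else polarize i N (j - 1) (plug_in i f)) =
    (\<lambda>x. of_nat (lookup e (U i) + j) * f x)" (is "?H f = ?R f")
proof -
  interpret p: Vector_Spaces.linear "\<lambda>c f x. c * f x" "\<lambda>c f x. c * f x" "plug_in i :: ('k point \<Rightarrow> 'k) \<Rightarrow> _"
    by (rule linear_plug_in)
  interpret q: Vector_Spaces.linear "\<lambda>c f x. c * f x" "\<lambda>c f x. c * f x" "polarize i N l :: ('k point \<Rightarrow> 'k) \<Rightarrow> _" for l
    by (rule linear_polarize)
  show ?thesis using assms(1)
  proof (induction rule: fv.span_induct_alt)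
    case base
    show ?case unfolding p.zero q.zero by (auto simp: fun_eq_iff)
  next
    case (step c h h')
    from step(1) obtain m cs where h: "h = gen m cs" and cs: "length cs = j" "set cs \<subseteq> {..<n}"
      "snd ` keys m \<subseteq> {..<n}" "multidegree d m + column_degree d cs = e" by (rule gensE)
    have *: "?H h = ?R h"
    proof
      fix x :: "'k point"
      obtain g y where x: "x = (g, y)" by (cases x)
      show "?H h x = ?R h x"
        using homotopy_gen[of m i cs N g y] row_degree[OF cs(4), of i] assms(2) cs(1)
        by (cases "j = 0") (auto simp: h x)
    qed
    have "?H ((\<lambda>x. c * h x) + h') = (\<lambda>x. c * ?H h x) + ?H h'"
      unfolding p.add p.scale q.add q.scale by (cases "j = 0") (simp_all add: fun_eq_iff algebra_simps)
    also have "\<dots> = ?R ((\<lambda>x. c * h x) + h')"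
      unfolding * step(2) by (simp add: fun_eq_iff algebra_simps)
    finally show ?case .
  qed
qed

text \<open>Polarisation is a contracting homotopy, up to the degree \<open>p\<close>, hence the complex is exact.\<close>

lemma koszul_euler_characteristic:
  assumes e: "lookup e (U i) = 0" and "p > 0"
  shows "(\<Sum>j\<le>p. (-1) ^ j * int (hdim j (e + single (U i) (p - j)))) = 0"
proof -
  \<comment> \<open>Even degree in row i plus number of odd rows is p throughout, so the homotopy is
    multiplication by p, which is invertible in characteristic zero.\<close>
  let ?e = "\<lambda>j. e + single (U i) (p - j)"
  let ?X = "\<lambda>j. fv.span (gens j (?e j))"
  interpret pl: Vector_Spaces.linear "\<lambda>c f x. c * f x" "\<lambda>c f x. c * f x" "plug_in i :: ('k point \<Rightarrow> 'k) \<Rightarrow> _"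
    by (rule linear_plug_in)
  interpret po: Vector_Spaces.linear "\<lambda>c f x. c * f x" "\<lambda>c f x. c * f x" "polarize i p l :: ('k point \<Rightarrow> 'k) \<Rightarrow> _" for l
    by (rule linear_polarize)
  have deg: "lookup (?e j) (U i) = p - j" for j by (simp add: lookup_add e)
  have step: "?e j = ?e (Suc j) + single (U i) 1" if "j < p" for j
    using that by (simp add: add.assoc Suc_diff_Suc flip: single_add)
  have plug: "plug_in i f \<in> ?X j" if "f \<in> ?X (Suc j)" "j < p" for f j
    using plug_in_span[OF that(1), of i] by (simp only: step[OF that(2)])
  have pol: "polarize i p j f \<in> ?X (Suc j)" if "f \<in> ?X j" "j < p" for f j
    using that deg[of "Suc j"] unfolding step[OF that(2)] by (intro polarize_span) auto
  have split: "f \<in> plug_in i ` ?X (Suc j)"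
    if f: "f \<in> ?X j" "j < p" "j = 0 \<or> plug_in i f = 0" for f j
  proof -
    have "plug_in i (polarize i p j f) = (\<lambda>x. of_nat p * f x)"
      using homotopy[OF f(1), of i p] f(2,3) deg[of j] by (cases "j = 0") (simp_all add: po.zero)
    then have "f = plug_in i (\<lambda>x. inverse (of_nat p) * polarize i p j f x)"
      using \<open>p > 0\<close> by (simp add: pl.scale fun_eq_iff)
    moreover have "(\<lambda>x. inverse (of_nat p) * polarize i p j f x) \<in> ?X (Suc j)"
      by (rule fv.span_scale) (rule pol[OF f(1,2)])
    ultimately show ?thesis by blast
  qed
  have "(\<Sum>j\<le>p. (-1) ^ j * int (fv.dim (?X j))) = 0"
  proof (rule fv.exact_euler_characteristic[OF linear_plug_in[of i]])
    show "fv.subspace (?X j)" "?X j \<subseteq> fv.span (gens j (?e j))" "finite (gens j (?e j))" for j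
      by (auto simp: fv.subspace_span finite_gens)
    show "plug_in i ` ?X 1 = ?X 0"
      using plug[of _ 0] split[of _ 0] \<open>p > 0\<close> by auto
    show "{f \<in> ?X j. plug_in i f = 0} = plug_in i ` ?X (Suc j)" if "0 < j" "j < p" for j
    proof -
      obtain j' where "j = Suc j'" using \<open>0 < j\<close> by (cases j) auto
      then show ?thesis using plug[of _ j] split[of _ j] plug_in_twice that by auto
    qed
    \<comment> \<open>At the last place no factor in row i is left, so polarisation gives 0 and the
      homotopy formula reduces to p f = 0.\<close>
    show "f = 0" if f: "f \<in> ?X p" "plug_in i f = 0" for f
    proof -
      have "lookup (?e p) (U i) = 0" using deg[of p] by simp
      from polarize_span_0[OF this f(1)] have "polarize i p p f = 0" .
      then have "(\<lambda>x. of_nat p * f x) = 0"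
        using homotopy[OF f(1), of i p] f(2) deg[of p] \<open>p > 0\<close> by (simp add: po.zero pl.zero) (simp add: zero_fun_def)
      then show ?thesis using \<open>p > 0\<close> by (auto simp: fun_eq_iff)
    qed
  qed fact
  then show ?thesis by (simp add: hdim_def)
qed

lemma hdim_rank:
  assumes "r < j"
  shows "hdim j e = 0"
proof -
  have "gens j e \<subseteq> {0}"
    using L_rank[OF assms] by (auto simp: gens_def gen_def odet_def fun_eq_iff)
  then have "fv.span (gens j e) = {0}"
    using fv.span_mono[of "gens j e" "{0}"] fv.span_zero fv.span_insert_0[of "{}"] by auto
  then show ?thesis
    unfolding hdim_def by (metis fv.dim_span fv.dim_zero_space)
qed

text \<open>Reindexing the even rows along \<open>\<rho>\<close> is a linear map on functions that
  carries the generators of one degree onto those of the relabelled degree. It is the source of the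
  symmetry of Hilbert series in u.\<close>

lemma hdim_relabel:
  assumes "inj \<rho>"
  shows "hdim 0 (push_mono (permute_u \<rho>) e) = hdim 0 e"
proof -
  let ?f = "\<lambda>x. (\<rho> (fst x), snd x)"
  define R :: "('k point \<Rightarrow> 'k) \<Rightarrow> ('k point \<Rightarrow> 'k)" where "R f = (\<lambda>(g, y). f (\<lambda>i. g (\<rho> i), y))" for f
  have lin: "fun_linear R"
    by (rule linear_funI) (auto simp: R_def fun_eq_iff)
  interpret R: Vector_Spaces.linear "\<lambda>c f x. c * f x" "\<lambda>c f x. c * f x" R by (rule lin)
  have gens0: "gens 0 e = {gen m [] | m. snd ` keys m \<subseteq> {..<n} \<and> multidegree d m = e}" for e
    by (auto simp: gens_def column_degree_def)
  have inj_f: "inj ?f" using assms by (auto simp: inj_def)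
  have md: "multidegree d (push_mono ?f m) = push_mono (permute_u \<rho>) (multidegree d m)" for m
    by (simp add: multidegree_push push_mono_add push_mono_push_mono)
  have R_gen: "R (gen m []) = gen (push_mono ?f m) []" for m
    by (auto simp: R_def gen_def form_mono_def mev_push_mono)
  have "gens 0 (push_mono (permute_u \<rho>) e) = R ` gens 0 e"
  proof (intro equalityI subsetI)
    fix h assume "h \<in> gens 0 (push_mono (permute_u \<rho>) e)"
    then obtain m where m: "h = gen m []" "snd ` keys m \<subseteq> {..<n}" "multidegree d m = push_mono (permute_u \<rho>) e"
      by (auto simp: gens0)
    have "keys m \<subseteq> range ?f"
    proof
      fix x assume "x \<in> keys m"
      then have "U (fst x) \<in> permute_u \<rho> ` keys e"
        using keys_multidegree[of d m] by (auto simp: m(3) keys_push_mono)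
      then obtain z where "U (fst x) = permute_u \<rho> z" by auto
      then obtain i where "fst x = \<rho> i" by (cases z) auto
      then show "x \<in> range ?f" by (intro image_eqI[of _ _ "(i, snd x)"]) (auto simp: prod_eq_iff)
    qed
    then have m': "push_mono ?f (Poly_Mapping.map_key ?f m) = m" (is "push_mono ?f ?m = m")
      by (rule push_mono_map_key[OF inj_f])
    have "push_mono (permute_u \<rho>) (multidegree d ?m) = push_mono (permute_u \<rho>) e"
      using m(3) md[of ?m] by (simp add: m')
    from arg_cong[OF this, of "Poly_Mapping.map_key (permute_u \<rho>)"] have "multidegree d ?m = e"
      by (simp add: map_key_push_mono[OF inj_permute_u[OF assms]])
    moreover have "snd ` keys ?m \<subseteq> {..<n}"
      using m(2) by (subst (asm) m'[symmetric]) (simp add: keys_push_mono image_image)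
    ultimately have "gen ?m [] \<in> gens 0 e" by (auto simp: gens0)
    moreover have "h = R (gen ?m [])" by (simp add: R_gen m' m(1))
    ultimately show "h \<in> R ` gens 0 e" by blast
  next
    fix h assume "h \<in> R ` gens 0 e"
    then obtain m where m: "h = R (gen m [])" "snd ` keys m \<subseteq> {..<n}" "multidegree d m = e"
      by (auto simp: gens0)
    have "snd ` keys (push_mono ?f m) \<subseteq> {..<n}" using m(2) by (simp add: keys_push_mono image_image)
    moreover have "multidegree d (push_mono ?f m) = push_mono (permute_u \<rho>) e" by (simp add: md m(3))
    ultimately show "h \<in> gens 0 (push_mono (permute_u \<rho>) e)" unfolding m(1) R_gen gens0 by blast
  qed
  then have "hdim 0 (push_mono (permute_u \<rho>) e) = fv.dim (R ` fv.span (gens 0 e))"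
    by (simp add: hdim_def flip: R.span_image)
  also have "\<dots> = fv.dim (fv.span (gens 0 e))"
  proof (rule fv.dim_image_inj[OF lin])
    show "f = 0" if "R f = 0" for f
    proof
      fix x :: "'k point"
      obtain g y where x: "x = (g, y)" by (cases x)
      \<comment> \<open>Reindexing this sequence of rows along \<open>\<rho>\<close> gives back g,
        so a function killed by \<open>R\<close> vanishes at every point.\<close>
      have "R f (\<lambda>i. g (inv_into UNIV \<rho> i), y) = 0" using that by simp
      then show "f x = 0 x" by (simp add: R_def x inv_f_f[OF assms])
    qed
  qed (auto simp: fv.subspace_span finite_gens)
  finally show ?thesis by (simp add: hdim_def)
qed

end

section \<open>Truncated Hilbert series\<close>

text \<open>The fibre of \<open>True\<close> consists of the t variables. Each matrix entry
  contributes exactly one of them, so for a bounded number of rows every t-degree contains only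
  finitely many monomials.\<close>

definition tdeg :: "(kvar \<Rightarrow>\<^sub>0 nat) \<Rightarrow> nat" where
  "tdeg e = lookup (push_mono (\<lambda>x. x \<in> range T) e) True"

lemma tdeg_add: "tdeg (a + b) = tdeg a + tdeg b"
  by (simp add: tdeg_def push_mono_add lookup_add)

lemma tdeg_single [simp]: "tdeg (single (U i) k) = 0" "tdeg (single (T j) k) = k"
  by (auto simp: tdeg_def lookup_single when_def)

lemma tdeg_permute_u: "tdeg (push_mono (permute_u f) e) = tdeg e"
proof -
  have "permute_u f x \<in> range T \<longleftrightarrow> x \<in> range T" for x by (cases x) auto
  then show ?thesis by (simp add: tdeg_def push_mono_push_mono)
qed

definition high :: "nat \<Rightarrow> (kvar, int) mpoly \<Rightarrow> bool" where
  "high D p \<longleftrightarrow> (\<forall>e\<in>keys p. D < tdeg e)"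

lemma high_0 [simp]: "high D 0"
  by (simp add: high_def)

lemma high_add: "high D p \<Longrightarrow> high D q \<Longrightarrow> high D (p + q)"
  using keys_add[of p q] by (auto simp: high_def)

lemma high_uminus [simp]: "high D (- p) \<longleftrightarrow> high D p"
  by (simp add: high_def)

lemma high_diff: "high D p \<Longrightarrow> high D q \<Longrightarrow> high D (p - q)"
  using high_add[of D p "- q"] by simp

lemma high_mult: "high D p \<Longrightarrow> high D (p * q)"
  using keys_mult[of p q] by (fastforce simp: high_def tdeg_add)

lemma high_sum: "(\<And>i. i \<in> I \<Longrightarrow> high D (f i)) \<Longrightarrow> high D (sum f I)"
  by (induction I rule: infinite_finite_induct) (auto intro: high_add)

lemma msub_permute_u_expand:
  "rename_u f p = (\<Sum>e\<in>keys p. single (push_mono (permute_u f) e) (lookup p e))"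
proof -
  have "of_int c * single m (1::int) = single m c" for c and m :: "kvar \<Rightarrow>\<^sub>0 nat"
    by (rule poly_mapping_eqI) (simp add: lookup_of_int_mult lookup_single when_def)
  then show ?thesis
    by (simp add: msub_def mev_Var flip: mev_push_mono)
qed

lemma high_rename_u: "high D p \<Longrightarrow> high D (rename_u f p)"
  unfolding msub_permute_u_expand
  by (rule high_sum) (auto simp: high_def tdeg_permute_u split: if_splits)

lemma keys_polys_in_U: "p \<in> polys_in (range U) \<Longrightarrow> e \<in> keys p \<Longrightarrow> tdeg e = 0"
proof -
  assume "p \<in> polys_in (range U)" "e \<in> keys p"
  then have "keys e \<subseteq> range U" by (auto simp: polys_in_def)
  then have "True \<notin> keys (push_mono (\<lambda>x. x \<in> range T) e)" by (auto simp: keys_push_mono)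
  then show ?thesis by (simp add: tdeg_def in_keys_iff)
qed

text \<open>The part of \<open>s\<close> of t-degree at most \<open>D\<close> keeps its t-degrees
  when multiplied by \<open>v\<close>, which is free of t. Its product with \<open>v\<close> is thus
  both low and high, hence zero.\<close>

lemma high_cancel:
  assumes "high D (s * v)" "v \<in> polys_in (range U)" "v \<noteq> 0"
  shows "high D s"
proof -
  define lo where "lo = (\<Sum>e\<in>{e \<in> keys s. tdeg e \<le> D}. single e (lookup s e))"
  define hi where "hi = (\<Sum>e\<in>{e \<in> keys s. D < tdeg e}. single e (lookup s e))"
  have "s = (\<Sum>e\<in>keys s. single e (lookup s e))" by (rule poly_mapping_sum_singles) auto
  also have "keys s = {e \<in> keys s. tdeg e \<le> D} \<union> {e \<in> keys s. D < tdeg e}" by auto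
  also have "(\<Sum>e\<in>\<dots>. single e (lookup s e)) = lo + hi"
    unfolding lo_def hi_def by (rule sum.union_disjoint) auto
  finally have s: "s = lo + hi" .
  have hi: "high D hi" unfolding hi_def by (rule high_sum) (auto simp: high_def)
  have lo: "tdeg e \<le> D" if "e \<in> keys lo" for e
    using that subsetD[OF keys_sum, of e] unfolding lo_def by (fastforce split: if_splits)
  have "high D (lo * v)"
    using high_diff[OF assms(1) high_mult[OF hi, of v]] by (simp add: s distrib_right)
  moreover have "tdeg e \<le> D" if "e \<in> keys (lo * v)" for e
    using that keys_mult[of lo v] lo keys_polys_in_U[OF assms(2)] by (fastforce simp: tdeg_add)
  ultimately have "keys (lo * v) = {}" by (fastforce simp: high_def)
  then have "lo = 0" using assms(3) by simp
  then show ?thesis using hi s by simp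
qed

definition tlow :: "nat \<Rightarrow> (kvar, int) mpoly \<Rightarrow> (kvar, int) mpoly \<Rightarrow> bool" where
  "tlow D p q \<longleftrightarrow> (\<forall>e. tdeg e \<le> D \<longrightarrow> lookup p e = lookup q e)"

lemma tlow_iff_high: "tlow D p q \<longleftrightarrow> high D (p - q)"
  by (auto simp: tlow_def high_def in_keys_iff lookup_minus not_le[symmetric])

lemma tlow_mult: "tlow D p q \<Longrightarrow> tlow D p' q' \<Longrightarrow> tlow D (p * p') (q * q')"
proof -
  assume "tlow D p q" "tlow D p' q'"
  then have "high D ((p - q) * p' + (p' - q') * q)"
    unfolding tlow_iff_high by (intro high_add high_mult)
  then show ?thesis unfolding tlow_iff_high by (simp add: algebra_simps)
qed

lemma vdm_polys_in_U: "vdm m \<in> polys_in (range U)"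
  unfolding vdm_def by (intro polys_in_prod polys_in_minus polys_in_Var) auto

lemma bordered_minus: "bordered m g (p - q) = bordered m g p - bordered m g q"
  by (simp add: bordered_def msub.hom_minus algebra_simps sum_subtractf del: sum.lessThan_Suc)

text \<open>Bordering is linear and does not lower t-degrees, and the Vandermonde factor, containing
  only u, can be removed by \<open>high_cancel\<close>.\<close>

lemma tlow_rho:
  assumes "p \<in> sym_polys m" "q \<in> sym_polys m" "finite J" "tlow D p q"
  shows "tlow D (rho J m p) (rho J m q)"
proof -
  have "high D (bordered m g (p - q))" for g
    using assms(4) unfolding tlow_iff_high bordered_def
    by (intro high_sum) (simp add: mult.commute[of "g _"] mult.assoc high_mult high_rename_u)
  then have "high D ((rho J m p - rho J m q) * vdm (Suc m))"
    using rho(2)[OF assms(1,3)] rho(2)[OF assms(2,3)] by (simp add: left_diff_distrib bordered_minus)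
  then show ?thesis
    unfolding tlow_iff_high by (rule high_cancel) (simp_all add: vdm_polys_in_U vdm_nonzero)
qed

section \<open>The determinantal recursion for truncated series\<close>

lemma lookup_single_mult: "lookup (single a 1 * p) (a + b) = lookup p b"
  for p :: "('x, int) mpoly"
proof -
  have "single a 1 * p = (\<Sum>m\<in>insert b (keys p). single (a + m) (lookup p m))"
    by (subst poly_mapping_sum_singles[of "insert b (keys p)" p], simp, blast)
       (simp only: sum_distrib_left mult_single mult_1)
  then have "lookup (single a 1 * p) (a + b) = (\<Sum>m\<in>insert b (keys p). if m = b then lookup p m else 0)"
    by (simp only: lookup_sum lookup_single when_def add_left_cancel)
  then show ?thesis by (simp add: sum.delta)
qed

lemma lookup_Var_power_mult:
  fixes p :: "('x, int) mpoly"
  shows "lookup (Var x ^ k * p) e = (if k \<le> lookup e x then lookup p (e - single x k) else 0)"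
proof -
  have V: "Var x ^ k = (single (single x k) 1 :: ('x, int) mpoly)"
    using mev_Var[of "single x k"] by simp
  show ?thesis
  proof (cases "k \<le> lookup e x")
    case True
    then have "single x k + (e - single x k) = e"
      by (intro poly_mapping_eqI) (auto simp: lookup_add lookup_minus lookup_single when_def)
    then show ?thesis using lookup_single_mult[of "single x k" p "e - single x k"] True by (simp add: V)
  next
    case False
    have "e \<notin> keys (Var x ^ k * p)"
    proof
      assume "e \<in> keys (Var x ^ k * p)"
      then obtain b where "e = single x k + b" using keys_mult[of "Var x ^ k" p] by (auto simp: V)
      then show False using False by (simp add: lookup_add)
    qed
    then show ?thesis using False by (simp add: in_keys_iff)
  qed
qed

definition linear_factors :: "nat \<Rightarrow> nat set \<Rightarrow> (kvar, int) mpoly" where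
  "linear_factors m J = (\<Prod>i<m. \<Prod>j\<in>J. 1 - Var (U i) * Var (T j))"

lemma linear_factors_shift:
  "(\<Prod>i<m. \<Prod>j<n. 1 - Var (U i) * Var (T (d + j))) = linear_factors m {d..<d + n}"
proof -
  have "(\<Prod>j<n. 1 - Var (U i) * Var (T (d + j))) =
      (\<Prod>j\<in>{d..<d + n}. 1 - Var (U i) * Var (T j) :: (kvar, int) mpoly)" for i
    by (rule prod.reindex_bij_witness[of _ "\<lambda>j. j - d" "\<lambda>j. d + j"]) auto
  then show ?thesis by (simp add: linear_factors_def)
qed

lemma linear_factors_insert:
  assumes "i \<le> m"
  shows "(\<Prod>j\<in>J. 1 - Var (U i) * Var (T j)) * omit_u i (linear_factors m J) = linear_factors (Suc m) J"
proof -
  have "omit_u i (linear_factors m J) = (\<Prod>l<m. \<Prod>j\<in>J. 1 - Var (U (insert_index i l)) * Var (T j))"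
    by (simp add: linear_factors_def msub.hom_prod msub.hom_minus msub_mult)
  also have "\<dots> = (\<Prod>l\<in>insert_index i ` {..<m}. \<Prod>j\<in>J. 1 - Var (U l) * Var (T j))"
    using inj_on_subset[OF insert_index_inj[of i]] by (subst prod.reindex) auto
  also have "(\<Prod>j\<in>J. 1 - Var (U i) * Var (T j)) * \<dots> = linear_factors (Suc m) J"
    unfolding insert_index_image_lessThan[OF assms] linear_factors_def
    by (rule prod.remove[symmetric]) (use assms in auto)
  finally show ?thesis .
qed

lemma linear_factors_sym: "linear_factors m J \<in> sym_polys m"
  unfolding sym_polys_iff
proof (intro conjI allI impI)
  show "linear_factors m J \<in> polys_in (ut_vars m)"
    unfolding linear_factors_def by (intro polys_in_prod polys_in_minus polys_in_mult polys_in_Var polys_in_1) auto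
  show "rename_u \<pi> (linear_factors m J) = linear_factors m J" if "\<pi> permutes {..<m}" for \<pi>
  proof -
    have "rename_u \<pi> (linear_factors m J) = (\<Prod>i<m. \<Prod>j\<in>J. 1 - Var (U (\<pi> i)) * Var (T j))"
      by (simp add: linear_factors_def msub.hom_prod msub.hom_minus msub_mult)
    also have "\<dots> = linear_factors m J"
      unfolding linear_factors_def by (rule prod.permute[OF that, unfolded o_def, symmetric])
    finally show ?thesis .
  qed
qed

context row_forms
begin

text \<open>The Hilbert series for m even and j odd rows, cut off at t-degree \<open>D\<close>. The
  support is finite by \<open>lookup_hpoly\<close>, so that it lives in the same ring as the
  K-polynomials.\<close>

definition hpoly :: "nat \<Rightarrow> nat \<Rightarrow> nat \<Rightarrow> (kvar, int) mpoly" where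
  "hpoly j m D = Abs_poly_mapping (\<lambda>e. if keys e \<subseteq> ut_vars m \<and> tdeg e \<le> D then int (hdim j e) else 0)"

lemma tdeg_multidegree: "tdeg (multidegree d m) = lookup (push_mono (\<lambda>_. True) m) True"
proof -
  have "U i \<notin> range T" for i by auto
  then have "push_mono (\<lambda>x. x \<in> range T) (multidegree d m) = push_mono (\<lambda>_. False) m + push_mono (\<lambda>_. True) m"
    by (simp add: multidegree_push push_mono_add push_mono_push_mono image_iff)
  moreover have "lookup (push_mono (\<lambda>_. False) m) True = 0"
    using keys_push_mono[of "\<lambda>_. False" m] by (auto simp: in_keys_iff[symmetric] not_in_keys_iff_lookup_eq_zero[symmetric])
  ultimately show ?thesis by (simp add: tdeg_def lookup_add)
qed

lemma lookup_hpoly: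
  "lookup (hpoly j m D) e = (if keys e \<subseteq> ut_vars m \<and> tdeg e \<le> D then int (hdim j e) else 0)"
proof -
  let ?f = "\<lambda>e. if keys e \<subseteq> ut_vars m \<and> tdeg e \<le> D then int (hdim j e) else 0"
  let ?M = "{m' :: nat \<times> nat \<Rightarrow>\<^sub>0 nat. keys m' \<subseteq> {..<m} \<times> {..<n} \<and> (\<forall>x. lookup m' x \<le> D)}"
  let ?C = "{cs. set cs \<subseteq> {..<n} \<and> length cs = j}"
  have "{e. ?f e \<noteq> 0} \<subseteq> (\<lambda>(m', cs). multidegree d m' + column_degree d cs) ` (?M \<times> ?C)"
  proof
    fix e assume "e \<in> {e. ?f e \<noteq> 0}"
    then have e: "keys e \<subseteq> ut_vars m" "tdeg e \<le> D" "hdim j e \<noteq> 0"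
      by (auto split: if_splits)
    have "gens j e \<noteq> {}"
      using e(3) by (auto simp: hdim_def fv.dim_eq_card_independent[OF fv.independent_empty])
    then obtain m' cs where m': "length cs = j" "set cs \<subseteq> {..<n}" "snd ` keys m' \<subseteq> {..<n}"
      "multidegree d m' + column_degree d cs = e" unfolding gens_def by blast
    have "keys m' \<subseteq> {..<m} \<times> {..<n}"
    proof
      fix x assume x: "x \<in> keys m'"
      then have "U (fst x) \<in> keys e" by (auto simp: keys_multidegree keys_add_nat simp flip: m'(4))
      then have "fst x < m" using e(1) by auto
      moreover have "snd x < n" using x m'(3) by auto
      ultimately show "x \<in> {..<m} \<times> {..<n}" by (cases x) auto
    qed
    moreover have "lookup m' x \<le> D" for x
    proof -
      have "lookup m' x \<le> tdeg (multidegree d m')"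
        unfolding tdeg_multidegree using lookup_le_push_mono[of m' x "\<lambda>_. True"] by simp
      also have "\<dots> \<le> tdeg e" by (simp add: tdeg_add flip: m'(4))
      finally show ?thesis using e(2) by simp
    qed
    ultimately show "e \<in> (\<lambda>(m', cs). multidegree d m' + column_degree d cs) ` (?M \<times> ?C)"
      using m' by (intro image_eqI[of _ _ "(m', cs)"]) auto
  qed
  then have "finite {e. ?f e \<noteq> 0}"
    by (rule finite_subset)
       (intro finite_imageI finite_cartesian_product finite_bounded_monomials finite_lists_length_eq finite_lessThan)
  then show ?thesis unfolding hpoly_def by (rule fun_cong[OF lookup_Abs_poly_mapping])
qed

text \<open>By \<open>hdim_relabel\<close> the coefficients are the same function of the degree as
  before; the renaming changes only the set of rows that may occur.\<close>

lemma rename_u_hpoly: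
  assumes "inj f"
  shows "lookup (rename_u f (hpoly 0 m D)) e =
    (if keys e \<subseteq> U ` f ` {..<m} \<union> range T \<and> tdeg e \<le> D then int (hdim 0 e) else 0)"
proof (cases "keys e \<subseteq> range (permute_u f)")
  case True
  note inj = inj_permute_u[OF assms]
  define e' where "e' = Poly_Mapping.map_key (permute_u f) e"
  have e: "e = push_mono (permute_u f) e'" using push_mono_map_key[OF inj True] by (simp add: e'_def)
  have mem: "x \<in> ut_vars m \<longleftrightarrow> permute_u f x \<in> U ` f ` {..<m} \<union> range T" for x
    using assms by (cases x) (auto simp: inj_eq)
  have supp: "keys e' \<subseteq> ut_vars m \<longleftrightarrow> keys e \<subseteq> U ` f ` {..<m} \<union> range T"
    unfolding e keys_push_mono image_subset_iff by (simp only: subset_iff[of "keys e'"] mem Ball_def)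
  have "tdeg e' = tdeg e" "hdim 0 e' = hdim 0 e"
    by (simp_all add: e tdeg_permute_u hdim_relabel[OF assms])
  moreover have "lookup (rename_u f (hpoly 0 m D)) e = lookup (hpoly 0 m D) e'"
    using True by (simp add: lookup_msub_rename[OF inj] e'_def)
  ultimately show ?thesis by (simp only: lookup_hpoly supp)
next
  case False
  have "U ` f ` {..<m} \<union> range T \<subseteq> range (permute_u f)"
  proof
    fix x assume "x \<in> U ` f ` {..<m} \<union> range T"
    then show "x \<in> range (permute_u f)"
      by (auto intro: range_eqI[of _ "permute_u f", OF permute_u.simps(1)[symmetric]]
          range_eqI[of _ "permute_u f", OF permute_u.simps(2)[symmetric]])
  qed
  then have "\<not> keys e \<subseteq> U ` f ` {..<m} \<union> range T" using False order_trans by metis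
  then show ?thesis using False by (simp add: lookup_msub_rename[OF inj_permute_u[OF assms]])
qed

lemma hpoly_sym: "hpoly 0 m D \<in> sym_polys m"
  unfolding sym_polys_iff
proof (intro conjI allI impI)
  show "hpoly 0 m D \<in> polys_in (ut_vars m)"
    by (auto simp: polys_in_def in_keys_iff[of _ "hpoly 0 m D"] lookup_hpoly split: if_splits)
  show "rename_u \<pi> (hpoly 0 m D) = hpoly 0 m D" if \<pi>: "\<pi> permutes {..<m}" for \<pi>
    by (rule poly_mapping_eqI) (simp add: rename_u_hpoly[OF permutes_inj[OF \<pi>]] lookup_hpoly permutes_image[OF \<pi>])
qed

text \<open>The coefficient at a degree with exponent p in \<open>U i\<close> is the Euler
  characteristic of the complex of total row degree p, the power of the variable making up for the j
  odd rows. It is 0 for p > 0. For p = 0 only j = 0 remains, and absence of \<open>U i\<close> means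
  that row i is omitted.\<close>

lemma koszul_hpoly:
  assumes "r \<le> m" "i \<le> m"
  shows "(\<Sum>j\<le>m. (- Var (U i)) ^ j * hpoly j (Suc m) D) = omit_u i (hpoly 0 m D)"
proof (rule poly_mapping_eqI)
  fix e :: "kvar \<Rightarrow>\<^sub>0 nat"
  define p where "p = lookup e (U i)"
  define e0 where "e0 = e - single (U i) p"
  let ?ok = "\<lambda>e. keys e \<subseteq> ut_vars (Suc m) \<and> tdeg e \<le> D"
  have e: "e = e0 + single (U i) p"
    by (rule poly_mapping_eqI) (auto simp: e0_def p_def lookup_add lookup_minus lookup_single when_def)
  have e0i: "lookup e0 (U i) = 0" by (simp add: e0_def p_def lookup_minus)
  have ok: "?ok (e0 + single (U i) k) \<longleftrightarrow> ?ok e0" for k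
    using \<open>i \<le> m\<close> by (auto simp: keys_add_nat tdeg_add)
  have summand: "lookup ((- Var (U i)) ^ j * hpoly j (Suc m) D) e =
      (if j \<le> p \<and> ?ok e then (-1) ^ j * int (hdim j (e0 + single (U i) (p - j))) else 0)" for j
  proof -
    have "(- Var (U i)) ^ j * hpoly j (Suc m) D = of_int ((-1) ^ j) * (Var (U i) ^ j * hpoly j (Suc m) D)"
      by (subst power_minus) (simp add: mult.assoc)
    then have "lookup ((- Var (U i)) ^ j * hpoly j (Suc m) D) e =
        (-1) ^ j * (if j \<le> p then lookup (hpoly j (Suc m) D) (e - single (U i) j) else 0)"
      by (simp only: lookup_of_int_mult lookup_Var_power_mult p_def)
    moreover have "e - single (U i) j = e0 + single (U i) (p - j)" if "j \<le> p"
      by (rule poly_mapping_eqI) (use that e0i in \<open>auto simp: e lookup_add lookup_minus lookup_single when_def\<close>)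
    ultimately show ?thesis using ok[of "p - j"] ok[of p] by (auto simp: lookup_hpoly e)
  qed
  have "lookup (\<Sum>j\<le>m. (- Var (U i)) ^ j * hpoly j (Suc m) D) e =
      (if ?ok e then \<Sum>j\<le>m. if j \<le> p then (-1) ^ j * int (hdim j (e0 + single (U i) (p - j))) else 0 else 0)"
  proof -
    have "(\<Sum>j\<in>A. if a j \<and> P then f j else 0) = (if P then \<Sum>j\<in>A. if a j then f j else 0 else 0)"
      for A and a :: "nat \<Rightarrow> bool" and P and f :: "nat \<Rightarrow> int"
      by (cases P) simp_all
    then show ?thesis unfolding lookup_sum summand .
  qed
  also have "(\<Sum>j\<le>m. if j \<le> p then (-1) ^ j * int (hdim j (e0 + single (U i) (p - j))) else 0) =
      (\<Sum>j\<in>{j \<in> {..m}. j \<le> p}. (-1) ^ j * int (hdim j (e0 + single (U i) (p - j))))"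
    by (rule sum.inter_filter[symmetric]) simp
  \<comment> \<open>If p > m, the sum is extended by the terms with m < j, which vanish since j
    exceeds the rank bound.\<close>
  also have "\<dots> = (\<Sum>j\<le>p. (-1) ^ j * int (hdim j (e0 + single (U i) (p - j))))"
  proof (rule sum.mono_neutral_left)
    show "\<forall>j\<in>{..p} - {j \<in> {..m}. j \<le> p}. (-1) ^ j * int (hdim j (e0 + single (U i) (p - j))) = 0"
    proof
      fix j assume "j \<in> {..p} - {j \<in> {..m}. j \<le> p}"
      then have "r < j" using \<open>r \<le> m\<close> by auto
      then show "(-1) ^ j * int (hdim j (e0 + single (U i) (p - j))) = 0" by (simp add: hdim_rank)
    qed
  qed auto
  also have "\<dots> = (if p = 0 then int (hdim 0 e) else 0)"
    using koszul_euler_characteristic[OF e0i, of p] by (simp add: e)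
  also have "(if ?ok e then \<dots> else 0) = lookup (omit_u i (hpoly 0 m D)) e"
  proof -
    have "keys e \<subseteq> U ` ({..<Suc m} - {i}) \<union> range T \<longleftrightarrow> keys e \<subseteq> ut_vars (Suc m) \<and> p = 0"
    proof -
      have "U ` ({..<Suc m} - {i}) \<union> range T = (ut_vars (Suc m)) - {U i}" by auto
      then show ?thesis by (simp only: subset_Diff_insert p_def in_keys_iff not_not Diff_empty)
    qed
    then show ?thesis
      by (simp add: rename_u_hpoly[OF insert_index_inj] insert_index_image_lessThan[OF \<open>i \<le> m\<close>] del: lessThan_Suc)
  qed
  finally show "lookup (\<Sum>j\<le>m. (- Var (U i)) ^ j * hpoly j (Suc m) D) e =
      lookup (omit_u i (hpoly 0 m D)) e" .
qed

text \<open>Cramer's rule for the Vandermonde system of the previous lemma.\<close>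

lemma hpoly_bordered:
  assumes "r \<le> m"
  shows "hpoly 0 (Suc m) D * vdm (Suc m) = bordered m (\<lambda>_. 1) (hpoly 0 m D)"
proof -
  let ?A = "mat (Suc m) (Suc m) (\<lambda>(i, j). Var (U i) ^ (m - j)) :: (kvar, int) mpoly mat"
  \<comment> \<open>The unknowns stand in reversed order, so the series without odd rows is the last
    one and Cramer's rule replaces the last column, the bordered one.\<close>
  let ?x = "vec (Suc m) (\<lambda>j. (-1) ^ (m - j) * hpoly (m - j) (Suc m) D)"
  have "(?A *\<^sub>v ?x) $ i = omit_u i (hpoly 0 m D)" if "i < Suc m" for i
  proof -
    have "(?A *\<^sub>v ?x) $ i = (\<Sum>j<Suc m. Var (U i) ^ (m - j) * ((-1) ^ (m - j) * hpoly (m - j) (Suc m) D))"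
      using that by (simp add: scalar_prod_def atLeast0LessThan del: sum.lessThan_Suc)
    also have "\<dots> = (\<Sum>j<Suc m. Var (U i) ^ j * ((-1) ^ j * hpoly j (Suc m) D))"
      using sum.nat_diff_reindex[of "\<lambda>j. Var (U i) ^ j * ((-1) ^ j * hpoly j (Suc m) D)" "Suc m"]
      by (simp only: diff_Suc_Suc)
    also have "\<dots> = (\<Sum>j\<le>m. (- Var (U i)) ^ j * hpoly j (Suc m) D)"
      unfolding lessThan_Suc_atMost by (intro sum.cong refl) (simp add: power_minus[of "Var (U i)"] mult_ac)
    also have "\<dots> = omit_u i (hpoly 0 m D)"
      using koszul_hpoly[OF assms] that by simp
    finally show ?thesis .
  qed
  then have "replace_col ?A (?A *\<^sub>v ?x) m =
      mat (Suc m) (Suc m) (\<lambda>(i, j). if j = m then 1 * omit_u i (hpoly 0 m D) else Var (U i) ^ (m - j))"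
    by (intro eq_matI) (auto simp: replace_col_def)
  moreover have "det (replace_col ?A (?A *\<^sub>v ?x) m) = ?x $ m * det ?A"
    by (rule cramer_lemma_mat) auto
  ultimately show ?thesis unfolding bordered_det vdm_det by simp
qed

text \<open>The factor belonging to row i, multiplied by the linear factors of the other rows, is
  the product over all rows. It does not depend on i and can be taken out of the bordered
  determinant, which leaves \<open>hpoly_bordered\<close>.\<close>

lemma rho_hpoly:
  assumes "r \<le> m" "finite J"
  shows "rho J m (hpoly 0 m D * linear_factors m J) = hpoly 0 (Suc m) D * linear_factors (Suc m) J"
proof -
  have "hpoly 0 m D * linear_factors m J \<in> sym_polys m"
    by (intro sym_polys_mult hpoly_sym linear_factors_sym)
  then have "rho J m (hpoly 0 m D * linear_factors m J) * vdm (Suc m) =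
      bordered m (\<lambda>i. \<Prod>j\<in>J. 1 - Var (U i) * Var (T j)) (hpoly 0 m D * linear_factors m J)"
    using assms(2) by (rule rho(2))
  also have "\<dots> = linear_factors (Suc m) J * bordered m (\<lambda>_. 1) (hpoly 0 m D)"
    unfolding bordered_def sum_distrib_left
  proof (intro sum.cong refl)
    fix i assume "i \<in> {..<Suc m}"
    then have "i \<le> m" by auto
    show "(\<Prod>j\<in>J. 1 - Var (U i) * Var (T j)) * omit_u i (hpoly 0 m D * linear_factors m J) * border_cofactor m i =
        linear_factors (Suc m) J * (1 * omit_u i (hpoly 0 m D) * border_cofactor m i)"
      unfolding linear_factors_insert[OF \<open>i \<le> m\<close>, of J, symmetric] by (simp add: msub_mult mult_ac)
  qed
  also have "\<dots> = hpoly 0 (Suc m) D * linear_factors (Suc m) J * vdm (Suc m)"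
    by (simp add: mult_ac flip: hpoly_bordered[OF assms(1)])
  finally show ?thesis using vdm_nonzero[of "Suc m"] by simp
qed

end

section \<open>Existence of K-polynomials\<close>

text \<open>By induction on the variables. A finite set \<open>G\<close> that works for the old
  variables also dominates all v whose new exponent is at least \<open>N\<close>, a bound for the
  new exponents in \<open>G\<close>. The finitely many smaller exponents are treated as separate
  slices.\<close>

lemma dickson:
  fixes V :: "('x \<Rightarrow>\<^sub>0 nat) set"
  assumes "finite A"
  shows "\<exists>G. finite G \<and> G \<subseteq> V \<and> (\<forall>v\<in>V. \<exists>g\<in>G. \<forall>x\<in>A. lookup g x \<le> lookup v x)"
  using assms
proof (induction A arbitrary: V rule: finite_induct)
  case empty
  show ?case
  proof (cases "V = {}")
    case False
    then obtain v where "v \<in> V" by auto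
    then show ?thesis by (intro exI[of _ "{v}"]) auto
  qed auto
next
  case (insert a A)
  obtain G where G: "finite G" "G \<subseteq> V" "\<And>v. v \<in> V \<Longrightarrow> \<exists>g\<in>G. \<forall>x\<in>A. lookup g x \<le> lookup v x"
    using insert.IH[of V] by blast
  define N where "N = (\<Sum>g\<in>G. lookup g a)"
  have N: "lookup g a \<le> N" if "g \<in> G" for g
    unfolding N_def using that G(1) by (intro member_le_sum) auto
  have "\<exists>H. finite H \<and> H \<subseteq> {v \<in> V. lookup v a = c} \<and>
      (\<forall>v\<in>{v \<in> V. lookup v a = c}. \<exists>g\<in>H. \<forall>x\<in>A. lookup g x \<le> lookup v x)" for c
    by (rule insert.IH)
  from choice[OF allI[OF this]] obtain H where "\<forall>c. finite (H c) \<and> H c \<subseteq> {v \<in> V. lookup v a = c} \<and>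
      (\<forall>v\<in>{v \<in> V. lookup v a = c}. \<exists>g\<in>H c. \<forall>x\<in>A. lookup g x \<le> lookup v x)" ..
  then have H: "finite (H c)" "H c \<subseteq> {v \<in> V. lookup v a = c}"
    "v \<in> V \<Longrightarrow> lookup v a = c \<Longrightarrow> \<exists>g\<in>H c. \<forall>x\<in>A. lookup g x \<le> lookup v x" for c v
    by simp_all
  let ?G = "G \<union> (\<Union>c\<le>N. H c)"
  have "\<exists>g\<in>?G. \<forall>x\<in>insert a A. lookup g x \<le> lookup v x" if v: "v \<in> V" for v
  proof (cases "N \<le> lookup v a")
    case True
    obtain g where "g \<in> G" "\<forall>x\<in>A. lookup g x \<le> lookup v x" using G(3)[OF v] by auto
    then show ?thesis using N[of g] True by (intro bexI[of _ g]) auto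
  next
    case False
    obtain g where g: "g \<in> H (lookup v a)" "\<forall>x\<in>A. lookup g x \<le> lookup v x" using H(3)[OF v refl] by auto
    then have "lookup g a = lookup v a" using H(2) by blast
    then show ?thesis using g False by (intro bexI[of _ g]) auto
  qed
  moreover have "finite ?G" "?G \<subseteq> V" using G(1,2) H(1,2) by auto
  ultimately show ?case by blast
qed

definition tot_deg :: "('x \<Rightarrow>\<^sub>0 nat) \<Rightarrow> nat" where
  "tot_deg m = lookup (push_mono (\<lambda>_. True) m) True"

lemma tot_deg_add: "tot_deg (a + b) = tot_deg a + tot_deg b"
  by (simp add: tot_deg_def push_mono_add lookup_add)

lemma tot_deg_single [simp]: "tot_deg (single x k) = k"
  by (simp add: tot_deg_def)

lemma lookup_le_tot_deg: "lookup m x \<le> tot_deg m"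
  unfolding tot_deg_def using lookup_le_push_mono[of m x "\<lambda>_. True"] by simp

lemma tot_deg_sum: "tot_deg m = (\<Sum>x\<in>keys m. lookup m x)"
  by (simp add: tot_deg_def push_mono_def lookup_sum)

lemma keys_diff_nat: "keys (a - b) \<subseteq> keys (a :: 'x \<Rightarrow>\<^sub>0 nat)"
  by (auto simp: in_keys_iff lookup_minus)

lemma keys_multE:
  assumes "e \<in> keys (p * q)"
  obtains a b where "e = a + b" "a \<in> keys p" "b \<in> keys q"
  using assms keys_mult[of p q] by blast

section \<open>Standard monomials\<close>

context row_forms
begin

definition degree_monos :: "(kvar \<Rightarrow>\<^sub>0 nat) \<Rightarrow> (nat \<times> nat \<Rightarrow>\<^sub>0 nat) set" where
  "degree_monos e = {m. snd ` keys m \<subseteq> {..<n} \<and> multidegree d m = e}"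

text \<open>As in Groebner basis theory, but expressed through functions: the monomial function is
  no combination of smaller ones of the same multidegree. The order is the linear order of
  polynomial mappings, which is compatible with addition.\<close>

definition std_mono :: "(nat \<times> nat \<Rightarrow>\<^sub>0 nat) \<Rightarrow> bool" where
  "std_mono m \<longleftrightarrow> gen m [] \<notin> fv.span ((\<lambda>m. gen m []) ` {m' \<in> degree_monos (multidegree d m). m' < m})"

lemma gens_0: "gens 0 e = (\<lambda>m. gen m []) ` degree_monos e"
  by (auto simp: gens_def degree_monos_def column_degree_def)

lemma finite_degree_monos: "finite (degree_monos e)"
  by (rule finite_subset[OF _ finite_multidegree[of d e]]) (auto simp: degree_monos_def intro!: exI[of _ 0])

lemma std_mono_basis:
  "inj_on (\<lambda>m. gen m []) {m \<in> degree_monos e. std_mono m}"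
  "fv.independent ((\<lambda>m. gen m []) ` {m \<in> degree_monos e. std_mono m})"
  "fv.span ((\<lambda>m. gen m []) ` {m \<in> degree_monos e. std_mono m}) = fv.span (gens 0 e)"
proof -
  have "{m \<in> degree_monos e. std_mono m} =
      {m \<in> degree_monos e. gen m [] \<notin> fv.span ((\<lambda>m. gen m []) ` {m' \<in> degree_monos e. m' < m})}"
    by (auto simp: std_mono_def degree_monos_def)
  then show "inj_on (\<lambda>m. gen m []) {m \<in> degree_monos e. std_mono m}"
    "fv.independent ((\<lambda>m. gen m []) ` {m \<in> degree_monos e. std_mono m})"
    "fv.span ((\<lambda>m. gen m []) ` {m \<in> degree_monos e. std_mono m}) = fv.span (gens 0 e)"
    using fv.standard_subset[OF finite_degree_monos[of e], of "\<lambda>m. gen m []"] unfolding gens_0 by simp_all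
qed

lemma hdim_std_mono: "hdim 0 e = card {m \<in> degree_monos e. std_mono m}"
proof -
  let ?S = "{m \<in> degree_monos e. std_mono m}"
  have "hdim 0 e = fv.dim (fv.span ((\<lambda>m. gen m []) ` ?S))" by (simp add: hdim_def std_mono_basis(3))
  also have "\<dots> = card ((\<lambda>m. gen m []) ` ?S)"
    by (rule fv.dim_span_eq_card_independent[OF std_mono_basis(2)])
  also have "\<dots> = card ?S" by (rule card_image[OF std_mono_basis(1)])
  finally show ?thesis .
qed

text \<open>A relation expressing m through smaller monomials, multiplied by x, does the same for m
  + x. Nonstandard monomials thus form a monomial ideal.\<close>

lemma std_mono_divisor:
  assumes "std_mono (m + x)" "snd ` keys x \<subseteq> {..<n}"
  shows "std_mono m"
proof (rule ccontr)
  assume "\<not> std_mono m"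
  then have m: "gen m [] \<in> fv.span ((\<lambda>m. gen m []) ` {m' \<in> degree_monos (multidegree d m). m' < m})"
    by (simp add: std_mono_def)
  have lin: "fun_linear (\<lambda>f z. gen x [] z * f z)"
    by (rule linear_funI) (auto simp: fun_eq_iff algebra_simps)
  have gen_add: "(\<lambda>z. gen x [] z * gen m' [] z) = gen (m' + x) []" for m'
    by (auto simp: gen_def odet_def form_mono_add fun_eq_iff)
  have "(\<lambda>z. gen x [] z * gen m [] z) \<in>
      fv.span ((\<lambda>m. gen m []) ` {m' \<in> degree_monos (multidegree d (m + x)). m' < m + x})"
  proof (rule linear_image_span_subset[OF lin _ m])
    fix f assume "f \<in> (\<lambda>m. gen m []) ` {m' \<in> degree_monos (multidegree d m). m' < m}"
    then obtain m' where m': "f = gen m' []" "m' \<in> degree_monos (multidegree d m)" "m' < m" by auto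
    have "m' + x \<in> degree_monos (multidegree d (m + x))"
      using m'(2) assms(2) by (auto simp: degree_monos_def multidegree_add keys_add_nat)
    moreover have "m' + x < m + x" using m'(3) by (rule add_strict_right_mono)
    ultimately show "(\<lambda>z. gen x [] z * f z) \<in>
        fv.span ((\<lambda>m. gen m []) ` {m' \<in> degree_monos (multidegree d (m + x)). m' < m + x})"
      unfolding m'(1) gen_add by (intro fv.span_base imageI) simp
  qed
  then show False using assms(1) unfolding gen_add by (simp add: std_mono_def)
qed

text \<open>The ideal of nonstandard monomials on M rows has finitely many generators. Above all
  their exponents, lowering an exponent by one leaves divisibility by any of them unchanged.\<close>

lemma std_mono_bound:
  "\<exists>N. \<forall>m x. keys m \<subseteq> {..<M} \<times> {..<n} \<and> N < lookup m x \<longrightarrow> std_mono (m - single x 1) = std_mono m"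
proof -
  let ?A = "{..<M} \<times> {..<n}"
  let ?V = "{m. keys m \<subseteq> ?A \<and> \<not> std_mono m}"
  obtain G where G: "finite G" "G \<subseteq> ?V" "\<And>v. v \<in> ?V \<Longrightarrow> \<exists>g\<in>G. \<forall>x\<in>?A. lookup g x \<le> lookup v x"
    using dickson[of ?A ?V] by auto
  \<comment> \<open>A crude bound in place of a maximum: it exceeds or equals every exponent of
    every generator.\<close>
  define N where "N = (\<Sum>g\<in>G. tot_deg g)"
  have N: "lookup g x \<le> N" if "g \<in> G" for g x
    using lookup_le_tot_deg[of g x] member_le_sum[OF that, of tot_deg] G(1) by (simp add: N_def)
  have "std_mono (m - single x 1) = std_mono m" if m: "keys m \<subseteq> ?A" "N < lookup m x" for m x
  proof -
    have xA: "x \<in> ?A" using m by (auto simp: in_keys_iff)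
    have split: "m = (m - single x 1) + single x 1"
      using m(2) by (intro poly_mapping_eqI) (auto simp: lookup_add lookup_minus lookup_single when_def)
    have "std_mono (m - single x 1)" if "std_mono m"
      using that xA by (subst (asm) split) (erule std_mono_divisor, auto)
    moreover have "\<not> std_mono (m - single x 1)" if nonstd: "\<not> std_mono m"
    proof
      assume std: "std_mono (m - single x 1)"
      obtain g where g: "g \<in> G" "\<forall>y\<in>?A. lookup g y \<le> lookup m y" using G(3)[of m] m(1) nonstd by auto
      have gA: "keys g \<subseteq> ?A" "\<not> std_mono g" using G(2) g(1) by auto
      have "lookup g y \<le> lookup (m - single x 1) y" for y
      proof (cases "y \<in> ?A")
        case True
        then show ?thesis using g N[OF g(1), of x] m(2) by (auto simp: lookup_minus lookup_single when_def)
      next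
        case False
        then have "y \<notin> keys g" using gA(1) by auto
        then show ?thesis by (simp add: in_keys_iff)
      qed
      then have sum: "m - single x 1 = g + (m - single x 1 - g)"
        by (intro poly_mapping_eqI) (simp add: lookup_add lookup_minus[of _ g])
      have "keys (m - single x 1 - g) \<subseteq> keys m"
        by (rule order_trans[OF keys_diff_nat keys_diff_nat])
      then have "snd ` keys (m - single x 1 - g) \<subseteq> {..<n}" using m(1) by auto
      then have "std_mono g" using std by (subst (asm) sum) (erule std_mono_divisor)
      then show False using gA(2) by simp
    qed
    ultimately show ?thesis by blast
  qed
  then show ?thesis by blast
qed

text \<open>Finely graded, with one variable per matrix entry: coefficients are 0 or 1, and
  multiplication by 1 - x compares a monomial with its neighbour in direction x.\<close>

definition std_series :: "nat \<Rightarrow> nat \<Rightarrow> (nat \<times> nat, int) mpoly" where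
  "std_series M D = (\<Sum>m\<in>{m. keys m \<subseteq> {..<M} \<times> {..<n} \<and> std_mono m \<and> tot_deg m \<le> D}. single m 1)"

lemma finite_tot_deg_le: "finite {m. keys m \<subseteq> {..<M} \<times> {..<n} \<and> std_mono m \<and> tot_deg m \<le> D}"
proof (rule finite_subset)
  show "finite {m :: nat \<times> nat \<Rightarrow>\<^sub>0 nat. keys m \<subseteq> {..<M} \<times> {..<n} \<and> (\<forall>x. lookup m x \<le> D)}"
    by (rule finite_bounded_monomials) simp
  show "{m. keys m \<subseteq> {..<M} \<times> {..<n} \<and> std_mono m \<and> tot_deg m \<le> D} \<subseteq>
      {m. keys m \<subseteq> {..<M} \<times> {..<n} \<and> (\<forall>x. lookup m x \<le> D)}"
    by (auto intro: order_trans[OF lookup_le_tot_deg])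
qed

lemma lookup_std_series:
  "lookup (std_series M D) m = (if keys m \<subseteq> {..<M} \<times> {..<n} \<and> std_mono m \<and> tot_deg m \<le> D then 1 else 0)"
  using finite_tot_deg_le[of M D] by (simp add: std_series_def lookup_sum lookup_single when_def)

abbreviation "degree_hom \<equiv> msub (\<lambda>x. Var (U (fst x)) * Var (T (d + snd x)) :: (kvar, int) mpoly)"

lemma mev_degree: "mev (\<lambda>x. Var (U (fst x)) * Var (T (d + snd x))) m = (single (multidegree d m) 1 :: (kvar, int) mpoly)"
  unfolding mev_mult multidegree_push mev_Var[symmetric] mev_add mev_push_mono ..

lemma degree_hom_std_series: "degree_hom (std_series M D) = hpoly 0 M D"
proof (rule poly_mapping_eqI)
  fix e
  let ?S = "{m. keys m \<subseteq> {..<M} \<times> {..<n} \<and> std_mono m \<and> tot_deg m \<le> D}"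
  have "lookup (degree_hom (std_series M D)) e = (\<Sum>m\<in>?S. if multidegree d m = e then 1 else 0)"
    by (simp add: std_series_def msub_sum mev_degree lookup_sum lookup_single when_def) (auto intro!: sum.cong)
  also have "\<dots> = int (card {m \<in> ?S. multidegree d m = e})"
    using finite_tot_deg_le[of M D] by (simp add: sum.inter_filter[symmetric])
  also have "{m \<in> ?S. multidegree d m = e} =
      (if keys e \<subseteq> ut_vars M \<and> tdeg e \<le> D then {m \<in> degree_monos e. std_mono m} else {})"
  proof -
    show ?thesis by (auto simp: degree_monos_def tdeg_multidegree tot_deg_def keys_box_iff[of _ M n d])
  qed
  also have "int (card \<dots>) = lookup (hpoly 0 M D) e"
    by (simp add: lookup_hpoly hdim_std_mono)
  finally show "lookup (degree_hom (std_series M D)) e = lookup (hpoly 0 M D) e" .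
qed

lemma degree_hom_factors:
  "degree_hom (\<Prod>x\<in>{..<M} \<times> {..<n}. 1 - Var x) = linear_factors M {d..<d + n}"
  by (simp add: msub.hom_prod msub.hom_minus prod.cartesian_product case_prod_unfold flip: linear_factors_shift)

text \<open>In the fine grading, multiplication by 1 - x cancels all monomials whose exponent of x
  exceeds \<open>N\<close>, by \<open>std_mono_bound\<close>. After multiplication by all these
  factors only exponents up to \<open>N\<close> remain, so one polynomial \<open>Kx\<close> agrees
  with every truncation in its range. Its image under \<open>degree_hom\<close> is the polynomial
  sought.\<close>

lemma K_polynomial_exists:
  "\<exists>K. \<forall>D. tlow D K (hpoly 0 M D * linear_factors M {d..<d + n})"
proof -
  let ?A = "{..<M} \<times> {..<n}"
  let ?P = "\<Prod>x\<in>?A. 1 - Var x :: (nat \<times> nat, int) mpoly"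
  obtain N where N: "\<And>m x. keys m \<subseteq> ?A \<Longrightarrow> N < lookup m x \<Longrightarrow> std_mono (m - single x 1) = std_mono m"
    using std_mono_bound[of M] by blast
  have P: "?P \<in> polys_in ?A" by (intro polys_in_prod polys_in_minus polys_in_Var polys_in_1)
  have S: "std_series M D \<in> polys_in ?A" for D
    by (auto simp: polys_in_def in_keys_iff[of _ "std_series M D"] lookup_std_series split: if_splits)
  \<comment> \<open>Beyond total degree \<open>D\<close> the truncation leaves spurious boundary
    terms, hence the condition on \<open>tot_deg e\<close>.\<close>
  have box: "lookup e x \<le> N" if e: "e \<in> keys (std_series M D * ?P)" "tot_deg e \<le> D" and x: "x \<in> ?A" for e x D
  proof -
    let ?P' = "\<Prod>y\<in>?A - {x}. 1 - Var y :: (nat \<times> nat, int) mpoly"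
    have "?P = (1 - Var x) * ?P'" by (rule prod.remove) (use x in auto)
    then have SP: "std_series M D * ?P = (std_series M D * (1 - Var x)) * ?P'" by (simp add: mult.assoc)
    obtain a b where ab: "e = a + b" "a \<in> keys (std_series M D * (1 - Var x))" "b \<in> keys ?P'"
      using e(1) unfolding SP by (rule keys_multE)
    have "?P' \<in> polys_in (?A - {x})" by (intro polys_in_prod polys_in_minus polys_in_Var polys_in_1)
    then have b: "lookup b x = 0" using ab(3) by (auto simp: polys_in_def in_keys_iff[symmetric] not_in_keys_iff_lookup_eq_zero[symmetric])
    have "lookup a x \<le> N"
    proof (rule ccontr)
      assume a: "\<not> lookup a x \<le> N"
      have "std_series M D * (1 - Var x) \<in> polys_in ?A"
        by (intro polys_in_mult S polys_in_minus polys_in_Var polys_in_1 x)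
      then have aA: "keys a \<subseteq> ?A" using ab(2) by (auto simp: polys_in_def)
      have tot: "tot_deg a \<le> D" using e(2) by (simp add: ab(1) tot_deg_add)
      have split: "a = (a - single x 1) + single x 1"
        using a by (intro poly_mapping_eqI) (auto simp: lookup_add lookup_minus lookup_single when_def)
      have "tot_deg (a - single x 1) \<le> D" using tot by (subst (asm) split) (simp add: tot_deg_add)
      moreover have "keys (a - single x 1) \<subseteq> ?A" by (rule order_trans[OF keys_diff_nat aA])
      moreover have "std_mono (a - single x 1) = std_mono a" using N[OF aA] a by simp
      ultimately have "lookup (std_series M D) (a - single x 1) = lookup (std_series M D) a"
        using aA tot by (simp add: lookup_std_series)
      moreover have "lookup (std_series M D * (1 - Var x)) a =
          lookup (std_series M D) a - lookup (std_series M D) (a - single x 1)"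
        using lookup_Var_power_mult[of x 1 "std_series M D" a] a
        by (simp add: right_diff_distrib lookup_minus mult.commute[of "std_series M D"])
      ultimately show False using ab(2) by (simp add: in_keys_iff)
    qed
    then show ?thesis using b by (simp add: ab(1) lookup_add)
  qed
  define B where "B = card ?A * N"
  have bound: "tot_deg e \<le> B" if e: "e \<in> keys (std_series M D * ?P)" "tot_deg e \<le> D" for e D
  proof -
    have "std_series M D * ?P \<in> polys_in ?A" by (intro polys_in_mult S P)
    then have eA: "keys e \<subseteq> ?A" using e(1) by (auto simp: polys_in_def)
    have "tot_deg e \<le> (\<Sum>x\<in>keys e. N)"
      unfolding tot_deg_sum by (rule sum_mono) (use box[OF e] eA in auto)
    also have "\<dots> \<le> B" using card_mono[OF _ eA] by (simp add: B_def)
    finally show ?thesis .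
  qed
  have cons: "lookup (std_series M D * ?P) e = lookup (std_series M D' * ?P) e"
    if "tot_deg e \<le> D" "tot_deg e \<le> D'" for e D D'
  proof -
    have "e \<notin> keys ((std_series M D - std_series M D') * ?P)"
    proof
      assume "e \<in> keys ((std_series M D - std_series M D') * ?P)"
      then obtain a b where ab: "e = a + b" "a \<in> keys (std_series M D - std_series M D')"
        by (rule keys_multE)
      then show False using that
        by (auto simp: in_keys_iff lookup_minus lookup_std_series tot_deg_add split: if_splits)
    qed
    then show ?thesis by (simp add: in_keys_iff left_diff_distrib lookup_minus)
  qed
  define Kx where "Kx = (\<Sum>e\<in>{e \<in> keys (std_series M B * ?P). tot_deg e \<le> B}. single e (lookup (std_series M B * ?P) e))"
  have Kx: "lookup Kx e = (if tot_deg e \<le> B then lookup (std_series M B * ?P) e else 0)" for e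
    unfolding Kx_def by (auto simp: lookup_sum lookup_single when_def in_keys_iff)
  have Kx_eq: "lookup Kx e = lookup (std_series M D * ?P) e" if "tot_deg e \<le> D" for e D
    using cons[of e D B] bound[of e D] that by (auto simp: Kx in_keys_iff)
  have "tlow D (degree_hom Kx) (hpoly 0 M D * linear_factors M {d..<d + n})" for D
  proof -
    let ?q = "Kx - std_series M D * ?P"
    have "high D (degree_hom ?q)"
      unfolding msub_def
    proof (rule high_sum)
      fix e assume "e \<in> keys ?q"
      then have "D < tot_deg e" using Kx_eq[of e D] by (auto simp: in_keys_iff lookup_minus not_le[symmetric])
      then have "high D (single (multidegree d e) 1)" by (auto simp: high_def tdeg_multidegree tot_deg_def)
      then show "high D (of_int (lookup ?q e) * mev (\<lambda>x. Var (U (fst x)) * Var (T (d + snd x))) e)"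
        unfolding mev_degree by (subst mult.commute) (rule high_mult)
    qed
    then show ?thesis
      by (simp add: tlow_iff_high msub.hom_minus msub_mult degree_hom_std_series degree_hom_factors)
  qed
  then show ?thesis by blast
qed

end

section \<open>Direct sums\<close>

text \<open>Indexing by a family includes injectivity: equal functions at different indices count as
  dependent.\<close>

definition indep_family :: "'i set \<Rightarrow> ('i \<Rightarrow> 'a \<Rightarrow> 'k::field) \<Rightarrow> bool" where
  "indep_family I F \<longleftrightarrow> (\<forall>c. (\<forall>x. (\<Sum>i\<in>I. c i * F i x) = 0) \<longrightarrow> (\<forall>i\<in>I. c i = 0))"

lemma indep_familyD: "indep_family I F \<Longrightarrow> (\<And>x. (\<Sum>i\<in>I. c i * F i x) = 0) \<Longrightarrow> i \<in> I \<Longrightarrow> c i = 0"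
  by (auto simp: indep_family_def)

lemma indep_family_iff:
  fixes F :: "'i \<Rightarrow> 'a \<Rightarrow> 'k::field"
  assumes "finite I"
  shows "indep_family I F \<longleftrightarrow> inj_on F I \<and> fv.independent (F ` I)"
proof
  assume ind: "indep_family I F"
  have inj: "inj_on F I"
  proof (rule inj_onI, rule ccontr)
    fix i j assume ij: "i \<in> I" "j \<in> I" "F i = F j" "i \<noteq> j"
    let ?c = "\<lambda>l. (if l = i then 1 else 0) - (if l = j then 1 else 0) :: 'k"
    have "(\<Sum>l\<in>I. ?c l * F l x) = F i x - F j x" for x
    proof -
      have "(\<Sum>l\<in>I. ?c l * F l x) = (\<Sum>l\<in>I. if l = i then F l x else 0) - (\<Sum>l\<in>I. if l = j then F l x else 0)"
        unfolding sum_subtractf[symmetric] by (rule sum.cong) auto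
      then show ?thesis using ij(1,2) assms by simp
    qed
    then have "(\<Sum>l\<in>I. ?c l * F l x) = 0" for x using ij(3) by simp
    from indep_familyD[OF ind this ij(1)] have "?c i = 0" .
    then show False using ij(4) by simp
  qed
  moreover have "fv.independent (F ` I)"
  proof (rule fv.independent_if_scalars_zero)
    fix u f assume u: "(\<Sum>f\<in>F ` I. (\<lambda>x. u f * f x)) = 0" and f: "f \<in> F ` I"
    have "(\<Sum>i\<in>I. u (F i) * F i x) = 0" for x
      using fun_cong[OF u, of x] by (simp add: sum_fun_apply sum.reindex[OF inj])
    from indep_familyD[OF ind this] show "u f = 0" using f by auto
  qed (use assms in simp)
  ultimately show "inj_on F I \<and> fv.independent (F ` I)" ..
next
  assume *: "inj_on F I \<and> fv.independent (F ` I)"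
  show "indep_family I F"
    unfolding indep_family_def
  proof (intro allI impI ballI)
    fix c i assume c: "\<forall>x. (\<Sum>i\<in>I. c i * F i x) = 0" and i: "i \<in> I"
    let ?u = "\<lambda>f. c (inv_into I F f)"
    have "(\<Sum>f\<in>F ` I. (\<lambda>x. ?u f * f x)) = 0"
    proof
      fix x
      have "(\<Sum>f\<in>F ` I. ?u f * f x) = (\<Sum>i\<in>I. ?u (F i) * F i x)"
        using * by (simp add: sum.reindex)
      also have "\<dots> = (\<Sum>i\<in>I. c i * F i x)" using * by (intro sum.cong refl) simp
      also have "\<dots> = 0" using c by simp
      finally show "(\<Sum>f\<in>F ` I. (\<lambda>x. ?u f * f x)) x = 0 x" by (simp add: sum_fun_apply)
    qed
    then have "?u (F i) = 0"
      using fv.independentD[of "F ` I" "F ` I" ?u "F i"] * assms i by auto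
    then show "c i = 0" using * i by simp
  qed
qed

lemma indep_family_subset: "indep_family I F \<Longrightarrow> finite I \<Longrightarrow> J \<subseteq> I \<Longrightarrow> indep_family J F"
  by (auto simp: indep_family_iff finite_subset inj_on_subset fv.independent_mono image_mono)

section \<open>Independence across row degrees\<close>

definition scale_rows :: "(nat \<Rightarrow> 'k) \<Rightarrow> ('k::field_char_0 point \<Rightarrow> 'k) \<Rightarrow> ('k point \<Rightarrow> 'k)" where
  "scale_rows t f = (\<lambda>(g, y). f (\<lambda>i k. t i * g i k, y))"

lemma linear_scale_rows: "fun_linear (scale_rows t)"
  by (rule linear_funI) (auto simp: scale_rows_def fun_eq_iff)

lemma mev_characters_inj: "inj (\<lambda>a t. mev (t :: 'i \<Rightarrow> 'k::field_char_0) a)"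
proof (rule injI, rule poly_mapping_eqI)
  fix a b :: "'i \<Rightarrow>\<^sub>0 nat" and i :: 'i
  assume eq: "(\<lambda>t :: 'i \<Rightarrow> 'k. mev t a) = (\<lambda>t. mev t b)"
  \<comment> \<open>The value 2 at a single coordinate reads off its exponent, as the powers of 2
    are distinct in characteristic zero.\<close>
  have "mev (\<lambda>j. if j = i then 2 else 1 :: 'k) a = 2 ^ lookup a i" for a
  proof -
    have "mev (\<lambda>j. if j = i then 2 else 1 :: 'k) a = (\<Prod>x\<in>insert i (keys a). (if x = i then 2 else 1) ^ lookup a x)"
      by (rule mev_superset) auto
    also have "\<dots> = (\<Prod>x\<in>insert i (keys a). if x = i then 2 ^ lookup a i else 1)"
      by (rule prod.cong) auto
    also have "\<dots> = 2 ^ lookup a i" by (subst prod.delta) auto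
    finally show ?thesis .
  qed
  then have "(2 :: 'k) ^ lookup a i = 2 ^ lookup b i" using fun_cong[OF eq, of "\<lambda>j. if j = i then 2 else 1"] by simp
  then have "of_nat (2 ^ lookup a i) = (of_nat (2 ^ lookup b i) :: 'k)" by simp
  then have "(2::nat) ^ lookup a i = 2 ^ lookup b i" by (simp only: of_nat_eq_iff)
  then show "lookup a i = lookup b i" by simp
qed

context row_forms
begin

definition std_monos :: "(nat \<times> nat \<Rightarrow>\<^sub>0 nat) set" where
  "std_monos = {m. snd ` keys m \<subseteq> {..<n} \<and> std_mono m}"

lemma std_monos_degree: "{m \<in> std_monos. multidegree d m = e} = {m \<in> degree_monos e. std_mono m}"
  by (auto simp: std_monos_def degree_monos_def)

lemma scale_rows_gen: "scale_rows t (gen m []) = (\<lambda>x. mev t (push_mono fst m) * gen m [] x)"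
  by (auto simp: scale_rows_def gen_def form_mono_def L_scale mev_mult mev_push_mono fun_eq_iff)

text \<open>Row scaling acts on functions of g with the row degrees as characters, so different row
  degrees are independent. Columns are not scaled in a \<open>point\<close>, and proportional
  columns of the matrix do give dependent functions; therefore the t-part is held fixed.\<close>

lemma std_monos_independent:
  assumes "finite S" "S \<subseteq> std_monos"
    and T_part: "\<And>m m' j. m \<in> S \<Longrightarrow> m' \<in> S \<Longrightarrow> lookup (multidegree d m) (T j) = lookup (multidegree d m') (T j)"
  shows "indep_family S (\<lambda>m. gen m [])"
  unfolding indep_family_def
proof (intro allI impI ballI)
  fix c m assume c: "\<forall>x. (\<Sum>m\<in>S. c m * gen m [] x) = 0" and m: "m \<in> S"
  let ?rows = "push_mono fst ` S"
  let ?f = "\<lambda>a. \<Sum>m\<in>{m \<in> S. push_mono fst m = a}. (\<lambda>x. c m * gen m [] x)"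
  have f0: "?f (push_mono fst m) = 0"
  proof (rule fv.eigenvectors_independent[where R = scale_rows and \<chi> = "\<lambda>a t. mev t a" and A = ?rows
        and f = ?f and a = "push_mono fst m"])
    show "scale_rows t (?f a) = (\<lambda>x. mev t a * ?f a x)" for a t
    proof -
      interpret R: Vector_Spaces.linear "\<lambda>c f x. c * f x" "\<lambda>c f x. c * f x" "scale_rows t :: ('k point \<Rightarrow> 'k) \<Rightarrow> _"
        by (rule linear_scale_rows)
      have "scale_rows t (?f a) = (\<Sum>m\<in>{m \<in> S. push_mono fst m = a}. scale_rows t (\<lambda>x. c m * gen m [] x))"
        by (rule R.sum)
      also have "\<dots> = (\<Sum>m\<in>{m \<in> S. push_mono fst m = a}. (\<lambda>x. mev t a * (c m * gen m [] x)))"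
      proof (rule sum.cong[OF refl])
        fix m assume m: "m \<in> {m \<in> S. push_mono fst m = a}"
        have "scale_rows t (\<lambda>x. c m * gen m [] x) = (\<lambda>x. c m * scale_rows t (gen m []) x)"
          by (rule R.scale)
        also have "\<dots> = (\<lambda>x. mev t a * (c m * gen m [] x))"
          unfolding scale_rows_gen using m by (simp add: mult.left_commute)
        finally show "scale_rows t (\<lambda>x. c m * gen m [] x) = (\<lambda>x. mev t a * (c m * gen m [] x))" .
      qed
      finally have eq: "scale_rows t (?f a) = (\<Sum>m\<in>{m \<in> S. push_mono fst m = a}. (\<lambda>x. mev t a * (c m * gen m [] x)))" .
      show ?thesis
        unfolding eq by (rule ext) (simp only: sum_fun_apply sum_distrib_left)
    qed
    show "inj_on (\<lambda>a t. mev (t :: nat \<Rightarrow> 'k) a) ?rows"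
      using mev_characters_inj by (rule inj_on_subset) auto
    show "(\<Sum>a\<in>?rows. ?f a) = 0"
    proof
      fix x
      have "(\<Sum>a\<in>?rows. ?f a) x = (\<Sum>a\<in>?rows. \<Sum>m\<in>{m \<in> S. push_mono fst m = a}. c m * gen m [] x)"
        by (simp add: sum_fun_apply)
      also have "\<dots> = (\<Sum>m\<in>S. c m * gen m [] x)"
        by (rule sum.group[of S "push_mono fst ` S"]) (use assms(1) in simp_all)
      finally show "(\<Sum>a\<in>?rows. ?f a) x = 0 x" using c by simp
    qed
  qed (use assms(1) m linear_scale_rows in auto)
  have zero: "(\<Sum>m'\<in>{m' \<in> S. push_mono fst m' = push_mono fst m}. c m' * gen m' [] x) = 0" for x
    using fun_cong[OF f0, of x] by (simp add: sum_fun_apply)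
  have sub: "{m' \<in> S. push_mono fst m' = push_mono fst m} \<subseteq> {m' \<in> degree_monos (multidegree d m). std_mono m'}"
  proof safe
    fix m' assume m': "m' \<in> S" "push_mono fst m' = push_mono fst m"
    have "lookup (multidegree d m') x = lookup (multidegree d m) x" for x
      using T_part[OF m'(1) m] m'(2) by (cases x) (auto simp: lookup_multidegree_U)
    then have "multidegree d m' = multidegree d m" by (rule poly_mapping_eqI)
    then show "m' \<in> degree_monos (multidegree d m)" "std_mono m'"
      using m'(1) assms(2) by (auto simp: std_monos_def degree_monos_def)
  qed
  have "indep_family {m' \<in> degree_monos (multidegree d m). std_mono m'} (\<lambda>m. gen m [])"
    using std_mono_basis(1,2) finite_degree_monos by (subst indep_family_iff) auto
  then have "indep_family {m' \<in> S. push_mono fst m' = push_mono fst m} (\<lambda>m. gen m [])"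
    by (rule indep_family_subset) (use sub finite_degree_monos in auto)
  from indep_familyD[OF this zero] show "c m = 0" using m by simp
qed

end

text \<open>The maps \<open>\<pi>1\<close> and \<open>\<pi>2\<close> extract the halves of a row
  vector that act on the two blocks, and \<open>join\<close> shows that the halves can be prescribed
  independently. The offset n1 of the second block makes its t variables those of the right-hand
  columns.\<close>

locale row_forms_sum = A: row_forms L1 0 n1 r1 + B: row_forms L2 n1 n2 r2 + C: row_forms L 0 "n1 + n2" r
  for L1 L2 L :: "(nat \<Rightarrow> 'k::field_char_0) \<Rightarrow> nat \<Rightarrow> 'k" and n1 r1 n2 r2 r :: nat +
  fixes \<pi>1 \<pi>2 :: "(nat \<Rightarrow> 'k) \<Rightarrow> nat \<Rightarrow> 'k" and join :: "(nat \<Rightarrow> 'k) \<Rightarrow> (nat \<Rightarrow> 'k) \<Rightarrow> nat \<Rightarrow> 'k"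
  assumes L_left: "c < n1 \<Longrightarrow> L x c = L1 (\<pi>1 x) c"
    and L_right: "c < n2 \<Longrightarrow> L x (c + n1) = L2 (\<pi>2 x) c"
    and join: "L1 (\<pi>1 (join x y)) = L1 x" "L2 (\<pi>2 (join x y)) = L2 y"
begin

definition shift_mono :: "(nat \<times> nat \<Rightarrow>\<^sub>0 nat) \<Rightarrow> (nat \<times> nat \<Rightarrow>\<^sub>0 nat)" where
  "shift_mono = push_mono (\<lambda>x. (fst x, snd x + n1))"

definition pairs :: "(kvar \<Rightarrow>\<^sub>0 nat) \<Rightarrow> ((nat \<times> nat \<Rightarrow>\<^sub>0 nat) \<times> (nat \<times> nat \<Rightarrow>\<^sub>0 nat)) set" where
  "pairs e = {(m1, m2). m1 \<in> A.std_monos \<and> m2 \<in> B.std_monos \<and> multidegree 0 m1 + multidegree n1 m2 = e}"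

lemma finite_pairs: "finite (pairs e)"
proof (rule finite_subset)
  show "pairs e \<subseteq> {m. \<exists>a. multidegree 0 m + a = e} \<times> {m. \<exists>a. multidegree n1 m + a = e}"
    by (auto simp: pairs_def add.commute)
  show "finite ({m. \<exists>a. multidegree 0 m + a = e} \<times> {m. \<exists>a. multidegree n1 m + a = e})"
    by (intro finite_cartesian_product finite_multidegree)
qed

lemma multidegree_shift: "multidegree 0 (shift_mono m) = multidegree n1 m"
  by (simp add: multidegree_push shift_mono_def push_mono_push_mono add.commute)

lemma form_mono_sum:
  assumes "snd ` keys m1 \<subseteq> {..<n1}" "snd ` keys m2 \<subseteq> {..<n2}"
  shows "C.form_mono (m1 + shift_mono m2) g = A.form_mono m1 (\<lambda>i. \<pi>1 (g i)) * B.form_mono m2 (\<lambda>i. \<pi>2 (g i))"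
proof -
  have "C.form_mono m1 g = A.form_mono m1 (\<lambda>i. \<pi>1 (g i))"
    unfolding A.form_mono_def C.form_mono_def by (rule mev_cong) (use assms(1) in \<open>auto intro: L_left\<close>)
  moreover have "C.form_mono (shift_mono m2) g = B.form_mono m2 (\<lambda>i. \<pi>2 (g i))"
    unfolding B.form_mono_def C.form_mono_def shift_mono_def mev_push_mono
    by (rule mev_cong) (use assms(2) in \<open>auto intro: L_right\<close>)
  ultimately show ?thesis by (simp add: C.form_mono_add)
qed

definition tensor :: "('k point \<Rightarrow> 'k) \<Rightarrow> ('k point \<Rightarrow> 'k) \<Rightarrow> ('k point \<Rightarrow> 'k)" where
  "tensor f1 f2 = (\<lambda>(g, y). f1 (\<lambda>i. \<pi>1 (g i), y) * f2 (\<lambda>i. \<pi>2 (g i), y))"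

lemma gen_sum:
  assumes "snd ` keys m1 \<subseteq> {..<n1}" "snd ` keys m2 \<subseteq> {..<n2}"
  shows "C.gen (m1 + shift_mono m2) [] = tensor (A.gen m1 []) (B.gen m2 [])"
  by (auto simp: fun_eq_iff C.gen_def A.gen_def B.gen_def tensor_def form_mono_sum[OF assms]
      A.odet_def B.odet_def C.odet_def)

lemma split_mono:
  assumes "snd ` keys m \<subseteq> {..<n1 + n2}"
  obtains m1 m2 where "m = m1 + shift_mono m2" "snd ` keys m1 \<subseteq> {..<n1}" "snd ` keys m2 \<subseteq> {..<n2}"
proof -
  have "\<exists>m1 m2. m = m1 + shift_mono m2 \<and> snd ` keys m1 \<subseteq> {..<n1} \<and> snd ` keys m2 \<subseteq> {..<n2}"
    using assms
  proof (induction m rule: monomial_induct)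
    case zero
    then show ?case by (intro exI[of _ 0]) (simp add: shift_mono_def)
  next
    case (add m x)
    from add.prems have "snd ` keys m \<subseteq> {..<n1 + n2}" and x: "snd x < n1 + n2"
      by (auto simp: keys_add_nat)
    then obtain m1 m2 where m: "m = m1 + shift_mono m2" "snd ` keys m1 \<subseteq> {..<n1}" "snd ` keys m2 \<subseteq> {..<n2}"
      using add.IH by blast
    show ?case
    proof (cases "snd x < n1")
      case True
      then show ?thesis using m by (intro exI[of _ "m1 + single x 1"] exI[of _ m2]) (auto simp: keys_add_nat add_ac)
    next
      case False
      let ?x = "(fst x, snd x - n1)"
      have "shift_mono (m2 + single ?x 1) = shift_mono m2 + single x 1"
        using False by (simp add: shift_mono_def push_mono_add)
      then show ?thesis using m x False
        by (intro exI[of _ m1] exI[of _ "m2 + single ?x 1"]) (auto simp: keys_add_nat add_ac)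
    qed
  qed
  then show thesis using that by blast
qed

lemma tensor_span:
  assumes "f1 \<in> fv.span (A.gens 0 e1)" "f2 \<in> fv.span (B.gens 0 e2)"
  shows "tensor f1 f2 \<in> fv.span ((\<lambda>(m1, m2). tensor (A.gen m1 []) (B.gen m2 [])) ` pairs (e1 + e2))"
proof -
  have lin1: "fun_linear (\<lambda>f1. tensor f1 f2)" for f2
    by (rule linear_funI) (auto simp: tensor_def fun_eq_iff algebra_simps)
  have lin2: "fun_linear (tensor f1)" for f1
    by (rule linear_funI) (auto simp: tensor_def fun_eq_iff algebra_simps)
  from assms have f: "f1 \<in> fv.span ((\<lambda>m. A.gen m []) ` {m \<in> A.std_monos. multidegree 0 m = e1})"
    "f2 \<in> fv.span ((\<lambda>m. B.gen m []) ` {m \<in> B.std_monos. multidegree n1 m = e2})"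
    by (simp_all add: A.std_monos_degree B.std_monos_degree A.std_mono_basis(3) B.std_mono_basis(3))
  show ?thesis
  proof (rule linear_image_span_subset[OF lin1 _ f(1)])
    fix h1 assume "h1 \<in> (\<lambda>m. A.gen m []) ` {m \<in> A.std_monos. multidegree 0 m = e1}"
    then obtain m1 where m1: "h1 = A.gen m1 []" "m1 \<in> A.std_monos" "multidegree 0 m1 = e1" by auto
    show "tensor h1 f2 \<in> fv.span ((\<lambda>(m1, m2). tensor (A.gen m1 []) (B.gen m2 [])) ` pairs (e1 + e2))"
    proof (rule linear_image_span_subset[OF lin2 _ f(2)])
      fix h2 assume "h2 \<in> (\<lambda>m. B.gen m []) ` {m \<in> B.std_monos. multidegree n1 m = e2}"
      then obtain m2 where m2: "h2 = B.gen m2 []" "m2 \<in> B.std_monos" "multidegree n1 m2 = e2" by auto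
      have "(m1, m2) \<in> pairs (e1 + e2)" using m1 m2 by (simp add: pairs_def)
      then show "tensor h1 h2 \<in> fv.span ((\<lambda>(m1, m2). tensor (A.gen m1 []) (B.gen m2 [])) ` pairs (e1 + e2))"
        unfolding m1(1) m2(1) by (intro fv.span_base image_eqI[of _ _ "(m1, m2)"]) auto
    qed
  qed
qed

text \<open>With the second half of each row frozen, a relation becomes one among the functions of
  the first half, whose coefficients must vanish. These coefficients are relations among the
  functions of the second half.\<close>

lemma pairs_independent: "indep_family (pairs e) (\<lambda>(m1, m2). tensor (A.gen m1 []) (B.gen m2 []))"
  unfolding indep_family_def
proof (intro allI impI ballI)
  fix c m assume "\<forall>x. (\<Sum>m\<in>pairs e. c m * (case m of (m1, m2) \<Rightarrow> tensor (A.gen m1 []) (B.gen m2 [])) x) = 0"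
    and m: "m \<in> pairs e"
  then have c: "(\<Sum>m\<in>pairs e. c m * tensor (A.gen (fst m) []) (B.gen (snd m) []) x) = 0" for x
    by (simp add: case_prod_unfold del: split_paired_All)
  let ?S = "fst ` pairs e"
  \<comment> \<open>Columns below n1 come from the first block only, so the total degree e fixes the
    t-part of m1.\<close>
  have T_part: "lookup (multidegree 0 m1) (T j) = (if j < n1 then lookup e (T j) else 0)" if m1S: "m1 \<in> ?S" for m1 j
  proof -
    obtain m2 where m2: "(m1, m2) \<in> pairs e" using m1S by auto
    have m1: "snd ` keys m1 \<subseteq> {..<n1}" using m2 by (simp add: pairs_def A.std_monos_def)
    have "T j \<notin> keys (multidegree n1 m2)" if "j < n1" using that by (auto simp: keys_multidegree)
    moreover have "T j \<notin> keys (multidegree 0 m1)" if "\<not> j < n1" using that m1 by (auto simp: keys_multidegree)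
    ultimately show ?thesis using m2 by (auto simp: pairs_def lookup_add in_keys_iff)
  qed
  have ind: "indep_family ?S (\<lambda>m. A.gen m [])"
  proof (rule A.std_monos_independent)
    show "finite ?S" using finite_pairs by simp
    show "?S \<subseteq> A.std_monos" by (auto simp: pairs_def)
  qed (simp add: T_part)
  obtain m1 m2 where m12: "m = (m1, m2)" by (cases m)
  let ?P = "\<lambda>m1. {m2. (m1, m2) \<in> pairs e}"
  have finP: "finite (?P m1)" for m1
    by (rule finite_subset[of _ "snd ` pairs e"]) (force simp: finite_pairs)+
  have inner: "(\<Sum>m2\<in>?P m1. c (m1, m2) * B.gen m2 [] (g2, y)) = 0" if m1: "m1 \<in> ?S" for g2 y m1
  proof (rule indep_familyD[OF ind _ m1, where c = "\<lambda>m1. \<Sum>m2\<in>?P m1. c (m1, m2) * B.gen m2 [] (g2, y)"])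
    fix x :: "'k point"
    obtain g1 y' where x: "x = (g1, y')" by (cases x)
    have joinA: "A.gen m1 [] (\<lambda>i. \<pi>1 (join (g1 i) (g2 i)), y) = A.gen m1 [] (g1, y')" for m1
      by (simp add: A.gen_def A.form_mono_def join A.odet_def)
    have joinB: "B.gen m2 [] (\<lambda>i. \<pi>2 (join (g1 i) (g2 i)), y) = B.gen m2 [] (g2, y)" for m2
      by (simp add: B.gen_def B.form_mono_def join)
    have "(\<Sum>m1\<in>?S. (\<Sum>m2\<in>?P m1. c (m1, m2) * B.gen m2 [] (g2, y)) * A.gen m1 [] x) =
        (\<Sum>m1\<in>?S. \<Sum>m2\<in>?P m1. c (m1, m2) * tensor (A.gen m1 []) (B.gen m2 []) (\<lambda>i. join (g1 i) (g2 i), y))"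
      by (simp add: sum_distrib_left tensor_def joinA joinB x mult_ac)
    also have "\<dots> = (\<Sum>(m1, m2)\<in>(SIGMA m1:?S. ?P m1). c (m1, m2) * tensor (A.gen m1 []) (B.gen m2 []) (\<lambda>i. join (g1 i) (g2 i), y))"
      by (rule sum.Sigma) (auto simp: finite_pairs finP)
    also have "(SIGMA m1:?S. ?P m1) = pairs e" by force
    also have "(\<Sum>(m1, m2)\<in>pairs e. c (m1, m2) * tensor (A.gen m1 []) (B.gen m2 []) (\<lambda>i. join (g1 i) (g2 i), y)) = 0"
      using c[of "(\<lambda>i. join (g1 i) (g2 i), y)"] by (simp add: case_prod_unfold)
    finally show "(\<Sum>m1\<in>?S. (\<Sum>m2\<in>?P m1. c (m1, m2) * B.gen m2 [] (g2, y)) * A.gen m1 [] x) = 0" .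
  qed
  have "indep_family (?P m1) (\<lambda>m. B.gen m [])"
  proof (rule B.std_monos_independent[OF finP])
    show "?P m1 \<subseteq> B.std_monos" by (auto simp: pairs_def)
    show "lookup (multidegree n1 m) (T j) = lookup (multidegree n1 m') (T j)" if "m \<in> ?P m1" "m' \<in> ?P m1" for m m' j
      using that by (auto simp: pairs_def)
  qed
  then show "c m = 0"
    unfolding m12
  proof (rule indep_familyD[where c = "\<lambda>m2. c (m1, m2)"])
    fix x :: "'k point"
    have "m1 \<in> ?S" using m m12 by force
    from inner[OF this] show "(\<Sum>m2\<in>?P m1. c (m1, m2) * B.gen m2 [] x) = 0" by (cases x) simp
  qed (use m m12 in auto)
qed

lemma hdim_sum: "C.hdim 0 e = card (pairs e)"
proof -
  let ?F = "\<lambda>(m1, m2). tensor (A.gen m1 []) (B.gen m2 [])"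
  have span: "fv.span (C.gens 0 e) = fv.span (?F ` pairs e)"
  proof (intro equalityI fv.span_minimal fv.subspace_span)
    show "C.gens 0 e \<subseteq> fv.span (?F ` pairs e)"
    proof
      fix f assume "f \<in> C.gens 0 e"
      then obtain m where m: "f = C.gen m []" "snd ` keys m \<subseteq> {..<n1 + n2}" "multidegree 0 m = e"
        by (auto simp: C.gens_0 C.degree_monos_def)
      obtain m1 m2 where s: "m = m1 + shift_mono m2" "snd ` keys m1 \<subseteq> {..<n1}" "snd ` keys m2 \<subseteq> {..<n2}"
        by (rule split_mono[OF m(2)])
      have "A.gen m1 [] \<in> fv.span (A.gens 0 (multidegree 0 m1))" "B.gen m2 [] \<in> fv.span (B.gens 0 (multidegree n1 m2))"
        using s(2,3) by (auto simp: A.gens_0 B.gens_0 A.degree_monos_def B.degree_monos_def intro!: fv.span_base)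
      from tensor_span[OF this] show "f \<in> fv.span (?F ` pairs e)"
        unfolding m(1) m(3)[symmetric] s(1) multidegree_add multidegree_shift gen_sum[OF s(2,3)] .
    qed
    show "?F ` pairs e \<subseteq> fv.span (C.gens 0 e)"
    proof safe
      fix m1 m2 assume p: "(m1, m2) \<in> pairs e"
      then have k: "snd ` keys m1 \<subseteq> {..<n1}" "snd ` keys m2 \<subseteq> {..<n2}"
        by (auto simp: pairs_def A.std_monos_def B.std_monos_def)
      have "snd ` keys (m1 + shift_mono m2) \<subseteq> {..<n1 + n2}"
        using k by (auto simp: keys_add_nat keys_push_mono shift_mono_def)
      moreover have "multidegree 0 (m1 + shift_mono m2) = e"
        using p by (simp add: pairs_def multidegree_add multidegree_shift)
      ultimately have "m1 + shift_mono m2 \<in> C.degree_monos e" by (simp add: C.degree_monos_def)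
      then show "tensor (A.gen m1 []) (B.gen m2 []) \<in> fv.span (C.gens 0 e)"
        unfolding gen_sum[OF k, symmetric] C.gens_0 by (intro fv.span_base imageI)
    qed
  qed
  have ind: "inj_on ?F (pairs e)" "fv.independent (?F ` pairs e)"
    using pairs_independent[of e] by (auto simp: indep_family_iff[OF finite_pairs])
  have "C.hdim 0 e = fv.dim (fv.span (?F ` pairs e))" by (simp add: C.hdim_def flip: span)
  also have "\<dots> = card (?F ` pairs e)" by (rule fv.dim_span_eq_card_independent[OF ind(2)])
  also have "\<dots> = card (pairs e)" by (rule card_image[OF ind(1)])
  finally show ?thesis .
qed

text \<open>Only a congruence: the product of two truncations is complete up to t-degree
  \<open>D\<close> but may have stray terms above it.\<close>

lemma hpoly_sum: "tlow D (C.hpoly 0 M D) (A.hpoly 0 M D * B.hpoly 0 M D)"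
  unfolding tlow_def
proof (intro allI impI)
  fix e assume D: "tdeg e \<le> D"
  let ?SA = "{m. keys m \<subseteq> {..<M} \<times> {..<n1} \<and> A.std_mono m \<and> tot_deg m \<le> D}"
  let ?SB = "{m. keys m \<subseteq> {..<M} \<times> {..<n2} \<and> B.std_mono m \<and> tot_deg m \<le> D}"
  have A: "A.hpoly 0 M D = (\<Sum>m\<in>?SA. single (multidegree 0 m) 1)"
    unfolding A.degree_hom_std_series[symmetric] A.std_series_def
    by (simp only: msub_sum msub_single A.mev_degree of_int_1 mult_1)
  have B: "B.hpoly 0 M D = (\<Sum>m\<in>?SB. single (multidegree n1 m) 1)"
    unfolding B.degree_hom_std_series[symmetric] B.std_series_def
    by (simp only: msub_sum msub_single B.mev_degree of_int_1 mult_1)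
  have "A.hpoly 0 M D * B.hpoly 0 M D = (\<Sum>(m1, m2)\<in>?SA \<times> ?SB. single (multidegree 0 m1 + multidegree n1 m2) 1)"
    unfolding A B by (simp add: sum_product mult_single sum.cartesian_product)
  then have "lookup (A.hpoly 0 M D * B.hpoly 0 M D) e =
      (\<Sum>p\<in>?SA \<times> ?SB. if multidegree 0 (fst p) + multidegree n1 (snd p) = e then 1 else 0)"
    by (simp only: lookup_sum lookup_single when_def case_prod_unfold)
  also have "\<dots> = int (card {p \<in> ?SA \<times> ?SB. multidegree 0 (fst p) + multidegree n1 (snd p) = e})"
    using A.finite_tot_deg_le[of M D] B.finite_tot_deg_le[of M D]
    by (subst sum.inter_filter[symmetric]) simp_all
  also have "{p \<in> ?SA \<times> ?SB. multidegree 0 (fst p) + multidegree n1 (snd p) = e} =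
      (if keys e \<subseteq> ut_vars M then pairs e else {})"
  proof -
    \<comment> \<open>The two t-degrees add up to that of e, so neither exceeds \<open>D\<close>;
      likewise the rows of both monomials are visible in e.\<close>
    have mem: "m1 \<in> ?SA \<and> m2 \<in> ?SB \<longleftrightarrow> m1 \<in> A.std_monos \<and> m2 \<in> B.std_monos \<and> keys e \<subseteq> ut_vars M"
      if e: "multidegree 0 m1 + multidegree n1 m2 = e" for m1 m2
    proof -
      have "tot_deg m1 \<le> D" "tot_deg m2 \<le> D"
        using D A.tdeg_multidegree[of m1] B.tdeg_multidegree[of m2] by (auto simp: tdeg_add tot_deg_def simp flip: e)
      moreover have "keys e \<subseteq> ut_vars M \<longleftrightarrow>
          keys (multidegree 0 m1) \<subseteq> ut_vars M \<and> keys (multidegree n1 m2) \<subseteq> ut_vars M"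
        by (simp add: keys_add_nat flip: e)
      ultimately show ?thesis
        unfolding mem_Collect_eq A.std_monos_def B.std_monos_def keys_box_iff[of m1 M n1 0] keys_box_iff[of m2 M n2 n1] by blast
    qed
    show ?thesis
    proof (rule Set.set_eqI)
      fix p :: "(nat \<times> nat \<Rightarrow>\<^sub>0 nat) \<times> (nat \<times> nat \<Rightarrow>\<^sub>0 nat)"
      obtain m1 m2 where p: "p = (m1, m2)" by (cases p)
      have "p \<in> {p \<in> ?SA \<times> ?SB. multidegree 0 (fst p) + multidegree n1 (snd p) = e} \<longleftrightarrow>
          (m1 \<in> ?SA \<and> m2 \<in> ?SB) \<and> multidegree 0 m1 + multidegree n1 m2 = e"
        by (simp add: p)
      moreover have "p \<in> (if keys e \<subseteq> ut_vars M then pairs e else {}) \<longleftrightarrow>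
          (m1 \<in> A.std_monos \<and> m2 \<in> B.std_monos \<and> keys e \<subseteq> ut_vars M) \<and>
          multidegree 0 m1 + multidegree n1 m2 = e"
        by (simp add: p pairs_def)
      ultimately show "p \<in> {p \<in> ?SA \<times> ?SB. multidegree 0 (fst p) + multidegree n1 (snd p) = e} \<longleftrightarrow>
          p \<in> (if keys e \<subseteq> ut_vars M then pairs e else {})"
        using mem[of m1 m2] by blast
    qed
  qed
  also have "int (card \<dots>) = lookup (C.hpoly 0 M D) e"
    using D by (simp add: C.lookup_hpoly hdim_sum)
  finally show "lookup (C.hpoly 0 M D) e = lookup (A.hpoly 0 M D * B.hpoly 0 M D) e" by simp
qed

end

section \<open>Orbit closures of matrices\<close>

definition mat_form :: "nat \<Rightarrow> (nat \<Rightarrow> nat \<Rightarrow> 'k::comm_ring_1) \<Rightarrow> (nat \<Rightarrow> 'k) \<Rightarrow> nat \<Rightarrow> 'k" where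
  "mat_form r V x c = (\<Sum>k<r. x k * V k c)"

text \<open>A minor with more than r rows is the determinant of a product of two square matrices
  padded by zeros, and column r of the first is zero.\<close>

lemma row_forms_mat_form: "row_forms (mat_form r V) r"
proof
  fix z :: "nat \<Rightarrow> nat \<Rightarrow> 'a" and cs and j assume "r < j"
  let ?B = "mat j j (\<lambda>(l, k). if k < r then z l k else 0)"
  let ?C = "mat j j (\<lambda>(k, q). if k < r then V k (cs q) else 0)"
  have "det ?B = (\<Sum>i<j. ?B $$ (i, r) * cofactor ?B i r)"
    by (rule laplace_expansion_column) (use \<open>r < j\<close> in auto)
  also have "\<dots> = 0" using \<open>r < j\<close> by (intro sum.neutral) auto
  finally have "det (?B * ?C) = 0" using det_mult[of ?B j ?C] by simp
  moreover have "?B * ?C = mat j j (\<lambda>(l, q). mat_form r V (z l) (cs q))"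
  proof (rule eq_matI)
    fix l q assume "l < dim_row (mat j j (\<lambda>(l, q). mat_form r V (z l) (cs q)))"
      "q < dim_col (mat j j (\<lambda>(l, q). mat_form r V (z l) (cs q)))"
    then have lq: "l < j" "q < j" by auto
    then have "(?B * ?C) $$ (l, q) = (\<Sum>k\<in>{0..<j}. if k < r then z l k * V k (cs q) else 0)"
      by (auto simp: scalar_prod_def intro!: sum.cong)
    also have "\<dots> = (\<Sum>k\<in>{k \<in> {0..<j}. k < r}. z l k * V k (cs q))"
      by (rule sum.inter_filter[symmetric]) simp
    also have "{k \<in> {0..<j}. k < r} = {..<r}" using \<open>r < j\<close> by auto
    finally show "(?B * ?C) $$ (l, q) = mat j j (\<lambda>(l, q). mat_form r V (z l) (cs q)) $$ (l, q)"
      using lq by (simp add: mat_form_def)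
  qed auto
  ultimately show "det (mat j j (\<lambda>(l, q). mat_form r V (z l) (cs q))) = 0" by simp
qed (simp_all add: mat_form_def algebra_simps sum.distrib sum_distrib_left)

lemma eval_at_mev: "eval_at w p = (\<Sum>m\<in>keys p. lookup p m * mev (\<lambda>x. w $$ x) m)"
  by (simp add: eval_at_def mev_def)

lemma vanishing_ideal_closure:
  assumes "S \<subseteq> carrier_mat r n"
  shows "vanishing_ideal r n (zariski_closure r n S) = vanishing_ideal r n S"
proof (intro equalityI subsetI)
  fix p assume p: "p \<in> vanishing_ideal r n S"
  let ?Z = "{w \<in> carrier_mat r n. \<forall>q\<in>{p}. eval_at w q = 0}"
  have "zariski_closed r n ?Z" unfolding zariski_closed_def
    using p by (intro exI[of _ "{p}"]) (simp add: vanishing_ideal_def)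
  moreover have "S \<subseteq> ?Z" using p assms by (auto simp: vanishing_ideal_def)
  ultimately have "zariski_closure r n S \<subseteq> ?Z" by (auto simp: zariski_closure_def)
  then show "p \<in> vanishing_ideal r n (zariski_closure r n S)"
    using p by (auto simp: vanishing_ideal_def)
qed (auto simp: vanishing_ideal_def zariski_closure_def)

lemma det_nonzero_invertible:
  fixes A :: "'k::field mat"
  assumes "A \<in> carrier_mat n n" "det A \<noteq> 0"
  shows "invertible_mat A"
proof -
  obtain B where "B \<in> carrier_mat n n" "A * B = 1\<^sub>m n" "B * A = 1\<^sub>m n"
    using det_non_zero_imp_unit[OF assms, of undefined] by (auto simp: Units_def ring_mat_def)
  then show ?thesis
    using assms(1) by (auto simp: invertible_mat_def inverts_mat_def)
qed

lemma matrix_orbit_memI: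
  fixes v :: "'k::field mat"
  assumes "v \<in> carrier_mat r n" "g \<in> carrier_mat r r" "det g \<noteq> 0"
  shows "g * v \<in> matrix_orbit r n v"
  unfolding matrix_orbit_def using assms det_nonzero_invertible[OF assms(2,3)]
  by (intro CollectI exI[of _ g] exI[of _ "\<lambda>_. 1"]) simp

section \<open>Coefficients of products and dimensions of quotients\<close>

definition antidiagonal :: "('x \<Rightarrow>\<^sub>0 nat) \<Rightarrow> (('x \<Rightarrow>\<^sub>0 nat) \<times> ('x \<Rightarrow>\<^sub>0 nat)) set" where
  "antidiagonal e = {(a, b). a + b = e}"

lemma finite_antidiagonal: "finite (antidiagonal e)"
proof (rule finite_subset)
  let ?M = "{m. keys m \<subseteq> keys e \<and> (\<forall>x. lookup m x \<le> tot_deg e)}"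
  show "antidiagonal e \<subseteq> ?M \<times> ?M"
  proof safe
    fix a b assume ab: "(a, b) \<in> antidiagonal e"
    show "x \<in> keys a \<Longrightarrow> x \<in> keys e" "x \<in> keys b \<Longrightarrow> x \<in> keys e" for x
      using ab by (auto simp: antidiagonal_def keys_add_nat)
    show "lookup a x \<le> tot_deg e" "lookup b x \<le> tot_deg e" for x
      using ab lookup_le_tot_deg[of e x] by (auto simp: antidiagonal_def lookup_add)
  qed
  show "finite (?M \<times> ?M)" by (intro finite_cartesian_product finite_bounded_monomials finite_keys)
qed

lemma lookup_mult_antidiagonal:
  fixes p q :: "('x, int) mpoly"
  shows "lookup (p * q) e = (\<Sum>(a, b)\<in>antidiagonal e. lookup p a * lookup q b)"
proof -
  have "p * q = (\<Sum>a\<in>keys p. \<Sum>b\<in>keys q. single (a + b) (lookup p a * lookup q b))"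
    using sum_product[of "\<lambda>m. single m (lookup p m)" "keys p" "\<lambda>m. single m (lookup q m)" "keys q"]
      poly_mapping_sum_singles[of "keys p" p] poly_mapping_sum_singles[of "keys q" q]
    by (simp add: mult_single)
  then have "lookup (p * q) e = (\<Sum>x\<in>keys p \<times> keys q. if fst x + snd x = e then lookup p (fst x) * lookup q (snd x) else 0)"
    by (simp only: lookup_sum lookup_single when_def sum.cartesian_product case_prod_unfold)
  also have "\<dots> = (\<Sum>x\<in>{x \<in> keys p \<times> keys q. fst x + snd x = e}. lookup p (fst x) * lookup q (snd x))"
    by (rule sum.inter_filter[symmetric]) simp
  also have "\<dots> = (\<Sum>x\<in>antidiagonal e. lookup p (fst x) * lookup q (snd x))"
    by (rule sum.mono_neutral_left[OF finite_antidiagonal]) (auto simp: antidiagonal_def in_keys_iff)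
  finally show ?thesis by (simp add: case_prod_unfold)
qed

lemma lookup_Const_mult: "lookup (Const c * p) m = c * lookup p m"
  for p :: "('x, 'k::field) mpoly"
  unfolding Const_def mult_map_scale_conv_mult[symmetric]
  by (simp add: Poly_Mapping.map.rep_eq when_def)

text \<open>On \<open>V\<close> membership in \<open>I\<close> is the kernel condition for
  \<open>E\<close>, so bases modulo \<open>I\<close> correspond to bases of the image of
  \<open>V\<close>. All have the same size, which gives the definite description its value.\<close>

lemma quotient_dim_eq:
  fixes E :: "('x, 'k::field) mpoly \<Rightarrow> 'a \<Rightarrow> 'k"
  assumes E_sum: "\<And>c B. finite B \<Longrightarrow> E (\<Sum>b\<in>B. Const (c b) * b) = (\<lambda>x. \<Sum>b\<in>B. c b * E b x)"
    and E_diff: "\<And>p q. E (p - q) = (\<lambda>x. E p x - E q x)"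
    and V_sum: "\<And>c B. finite B \<Longrightarrow> B \<subseteq> V \<Longrightarrow> (\<Sum>b\<in>B. Const (c b) * b) \<in> V"
    and V_diff: "\<And>p q. p \<in> V \<Longrightarrow> q \<in> V \<Longrightarrow> p - q \<in> V"
    and I: "\<And>p. p \<in> V \<Longrightarrow> p \<in> I \<longleftrightarrow> (\<forall>x. E p x = 0)"
    and B0: "finite B0" "B0 \<subseteq> V" "indep_family B0 E" "E ` V \<subseteq> fv.span (E ` B0)"
  shows "quotient_dim I V = card B0"
proof -
  have iff: "basis_modulo I V B \<longleftrightarrow> indep_family B E \<and> E ` V \<subseteq> fv.span (E ` B)"
    if B: "finite B" "B \<subseteq> V" for B
  proof -
    have in_I: "(\<Sum>b\<in>B. Const (c b) * b) \<in> I \<longleftrightarrow> (\<forall>x. (\<Sum>b\<in>B. c b * E b x) = 0)" for c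
      using I[OF V_sum[OF B, of c]] by (simp add: E_sum[OF B(1)])
    have diff_I: "p - (\<Sum>b\<in>B. Const (c b) * b) \<in> I \<longleftrightarrow> (\<forall>x. E p x = (\<Sum>b\<in>B. c b * E b x))" if "p \<in> V" for p c
      using I[OF V_diff[OF that V_sum[OF B, of c]]] by (simp add: E_sum[OF B(1)] E_diff)
    have span_iff: "f \<in> fv.span (E ` B) \<longleftrightarrow> (\<exists>c. \<forall>x. f x = (\<Sum>b\<in>B. c b * E b x))"
      if ind: "indep_family B E" for f
    proof -
      have inj: "inj_on E B" using ind B(1) by (simp add: indep_family_iff)
      show ?thesis
      proof
        assume "f \<in> fv.span (E ` B)"
        then obtain u where "f = (\<Sum>h\<in>E ` B. (\<lambda>x. u h * h x))"
          using B(1) by (auto simp: fv.span_finite)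
        then have "\<forall>x. f x = (\<Sum>b\<in>B. u (E b) * E b x)" by (simp add: sum_fun_apply sum.reindex[OF inj])
        then show "\<exists>c. \<forall>x. f x = (\<Sum>b\<in>B. c b * E b x)" by (rule exI[of _ "\<lambda>b. u (E b)"])
      next
        assume "\<exists>c. \<forall>x. f x = (\<Sum>b\<in>B. c b * E b x)"
        then obtain c where "\<forall>x. f x = (\<Sum>b\<in>B. c b * E b x)" ..
        then have "f = (\<Sum>b\<in>B. (\<lambda>x. c b * E b x))" by (auto simp: fun_eq_iff sum_fun_apply)
        also have "\<dots> \<in> fv.span (E ` B)" by (intro fv.span_sum fv.span_scale fv.span_base imageI)
        finally show "f \<in> fv.span (E ` B)" .
      qed
    qed
    have "basis_modulo I V B \<longleftrightarrow> indep_family B E \<and> (\<forall>p\<in>V. \<exists>c. \<forall>x. E p x = (\<Sum>b\<in>B. c b * E b x))"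
      unfolding basis_modulo_def indep_family_def using B by (simp add: in_I diff_I)
    then show ?thesis by (auto simp: image_subset_iff span_iff)
  qed
  have card: "card B = fv.dim (E ` V)" if "basis_modulo I V B" for B
  proof -
    have B: "finite B" "B \<subseteq> V" using that by (auto simp: basis_modulo_def)
    have "inj_on E B" "fv.independent (E ` B)" "E ` V \<subseteq> fv.span (E ` B)"
      using that iff[OF B] B(1) by (simp_all add: indep_family_iff)
    then show ?thesis
      using fv.basis_card_eq_dim[of "E ` B" "E ` V"] B(2) by (simp add: card_image image_mono)
  qed
  have basis: "basis_modulo I V B0" using iff[OF B0(1,2)] B0(3,4) by simp
  show ?thesis
    unfolding quotient_dim_def
    by (rule the_equality) (use card basis card[OF basis] in auto)
qed

section \<open>Hilbert functions of orbit closures\<close>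

locale matrix_forms =
  fixes v :: "'k::field_char_0 mat" and r n d :: nat
  assumes v: "v \<in> carrier_mat r n"
begin

sublocale row_forms "mat_form r (\<lambda>k c. v $$ (k, c))" d n r
  by (rule row_forms_mat_form)

definition eval_form :: "(nat \<times> nat, 'k) mpoly \<Rightarrow> 'k point \<Rightarrow> 'k" where
  "eval_form p = (\<lambda>(g, y). \<Sum>m\<in>keys p. lookup p m * form_mono m g)"

lemma eval_form_superset:
  "finite A \<Longrightarrow> keys p \<subseteq> A \<Longrightarrow> eval_form p (g, y) = (\<Sum>m\<in>A. lookup p m * form_mono m g)"
  unfolding eval_form_def prod.case by (rule sum.mono_neutral_left) (auto simp: in_keys_iff)

lemma eval_form_diff: "eval_form (p - q) = (\<lambda>x. eval_form p x - eval_form q x)"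
proof
  fix x :: "'k point"
  obtain g y where x: "x = (g, y)" by (cases x)
  have "keys (p - q) \<subseteq> keys p \<union> keys q" by (auto simp: in_keys_iff lookup_minus)
  then show "eval_form (p - q) x = eval_form p x - eval_form q x"
    unfolding x by (subst (1 2 3) eval_form_superset[of "keys p \<union> keys q"])
      (auto simp: lookup_minus left_diff_distrib sum_subtractf)
qed

lemma eval_form_sum:
  assumes "finite B"
  shows "eval_form (\<Sum>b\<in>B. Const (c b) * b) = (\<lambda>x. \<Sum>b\<in>B. c b * eval_form b x)"
proof
  fix x :: "'k point"
  obtain g y where x: "x = (g, y)" by (cases x)
  let ?A = "\<Union>b\<in>B. keys b"
  have A: "finite ?A" using assms by simp
  have "keys (\<Sum>b\<in>B. Const (c b) * b) \<subseteq> ?A"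
    by (auto simp: in_keys_iff lookup_sum lookup_Const_mult) (metis (mono_tags, lifting) mult_zero_right sum.neutral)
  then have "eval_form (\<Sum>b\<in>B. Const (c b) * b) x = (\<Sum>m\<in>?A. \<Sum>b\<in>B. c b * (lookup b m * form_mono m g))"
    unfolding x by (subst eval_form_superset[OF A]) (simp_all add: lookup_sum lookup_Const_mult sum_distrib_right mult.assoc)
  also have "\<dots> = (\<Sum>b\<in>B. c b * (\<Sum>m\<in>?A. lookup b m * form_mono m g))"
    by (subst sum.swap) (simp add: sum_distrib_left)
  also have "\<dots> = (\<Sum>b\<in>B. c b * eval_form b x)"
    unfolding x by (intro sum.cong refl arg_cong2[of _ _ _ _ "(*)"] eval_form_superset[OF A, symmetric]) auto
  finally show "eval_form (\<Sum>b\<in>B. Const (c b) * b) x = (\<Sum>b\<in>B. c b * eval_form b x)" .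
qed

lemma mult_entry:
  "g \<in> carrier_mat r r \<Longrightarrow> i < r \<Longrightarrow> c < n \<Longrightarrow>
    (g * v) $$ (i, c) = mat_form r (\<lambda>k c. v $$ (k, c)) (\<lambda>k. g $$ (i, k)) c"
  using v by (simp add: scalar_prod_def mat_form_def atLeast0LessThan)

lemma mev_entries:
  assumes "keys m \<subseteq> {..<r} \<times> {..<n}" "g \<in> carrier_mat r r"
  shows "mev (\<lambda>x. (g * v) $$ x) m = form_mono m (\<lambda>i k. g $$ (i, k))"
  unfolding form_mono_def by (rule mev_cong) (use assms mult_entry[OF assms(2)] in auto)

lemma form_mono_cong:
  assumes "keys m \<subseteq> {..<r} \<times> {..<n}" "\<And>i k. i < r \<Longrightarrow> k < r \<Longrightarrow> g i k = h i k"
  shows "form_mono m g = form_mono m h"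
  unfolding form_mono_def mat_form_def
  by (rule mev_cong) (use assms in \<open>auto intro!: sum.cong\<close>)

text \<open>The invertible matrices are dense: \<open>g + \<epsilon> 1\<close> is invertible for all but finitely many \<open>\<epsilon>\<close>.\<close>

lemma eval_form_dense:
  assumes p: "p \<in> coord_ring r n"
    and inv: "\<And>g. g \<in> carrier_mat r r \<Longrightarrow> det g \<noteq> 0 \<Longrightarrow> eval_at (g * v) p = 0"
  shows "eval_form p (g, y) = 0"
proof -
  let ?G = "mat r r (\<lambda>(i, k). g i k)"
  let ?L = "mat_form r (\<lambda>k c. v $$ (k, c))"
  let ?\<delta> = "\<lambda>i k. if i = k then 1 else 0 :: 'k"
  \<comment> \<open>For fixed g a polynomial in the shift parameter, with values p at (g +
    \<epsilon> 1) v.\<close>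
  define P where "P = (\<Sum>m\<in>keys p. smult (lookup p m) (mev (\<lambda>x. [:?L (g (fst x)) (snd x), ?L (?\<delta> (fst x)) (snd x):]) m))"
  have keys: "keys m \<subseteq> {..<r} \<times> {..<n}" if "m \<in> keys p" for m
    using p that by (auto simp: polys_in_def)
  have P: "poly P \<epsilon> = (\<Sum>m\<in>keys p. lookup p m * form_mono m (\<lambda>i k. g i k + \<epsilon> * ?\<delta> i k))" for \<epsilon>
    by (simp add: P_def poly_sum form_mono_def mev_def poly_prod L_add L_scale)
  have G: "?G \<in> carrier_mat r r" by simp
  \<comment> \<open>\<open>char_matrix ?G \<epsilon>\<close> is \<open>?G\<close> minus \<epsilon>
    times the identity, hence the sign; it is invertible unless \<epsilon> is an eigenvalue.\<close>
  have "poly P (- \<epsilon>) = 0" if root: "poly (char_poly ?G) \<epsilon> \<noteq> 0" for \<epsilon>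
  proof -
    let ?H = "char_matrix ?G \<epsilon>"
    have H: "?H \<in> carrier_mat r r" by (rule char_matrix_closed[OF G])
    have "det ?H \<noteq> 0"
      using root eigenvalue_det[OF G, of \<epsilon>] eigenvalue_root_char_poly[OF G, of \<epsilon>] by simp
    then have "0 = eval_at (?H * v) p" using inv[OF H] by simp
    also have "\<dots> = (\<Sum>m\<in>keys p. lookup p m * form_mono m (\<lambda>i k. g i k + (- \<epsilon>) * ?\<delta> i k))"
      unfolding eval_at_mev
    proof (intro sum.cong refl arg_cong2[of _ _ _ _ "(*)"])
      fix m assume m: "m \<in> keys p"
      have "mev (\<lambda>x. (?H * v) $$ x) m = form_mono m (\<lambda>i k. ?H $$ (i, k))"
        by (rule mev_entries[OF keys[OF m] H])
      also have "\<dots> = form_mono m (\<lambda>i k. g i k + (- \<epsilon>) * ?\<delta> i k)"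
        by (rule form_mono_cong[OF keys[OF m]]) (simp add: char_matrix_def)
      finally show "mev (\<lambda>x. (?H * v) $$ x) m = form_mono m (\<lambda>i k. g i k + (- \<epsilon>) * ?\<delta> i k)" .
    qed
    finally show ?thesis by (simp add: P)
  qed
  then have "{\<epsilon>. poly P \<epsilon> \<noteq> 0} \<subseteq> uminus ` {\<epsilon>. poly (char_poly ?G) \<epsilon> = 0}"
    by (metis (mono_tags, lifting) image_eqI mem_Collect_eq minus_minus subsetI)
  moreover have "char_poly ?G \<noteq> 0" using degree_monic_char_poly[OF G] by auto
  ultimately have fin: "finite {\<epsilon>. poly P \<epsilon> \<noteq> 0}"
    using poly_roots_finite[of "char_poly ?G"] by (meson finite_imageI finite_subset)
  have "P = 0"
  proof (rule ccontr)
    assume "P \<noteq> 0"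
    then have "finite {\<epsilon>. poly P \<epsilon> = 0}" by (rule poly_roots_finite)
    then have "finite ({\<epsilon>. poly P \<epsilon> = 0} \<union> {\<epsilon>. poly P \<epsilon> \<noteq> 0})" using fin by (rule finite_UnI)
    moreover have "{\<epsilon>. poly P \<epsilon> = 0} \<union> {\<epsilon>. poly P \<epsilon> \<noteq> 0} = UNIV" by auto
    ultimately show False using infinite_UNIV_char_0[where 'a = 'k] by simp
  qed
  then show ?thesis using P[of 0] by (simp add: eval_form_def)
qed

text \<open>Column scalings multiply a homogeneous polynomial by the character of its degree, so
  vanishing on the orbit is a condition on the matrices g v alone, and density extends it from
  invertible to arbitrary g.\<close>

lemma vanishing_graded:
  assumes p: "p \<in> graded_piece r n d e"
  shows "p \<in> vanishing_ideal r n (orbit_closure r n v) \<longleftrightarrow> (\<forall>x. eval_form p x = 0)"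
proof -
  have pc: "p \<in> coord_ring r n" and deg: "\<And>m. m \<in> keys p \<Longrightarrow> multidegree d m = e"
    using p by (auto simp: graded_piece_def)
  have keys: "keys m \<subseteq> {..<r} \<times> {..<n}" if "m \<in> keys p" for m
    using pc that by (auto simp: polys_in_def)
  have orbit: "matrix_orbit r n v \<subseteq> carrier_mat r n"
    using v by (auto simp: matrix_orbit_def mat_diag_def)
  have "p \<in> vanishing_ideal r n (orbit_closure r n v) \<longleftrightarrow> (\<forall>w\<in>matrix_orbit r n v. eval_at w p = 0)"
    unfolding orbit_closure_def vanishing_ideal_closure[OF orbit] using pc by (simp add: vanishing_ideal_def)
  also have "\<dots> \<longleftrightarrow> (\<forall>x. eval_form p x = 0)"
  proof
    assume *: "\<forall>w\<in>matrix_orbit r n v. eval_at w p = 0"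
    have "eval_form p (g, y) = 0" for g y
      by (rule eval_form_dense[OF pc]) (use * matrix_orbit_memI[OF v] in blast)
    then show "\<forall>x. eval_form p x = 0" by auto
  next
    assume *: "\<forall>x. eval_form p x = 0"
    show "\<forall>w\<in>matrix_orbit r n v. eval_at w p = 0"
    proof
      fix w assume "w \<in> matrix_orbit r n v"
      then obtain g c where w: "w = g * v * mat_diag n c" and g: "g \<in> carrier_mat r r"
        by (auto simp: matrix_orbit_def)
      \<comment> \<open>Row variables become 1 and the offset d is undone, so the common multidegree
        e evaluates to the product of the column scalings.\<close>
      let ?\<sigma> = "\<lambda>x. case x of U i \<Rightarrow> 1 | T j \<Rightarrow> c (j - d)"
      have "mev (\<lambda>x. w $$ x) m = mev ?\<sigma> e * form_mono m (\<lambda>i k. g $$ (i, k))" if m: "m \<in> keys p" for m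
      proof -
        have "mev (\<lambda>x. w $$ x) m = mev (\<lambda>x. c (snd x) * (g * v) $$ x) m"
          using keys[OF m] g v unfolding w
          by (intro mev_cong) (auto simp: mat_diag_mult_right[of _ r n] mult.commute)
        also have "\<dots> = mev (\<lambda>x. c (snd x)) m * form_mono m (\<lambda>i k. g $$ (i, k))"
          by (simp add: mev_mult mev_entries[OF keys[OF m] g])
        also have "mev (\<lambda>x. c (snd x)) m = mev ?\<sigma> (multidegree d m)"
          by (simp add: multidegree_push mev_add mev_push_mono) (simp add: mev_def)
        finally show ?thesis by (simp add: deg[OF m])
      qed
      then have "eval_at w p = mev ?\<sigma> e * eval_form p (\<lambda>i k. g $$ (i, k), \<lambda>_ _. 0)"
        by (simp add: eval_at_mev eval_form_def sum_distrib_left mult_ac)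
      then show "eval_at w p = 0" using * by simp
    qed
  qed
  finally show ?thesis .
qed

text \<open>\<open>eval_form\<close> sends a monomial to its generator, so the standard monomials of
  degree e are a basis modulo the vanishing ideal. If e mentions a row beyond the first r, the
  graded piece is zero.\<close>

lemma hilbert_fun_hdim:
  "hilbert_fun r n d (orbit_closure r n v) e =
    (if keys e \<subseteq> ut_vars r then hdim 0 e else 0)"
proof -
  let ?V = "graded_piece r n d e :: (nat \<times> nat, 'k) mpoly set"
  define DM where "DM = {m. keys m \<subseteq> {..<r} \<times> {..<n} \<and> multidegree d m = e}"
  have DM: "DM = (if keys e \<subseteq> ut_vars r then degree_monos e else {})"
    by (auto simp: DM_def degree_monos_def keys_box_iff[of _ r n d])
  have V: "p \<in> ?V \<longleftrightarrow> keys p \<subseteq> DM" for p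
    by (auto simp: graded_piece_def polys_in_def DM_def)
  define S where "S = {m \<in> DM. std_mono m}"
  let ?s = "\<lambda>m. single m 1 :: (nat \<times> nat, 'k) mpoly"
  have finDM: "finite DM" using finite_degree_monos by (simp add: DM)
  have inj: "inj_on ?s S" by (rule inj_onI) (metis keys_single singleton_inject zero_neq_one)
  have Es: "eval_form (?s m) = gen m []" for m
    by (auto simp: eval_form_def gen_def odet_def fun_eq_iff)
  have S_ind: "indep_family S (\<lambda>m. gen m [])"
    using std_mono_basis(1,2)[of e] finite_degree_monos[of e]
    by (auto simp: S_def DM indep_family_iff fv.independent_empty)
  have S_span: "gen m [] \<in> fv.span ((\<lambda>m. gen m []) ` S)" if "m \<in> DM" for m
  proof -
    have ok: "DM = degree_monos e" using that by (auto simp: DM split: if_splits)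
    have "gen m [] \<in> fv.span (gens 0 e)" using that by (auto simp: ok gens_0 intro: fv.span_base)
    then show ?thesis by (simp add: S_def ok std_mono_basis(3))
  qed
  have "quotient_dim (vanishing_ideal r n (orbit_closure r n v)) ?V = card (?s ` S)"
  proof (rule quotient_dim_eq[where E = eval_form])
    show "(\<Sum>b\<in>B. Const (c b) * b) \<in> ?V" if "finite B" "B \<subseteq> ?V" for c B
    proof -
      have "m \<in> DM" if m: "m \<in> keys (\<Sum>b\<in>B. Const (c b) * b)" for m
      proof (rule ccontr)
        assume "m \<notin> DM"
        then have "lookup b m = 0" if "b \<in> B" for b
          using that \<open>B \<subseteq> ?V\<close> V by (auto simp: in_keys_iff subset_iff)
        then show False using m by (simp add: in_keys_iff lookup_sum lookup_Const_mult)
      qed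
      then show ?thesis by (auto simp: V)
    qed
    show "p - q \<in> ?V" if "p \<in> ?V" "q \<in> ?V" for p q
    proof -
      have "keys (p - q) \<subseteq> keys p \<union> keys q" by (auto simp: in_keys_iff lookup_minus)
      then show ?thesis using that unfolding V by blast
    qed
    show "indep_family (?s ` S) eval_form"
      using S_ind finDM inj by (subst (asm) indep_family_iff, simp add: S_def, subst indep_family_iff)
        (auto simp: S_def image_image Es inj_on_def)
    show "eval_form ` ?V \<subseteq> fv.span (eval_form ` ?s ` S)"
    proof safe
      fix p assume "p \<in> ?V"
      have "eval_form p = (\<Sum>m\<in>keys p. (\<lambda>x. lookup p m * gen m [] x))"
        by (auto simp: fun_eq_iff eval_form_def gen_def odet_def sum_fun_apply)
      also have "\<dots> \<in> fv.span ((\<lambda>m. gen m []) ` S)"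
        using \<open>p \<in> ?V\<close> by (intro fv.span_sum fv.span_scale S_span) (auto simp: V)
      finally show "eval_form p \<in> fv.span (eval_form ` ?s ` S)" by (simp add: image_image Es)
    qed
    show "?s ` S \<subseteq> ?V" by (auto simp: V S_def)
  qed (use finDM in \<open>auto simp: eval_form_sum eval_form_diff vanishing_graded S_def\<close>)
  also have "card (?s ` S) = card S" by (rule card_image[OF inj])
  also have "card S = (if keys e \<subseteq> ut_vars r then hdim 0 e else 0)"
    by (simp add: S_def DM hdim_std_mono)
  finally show ?thesis by (simp add: hilbert_fun_def)
qed

section \<open>From truncated series to K-polynomials\<close>

abbreviation numerator :: "nat \<Rightarrow> nat \<Rightarrow> (kvar, int) mpoly" where
  "numerator m D \<equiv> hpoly 0 m D * linear_factors m {d..<d + n}"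

text \<open>The coefficient at e involves only series coefficients at degrees a with a + b = e, for
  which truncation at \<open>tdeg e\<close> has no effect.\<close>

lemma K_poly_eqI:
  assumes K: "\<And>D. tlow D K (numerator r D)"
  shows "K_poly r n d (orbit_closure r n v) = K"
proof -
  have "(\<Sum>(a, b) | a + b = e. int (hilbert_fun r n d (orbit_closure r n v) a) *
      lookup (\<Prod>i<r. \<Prod>j<n. 1 - Var (U i) * Var (T (d + j))) b) = lookup K e" for e
  proof -
    have "lookup K e = lookup (numerator r (tdeg e)) e" using K[of "tdeg e"] by (simp add: tlow_def)
    also have "\<dots> = (\<Sum>(a, b)\<in>antidiagonal e. lookup (hpoly 0 r (tdeg e)) a * lookup (linear_factors r {d..<d + n}) b)"
      by (rule lookup_mult_antidiagonal)
    also have "\<dots> = (\<Sum>(a, b)\<in>antidiagonal e. int (hilbert_fun r n d (orbit_closure r n v) a) *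
        lookup (linear_factors r {d..<d + n}) b)"
      by (intro sum.cong refl) (auto simp: antidiagonal_def lookup_hpoly hilbert_fun_hdim tdeg_add)
    finally show ?thesis by (simp add: linear_factors_shift antidiagonal_def)
  qed
  then show ?thesis
    unfolding K_poly_def by (intro the_equality) (auto intro: poly_mapping_eqI)
qed

lemma tlow_sym_polys:
  assumes K: "\<And>D. tlow D K (numerator m D)"
  shows "K \<in> sym_polys m"
proof -
  have Q: "numerator m D \<in> sym_polys m" for D
    by (intro sym_polys_mult hpoly_sym linear_factors_sym)
  have K': "lookup K e = lookup (numerator m D) e" if "tdeg e \<le> D" for e D
    using K[of D] that by (simp add: tlow_def)
  have "keys e \<subseteq> ut_vars m" if "e \<in> keys K" for e
  proof -
    have "e \<in> keys (numerator m (tdeg e))" using that K'[of e "tdeg e"] by (simp add: in_keys_iff)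
    then show ?thesis using Q[of "tdeg e"] by (simp add: sym_polys_def polys_in_def)
  qed
  moreover have "lookup K (Poly_Mapping.map_key (permute_u \<pi>) a) = lookup K a" if "\<pi> permutes {..<m}" for \<pi> a
  proof -
    let ?b = "Poly_Mapping.map_key (permute_u \<pi>) a"
    \<comment> \<open>One truncation level has to cover both the degree and its permuted copy; the
      sum of their t-degrees does.\<close>
    have "lookup (numerator m (tdeg a + tdeg ?b)) ?b = lookup (numerator m (tdeg a + tdeg ?b)) a"
      using Q that unfolding sym_polys_def by blast
    then show ?thesis using K'[of a "tdeg a + tdeg ?b"] K'[of ?b "tdeg a + tdeg ?b"] by simp
  qed
  ultimately show ?thesis by (simp add: sym_polys_def polys_in_def)
qed

text \<open>The iteration starts with r rows, the least number for which \<open>rho_hpoly\<close> is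
  available. Symmetry is carried along because \<open>rho\<close> is controlled on symmetric
  polynomials only.\<close>

lemma tlow_rho_iter:
  assumes K: "\<And>D. tlow D K (numerator r D)"
  shows "tlow D (rho_iter {d..<d + n} r s K) (numerator (r + s) D)"
proof -
  have "rho_iter {d..<d + n} r s K \<in> sym_polys (r + s) \<and>
      (\<forall>D. tlow D (rho_iter {d..<d + n} r s K) (numerator (r + s) D))"
  proof (induction s)
    case 0
    then show ?case using K tlow_sym_polys[OF K] by simp
  next
    case (Suc s)
    have Q: "numerator (r + s) D \<in> sym_polys (r + s)" for D
      by (intro sym_polys_mult hpoly_sym linear_factors_sym)
    have "tlow D (rho {d..<d + n} (r + s) (rho_iter {d..<d + n} r s K)) (numerator (Suc (r + s)) D)" for D
      using tlow_rho[of _ "r + s" "numerator (r + s) D" "{d..<d + n}" D] Suc Q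
        rho_hpoly[of "r + s" "{d..<d + n}" D] by simp
    then show ?case using rho(1)[of _ "r + s" "{d..<d + n}"] Suc by simp
  qed
  then show ?thesis by blast
qed

end

theorem corollary7p2:
  fixes v1 v2 :: "'k::{alg_closed_field, field_char_0} mat"
    and r1 n1 r2 n2 :: nat
  assumes "v1 \<in> carrier_mat r1 n1" and "v2 \<in> carrier_mat r2 n2"
  shows "K_poly (r1 + r2) (n1 + n2) 0 (orbit_closure (r1 + r2) (n1 + n2) (mat_direct_sum v1 v2)) =
         rho_iter {..<n1} r1 r2 (K_poly r1 n1 0 (orbit_closure r1 n1 v1)) *
         rho_iter {n1..<n1 + n2} r2 r1 (K_poly r2 n2 n1 (orbit_closure r2 n2 v2))"
proof -
  let ?v = "mat_direct_sum v1 v2"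
  have vs: "?v \<in> carrier_mat (r1 + r2) (n1 + n2)"
    using assms by (simp add: mat_direct_sum_def)
  interpret A: matrix_forms v1 r1 n1 0 by unfold_locales (rule assms(1))
  interpret B: matrix_forms v2 r2 n2 n1 by unfold_locales (rule assms(2))
  interpret C: matrix_forms ?v "r1 + r2" "n1 + n2" 0 by unfold_locales (rule vs)
  interpret S: row_forms_sum "mat_form r1 (\<lambda>k c. v1 $$ (k, c))" "mat_form r2 (\<lambda>k c. v2 $$ (k, c))"
    "mat_form (r1 + r2) (\<lambda>k c. ?v $$ (k, c))" n1 r1 n2 r2 "r1 + r2"
    "\<lambda>x. x" "\<lambda>x k. x (k + r1)" "\<lambda>x y k. if k < r1 then x k else y (k - r1)"
  proof
    have split: "(\<Sum>k<r1 + r2. f k) = (\<Sum>k<r1. f k) + (\<Sum>k<r2. f (k + r1))" for f :: "nat \<Rightarrow> 'k"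
      by (induction r2) (simp_all add: add_ac)
    show "mat_form (r1 + r2) (\<lambda>k c. ?v $$ (k, c)) x c = mat_form r1 (\<lambda>k c. v1 $$ (k, c)) x c"
      if "c < n1" for c x
      using that assms by (simp add: mat_form_def split mat_direct_sum_def)
    show "mat_form (r1 + r2) (\<lambda>k c. ?v $$ (k, c)) x (c + n1) = mat_form r2 (\<lambda>k c. v2 $$ (k, c)) (\<lambda>k. x (k + r1)) c"
      if "c < n2" for c x
      using that assms by (simp add: mat_form_def split mat_direct_sum_def)
  qed (auto simp: mat_form_def fun_eq_iff intro!: sum.cong)
  obtain K1 where K1: "\<And>D. tlow D K1 (A.numerator r1 D)" using A.K_polynomial_exists by blast
  obtain K2 where K2: "\<And>D. tlow D K2 (B.numerator r2 D)" using B.K_polynomial_exists by blast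
  let ?R1 = "rho_iter {0..<0 + n1} r1 r2 K1" and ?R2 = "rho_iter {n1..<n1 + n2} r2 r1 K2"
  have "tlow D (?R1 * ?R2) (C.numerator (r1 + r2) D)" for D
  proof -
    have "{0..<0 + (n1 + n2)} = {0..<0 + n1} \<union> {n1..<n1 + n2}" by auto
    then have factors: "linear_factors (r1 + r2) {0..<0 + (n1 + n2)} =
        linear_factors (r1 + r2) {0..<0 + n1} * linear_factors (r1 + r2) {n1..<n1 + n2}"
      by (simp add: linear_factors_def prod.union_disjoint flip: prod.distrib)
    \<comment> \<open>Both factors arrive at r1 + r2 rows, one after r2 applications of
      \<open>rho\<close> and the other after r1.\<close>
    have "tlow D (?R1 * ?R2) (A.numerator (r1 + r2) D * B.numerator (r2 + r1) D)"
      by (intro tlow_mult A.tlow_rho_iter B.tlow_rho_iter K1 K2)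
    also have "A.numerator (r1 + r2) D * B.numerator (r2 + r1) D =
        (A.hpoly 0 (r1 + r2) D * B.hpoly 0 (r1 + r2) D) * linear_factors (r1 + r2) {0..<0 + (n1 + n2)}"
      unfolding factors add.commute[of r2 r1] by (simp only: mult_ac)
    finally have "tlow D (?R1 * ?R2)
        ((A.hpoly 0 (r1 + r2) D * B.hpoly 0 (r1 + r2) D) * linear_factors (r1 + r2) {0..<0 + (n1 + n2)})" .
    moreover have "tlow D (C.numerator (r1 + r2) D)
        ((A.hpoly 0 (r1 + r2) D * B.hpoly 0 (r1 + r2) D) * linear_factors (r1 + r2) {0..<0 + (n1 + n2)})"
      by (intro tlow_mult S.hpoly_sum) (simp add: tlow_def)
    ultimately show ?thesis unfolding tlow_def by presburger
  qed
  then have "K_poly (r1 + r2) (n1 + n2) 0 (orbit_closure (r1 + r2) (n1 + n2) ?v) = ?R1 * ?R2"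
    by (rule C.K_poly_eqI)
  moreover have "K_poly r1 n1 0 (orbit_closure r1 n1 v1) = K1" by (rule A.K_poly_eqI[OF K1])
  moreover have "K_poly r2 n2 n1 (orbit_closure r2 n2 v2) = K2" by (rule B.K_poly_eqI[OF K2])
  ultimately show ?thesis by (simp add: lessThan_atLeast0)
qed

end
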